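(* Let $R$ be the valuation ring, with maximal ideal $\mathfrak{m}$, of a Henselian valued field $K$ of equicharacteristic zero. Let $0 \leq r < n$, let $p=(p_{r+1},\ldots,p_{n})$ be an $(n-r)$-tuple of polynomials $p_{r+1},\ldots,p_{n} \in R[X]$, $X=(X_{1},\ldots,X_{n})$, and put $$ J := \frac{\partial(p_{r+1},\ldots,p_{n})}{\partial(X_{r+1},\ldots,X_{n})}, \quad e := J(\mathbf{0}). $$ Suppose that $$ \mathbf{0} \in V := \{x \in R^{n}: p_{r+1}(x) = \ldots = p_{n}(x) = 0\}. $$ If $e \neq 0$, then there exists a unique continuous map $$ \phi: (e^{2}\cdot\mathfrak{m})^{\times r} \longrightarrow (e\cdot\mathfrak{m})^{\times(n-r)} $$ which is definable in the language of valued fields and such that $\phi(0)=0$ and the graph map $$ (e^{2}\cdot\mathfrak{m})^{\times r} \ni u \longmapsto (u,\phi(u)) \in (e^{2}\cdot\mathfrak{m})^{\times r} \times (e\cdot\mathfrak{m})^{\times(n-r)} $$ is an open embedding into the zero locus $V$ and, more precisely, onto $$ V \cap \left[(e^{2}\cdot\mathfrak{m})^{\times r} \times (e\cdot\mathfrak{m})^{\times(n-r)}\right]. $$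
   Context: The topology is the valuation topology on $K$ (product topology on powers, induced topology on subsets). For an ideal $\mathfrak{a}$ of $R$, $\mathfrak{a}^{\times k}$ denotes its $k$-fold Cartesian product; $\mathbf{0}$ is the origin of $R^{n}$; $J$ is the determinant of the Jacobian matrix. Definability is with parameters. *)

theory Defs
  imports
    "HOL-Library.Poly_Mapping"
    "HOL-Library.FuncSet"
    "HOL-Computational_Algebra.Polynomial"
    "HOL-Analysis.Finite_Product_Measure"
    "Jordan_Normal_Form.Determinant"
begin

section \<open>Valued fields\<close>

text \<open>
  A (Krull) valuation is written additively, with values in an arbitrary linearly ordered abelian
  group. The value of \<open>v\<close> at \<open>0\<close> stands for infinity and carries no information, so every
  condition below treats \<open>0\<close> separately. The map \<open>v\<close> need not be onto: the value group is the
  image of the nonzero elements.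
\<close>

definition valuation :: "('a::field \<Rightarrow> 'g::linordered_ab_group_add) \<Rightarrow> bool" where
  "valuation v \<longleftrightarrow>
     (\<forall>x y. x \<noteq> 0 \<longrightarrow> y \<noteq> 0 \<longrightarrow> v (x * y) = v x + v y) \<and>
     (\<forall>x y. x \<noteq> 0 \<longrightarrow> y \<noteq> 0 \<longrightarrow> x + y \<noteq> 0 \<longrightarrow> min (v x) (v y) \<le> v (x + y))"

definition valuation_ring :: "('a::field \<Rightarrow> 'g::linordered_ab_group_add) \<Rightarrow> 'a set" where
  "valuation_ring v = {x. x = 0 \<or> 0 \<le> v x}"

definition valuation_ideal :: "('a::field \<Rightarrow> 'g::linordered_ab_group_add) \<Rightarrow> 'a set" where
  "valuation_ideal v = {x. x = 0 \<or> 0 < v x}"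

definition henselian :: "('a::field \<Rightarrow> 'g::linordered_ab_group_add) \<Rightarrow> bool" where
  "henselian v \<longleftrightarrow>
     (\<forall>f a. (\<forall>i. poly.coeff f i \<in> valuation_ring v) \<longrightarrow> a \<in> valuation_ring v \<longrightarrow>
        poly f a \<in> valuation_ideal v \<longrightarrow> poly (pderiv f) a \<notin> valuation_ideal v \<longrightarrow>
        (\<exists>b\<in>valuation_ring v. poly f b = 0 \<and> b - a \<in> valuation_ideal v))"

text \<open>The second conjunct says that no positive multiple of \<open>1\<close> vanishes in the residue field.\<close>

definition equichar_zero :: "('a::field \<Rightarrow> 'g::linordered_ab_group_add) \<Rightarrow> bool" where
  "equichar_zero v \<longleftrightarrow> CHAR('a) = 0 \<and> (\<forall>k::nat. 0 < k \<longrightarrow> of_nat k \<notin> valuation_ideal v)"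

text \<open>
  The radii of balls range over the value group of \<open>v\<close>, and not over all of the type \<open>'g\<close>:
  if the value group is not cofinal in \<open>'g\<close>, the latter would give the discrete topology.
\<close>

definition valuation_ball ::
  "('a::field \<Rightarrow> 'g::linordered_ab_group_add) \<Rightarrow> 'a \<Rightarrow> 'g \<Rightarrow> 'a set" where
  "valuation_ball v a \<gamma> = {x. x = a \<or> \<gamma> < v (x - a)}"

definition valuation_topology ::
  "('a::field \<Rightarrow> 'g::linordered_ab_group_add) \<Rightarrow> 'a topology" where
  "valuation_topology v =
     topology (\<lambda>U. \<forall>a\<in>U. \<exists>\<gamma>\<in>v ` {c. c \<noteq> 0}. valuation_ball v a \<gamma> \<subseteq> U)"

lemma openin_valuation_topology:
  "openin (valuation_topology v) U \<longleftrightarrow>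
     (\<forall>a\<in>U. \<exists>\<gamma>\<in>v ` {c. c \<noteq> 0}. valuation_ball v a \<gamma> \<subseteq> U)"
proof -
  let ?P = "\<lambda>U. \<forall>a\<in>U. \<exists>\<gamma>\<in>v ` {c. c \<noteq> 0}. valuation_ball v a \<gamma> \<subseteq> U"
  have "istopology ?P"
    unfolding istopology_def
  proof (intro conjI allI impI)
    fix S T assume S: "?P S" and T: "?P T"
    show "?P (S \<inter> T)"
    proof
      fix a assume "a \<in> S \<inter> T"
      then have "a \<in> S" "a \<in> T" by simp_all
      obtain \<gamma> where g: "\<gamma> \<in> v ` {c. c \<noteq> 0}" "valuation_ball v a \<gamma> \<subseteq> S"
        using bspec[OF S \<open>a \<in> S\<close>] by (rule bexE)
      obtain \<delta> where d: "\<delta> \<in> v ` {c. c \<noteq> 0}" "valuation_ball v a \<delta> \<subseteq> T"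
        using bspec[OF T \<open>a \<in> T\<close>] by (rule bexE)
      have "max \<gamma> \<delta> \<in> v ` {c. c \<noteq> 0}"
        using g(1) d(1) by (simp add: max_def)
      moreover have "valuation_ball v a (max \<gamma> \<delta>) \<subseteq> S \<inter> T"
        using g(2) d(2) by (fastforce simp: valuation_ball_def)
      ultimately show "\<exists>\<gamma>\<in>v ` {c. c \<noteq> 0}. valuation_ball v a \<gamma> \<subseteq> S \<inter> T"
        by (rule bexI[rotated])
    qed
  next
    fix \<K> assume P: "\<forall>K\<in>\<K>. ?P K"
    show "?P (\<Union>\<K>)"
    proof
      fix a assume "a \<in> \<Union>\<K>"
      then obtain K where K: "K \<in> \<K>" "a \<in> K" by (rule UnionE)
      then obtain \<gamma> where "\<gamma> \<in> v ` {c. c \<noteq> 0}" "valuation_ball v a \<gamma> \<subseteq> K"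
        using P by meson
      moreover have "K \<subseteq> \<Union>\<K>" using K(1) by (rule Union_upper)
      ultimately show "\<exists>\<gamma>\<in>v ` {c. c \<noteq> 0}. valuation_ball v a \<gamma> \<subseteq> \<Union>\<K>"
        by (meson order_trans)
    qed
  qed
  then show ?thesis
    by (simp add: valuation_topology_def topology_inverse')
qed

lemma topspace_valuation_topology [simp]: "topspace (valuation_topology v) = UNIV"
proof -
  have "openin (valuation_topology v) UNIV"
    unfolding openin_valuation_topology
  proof
    fix a :: 'a
    have "v 1 \<in> v ` {c. c \<noteq> 0}" by simp
    then show "\<exists>\<gamma>\<in>v ` {c. c \<noteq> 0}. valuation_ball v a \<gamma> \<subseteq> UNIV"
      by (rule bexI[rotated]) simp
  qed
  then show ?thesis
    using openin_subset by blast
qed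

text \<open>
  The powers \<open>K\<^sup>n\<close> are the function spaces \<open>I \<rightarrow>\<^sub>E UNIV\<close> over index sets \<open>I\<close> of naturals
  with the product topology. Coordinates are labelled from \<open>1\<close>: the set \<open>I\<close> is \<open>{1..n}\<close> for the whole
  space, \<open>{1..r}\<close> for its first \<open>r\<close> and \<open>{r+1..n}\<close> for its last \<open>n - r\<close> coordinates.
\<close>

abbreviation affine_topology ::
  "('a::field \<Rightarrow> 'g::linordered_ab_group_add) \<Rightarrow> nat set \<Rightarrow> (nat \<Rightarrow> 'a) topology" where
  "affine_topology v I \<equiv> product_topology (\<lambda>_. valuation_topology v) I"

definition origin :: "nat set \<Rightarrow> nat \<Rightarrow> 'a::zero" where
  "origin I = (\<lambda>i\<in>I. 0)"


section \<open>Polynomials in several variables\<close>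

text \<open>A monomial is its exponent vector; the variable \<open>X\<^sub>i\<close> is indexed by \<open>i :: nat\<close>.\<close>

type_synonym 'a mpolynomial = "(nat \<Rightarrow>\<^sub>0 nat) \<Rightarrow>\<^sub>0 'a"

definition mpolys_over :: "'a::comm_ring_1 set \<Rightarrow> nat set \<Rightarrow> 'a mpolynomial set" where
  "mpolys_over A I =
     {f. (\<forall>m. Poly_Mapping.lookup f m \<in> A) \<and>
         (\<forall>m\<in>Poly_Mapping.keys f. Poly_Mapping.keys m \<subseteq> I)}"

definition mpoly_eval :: "'a::comm_ring_1 mpolynomial \<Rightarrow> (nat \<Rightarrow> 'a) \<Rightarrow> 'a" where
  "mpoly_eval f x =
     (\<Sum>m\<in>Poly_Mapping.keys f. Poly_Mapping.lookup f m *
        (\<Prod>i\<in>Poly_Mapping.keys m. x i ^ Poly_Mapping.lookup m i))"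

text \<open>The truncated exponent for monomials without \<open>X\<^sub>i\<close> comes with coefficient \<open>0\<close>.\<close>

definition mpoly_pderiv :: "nat \<Rightarrow> 'a::comm_ring_1 mpolynomial \<Rightarrow> 'a mpolynomial" where
  "mpoly_pderiv i f =
     (\<Sum>m\<in>Poly_Mapping.keys f.
        Poly_Mapping.single (m - Poly_Mapping.single i 1)
          (of_nat (Poly_Mapping.lookup m i) * Poly_Mapping.lookup f m))"

text \<open>Matrix indices start at \<open>0\<close>: the entry \<open>(i, j)\<close> is the derivative of \<open>p\<^bsub>r+1+i\<^esub>\<close>
  with respect to \<open>X\<^bsub>r+1+j\<^esub>\<close>.\<close>

definition jacobian_det ::
  "nat \<Rightarrow> nat \<Rightarrow> (nat \<Rightarrow> 'a::comm_ring_1 mpolynomial) \<Rightarrow> 'a mpolynomial" where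
  "jacobian_det r n p =
     Determinant.det (mat (n - r) (n - r) (\<lambda>(i, j). mpoly_pderiv (r + 1 + j) (p (r + 1 + i))))"


section \<open>Definability in the language of valued fields\<close>

text \<open>
  First-order formulas in the language of rings expanded by a unary predicate for the valuation
  ring, with named variables and with a constant for every element of the field (parameters).
\<close>

datatype 'a vf_term =
    Var nat
  | Const 'a
  | Plus "'a vf_term" "'a vf_term"
  | Minus "'a vf_term" "'a vf_term"
  | Times "'a vf_term" "'a vf_term"

datatype 'a vf_formula =
    Equal "'a vf_term" "'a vf_term"
  | InRing "'a vf_term"
  | Neg "'a vf_formula"
  | Conj "'a vf_formula" "'a vf_formula"
  | Exists nat "'a vf_formula"

primrec vf_term_val :: "'a::field vf_term \<Rightarrow> (nat \<Rightarrow> 'a) \<Rightarrow> 'a" where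
  "vf_term_val (Var i) x = x i"
| "vf_term_val (Const c) x = c"
| "vf_term_val (Plus s t) x = vf_term_val s x + vf_term_val t x"
| "vf_term_val (Minus s t) x = vf_term_val s x - vf_term_val t x"
| "vf_term_val (Times s t) x = vf_term_val s x * vf_term_val t x"

primrec vf_sat ::
  "('a::field \<Rightarrow> 'g::linordered_ab_group_add) \<Rightarrow> 'a vf_formula \<Rightarrow> (nat \<Rightarrow> 'a) \<Rightarrow> bool" where
  "vf_sat v (Equal s t) x \<longleftrightarrow> vf_term_val s x = vf_term_val t x"
| "vf_sat v (InRing t) x \<longleftrightarrow> vf_term_val t x \<in> valuation_ring v"
| "vf_sat v (Neg F) x \<longleftrightarrow> \<not> vf_sat v F x"
| "vf_sat v (Conj F G) x \<longleftrightarrow> vf_sat v F x \<and> vf_sat v G x"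
| "vf_sat v (Exists i F) x \<longleftrightarrow> (\<exists>c. vf_sat v F (x(i := c)))"

primrec vf_term_vars :: "'a vf_term \<Rightarrow> nat set" where
  "vf_term_vars (Var i) = {i}"
| "vf_term_vars (Const c) = {}"
| "vf_term_vars (Plus s t) = vf_term_vars s \<union> vf_term_vars t"
| "vf_term_vars (Minus s t) = vf_term_vars s \<union> vf_term_vars t"
| "vf_term_vars (Times s t) = vf_term_vars s \<union> vf_term_vars t"

primrec vf_free_vars :: "'a vf_formula \<Rightarrow> nat set" where
  "vf_free_vars (Equal s t) = vf_term_vars s \<union> vf_term_vars t"
| "vf_free_vars (InRing t) = vf_term_vars t"
| "vf_free_vars (Neg F) = vf_free_vars F"
| "vf_free_vars (Conj F G) = vf_free_vars F \<union> vf_free_vars G"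
| "vf_free_vars (Exists i F) = vf_free_vars F - {i}"

definition vf_definable ::
  "('a::field \<Rightarrow> 'g::linordered_ab_group_add) \<Rightarrow> nat set \<Rightarrow> (nat \<Rightarrow> 'a) set \<Rightarrow> bool" where
  "vf_definable v I S \<longleftrightarrow>
     (\<exists>F. vf_free_vars F \<subseteq> I \<and> S = {x \<in> I \<rightarrow>\<^sub>E UNIV. vf_sat v F x})"

text \<open>
  A map from a subset \<open>D\<close> of \<open>K\<^sup>I\<close> to \<open>K\<^sup>J\<close>, with \<open>I\<close> and \<open>J\<close> disjoint, is definable if its
  graph is; \<^const>\<open>merge\<close> identifies the product of \<open>K\<^sup>I\<close> and \<open>K\<^sup>J\<close> with the
  functions on \<open>I \<union> J\<close>.
\<close>

definition graph_map ::
  "nat set \<Rightarrow> nat set \<Rightarrow> ((nat \<Rightarrow> 'a) \<Rightarrow> (nat \<Rightarrow> 'a)) \<Rightarrow> (nat \<Rightarrow> 'a) \<Rightarrow> (nat \<Rightarrow> 'a)" where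
  "graph_map I J \<phi> u = merge I J (u, \<phi> u)"

definition vf_definable_map ::
  "('a::field \<Rightarrow> 'g::linordered_ab_group_add) \<Rightarrow> nat set \<Rightarrow> nat set \<Rightarrow> (nat \<Rightarrow> 'a) set \<Rightarrow>
     ((nat \<Rightarrow> 'a) \<Rightarrow> (nat \<Rightarrow> 'a)) \<Rightarrow> bool" where
  "vf_definable_map v I J D \<phi> \<longleftrightarrow> vf_definable v (I \<union> J) (graph_map I J \<phi> ` D)"

end

theory Submission
  imports Defs
begin

text \<open>
  After the substitution \<open>y = e z\<close> and multiplication by the adjugate of the Jacobian matrix at the
  origin, the system becomes \<open>Q z = 0\<close> with \<open>Q\<close> a polynomial map on \<open>\<mm>\<^sup>N\<close>, \<open>N = n - r\<close>, whose
  Jacobian matrix is congruent to the identity modulo \<open>\<mm>\<close>. Such a map is isometric, which gives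
  uniqueness and continuity of the solution; existence is the multidimensional Hensel lemma, which has
  to be derived from the one for a single polynomial. The field is not assumed complete, so Newton
  approximation does not converge.

  Suppose \<open>Q\<close> has no zero, and call \<open>t\<close> a level if \<open>Q x \<in> t R\<^sup>N\<close> for some \<open>x\<close>. A Newton step
  shows that levels are closed under squaring, so the elements of \<open>R\<close> that are not levels form a prime
  ideal \<open>\<tau>\<close>. By counting monomials, each coordinate \<open>x\<^sub>k\<close> satisfies an algebraic relation
  \<open>F (Q x, x\<^sub>k) = 0\<close>; evaluating it at points with suitably prescribed values of \<open>Q\<close> isolates a
  polynomial \<open>f\<close> in one variable, not all of whose coefficients lie in \<open>\<tau>\<close>, such that \<open>f x\<^sub>k \<in> t R\<close>
  whenever \<open>Q x \<in> t R\<^sup>N\<close>. If the degree of \<open>f\<close> is minimal, then \<open>f'\<close> does not have this property,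
  because the residue field has characteristic zero, and Hensel's lemma yields a root of \<open>f\<close> that
  approximates all these \<open>x\<^sub>k\<close>. The vector of these roots is a point at which \<open>Q\<close> takes values in
  \<open>t R\<^sup>N\<close> for every level \<open>t\<close>; but a nonzero value of \<open>Q\<close> is itself a level, and so is its square.
\<close>

section \<open>Valuation rings\<close>

text \<open>The value group is discarded until the topology is needed: divisibility, written
  \<open>a \<in> principal t\<close>, takes the place of the inequality v(a) \<ge> v(t), and 0 is
  simply divisible by every \<open>t\<close>.\<close>

locale valuation_subring =
  fixes R :: "'k::field set"
  assumes one_mem: "1 \<in> R"
    and diff_mem: "a \<in> R \<Longrightarrow> b \<in> R \<Longrightarrow> a - b \<in> R"
    and mult_mem: "a \<in> R \<Longrightarrow> b \<in> R \<Longrightarrow> a * b \<in> R"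
    and mem_or_inverse_mem: "a \<in> R \<or> inverse a \<in> R"
begin

text \<open>0 is listed separately because \<open>inverse 0 = 0\<close> lies in
  \<open>R\<close>.\<close>

definition maximal_ideal :: "'k set" where
  "maximal_ideal = {a \<in> R. a = 0 \<or> inverse a \<notin> R}"

text \<open>\<open>t\<close> ranges over the whole field: fractional ideals such as the one
  generated by \<open>s / e\<^sup>2\<close> occur in the Lipschitz estimates.\<close>

definition principal :: "'k \<Rightarrow> 'k set" where
  "principal t = (*) t ` R"

lemma zero_mem: "0 \<in> R"
  using diff_mem[OF one_mem one_mem] by simp

lemma uminus_mem: "a \<in> R \<Longrightarrow> - a \<in> R"
  using diff_mem[OF zero_mem] by simp

lemma add_mem: "a \<in> R \<Longrightarrow> b \<in> R \<Longrightarrow> a + b \<in> R"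
  using diff_mem[of a "- b"] uminus_mem by simp

lemma power_mem: "a \<in> R \<Longrightarrow> a ^ n \<in> R"
  by (induction n) (auto simp: one_mem mult_mem)

lemma sum_mem: "(\<And>i. i \<in> A \<Longrightarrow> f i \<in> R) \<Longrightarrow> sum f A \<in> R"
  by (induction A rule: infinite_finite_induct) (auto simp: zero_mem add_mem)

lemma prod_mem: "(\<And>i. i \<in> A \<Longrightarrow> f i \<in> R) \<Longrightarrow> prod f A \<in> R"
  by (induction A rule: infinite_finite_induct) (auto simp: one_mem mult_mem)

lemma of_nat_mem: "of_nat n \<in> R"
  by (induction n) (auto simp: zero_mem one_mem add_mem)

lemmas ring_mem = zero_mem one_mem uminus_mem add_mem diff_mem mult_mem power_mem of_nat_mem

lemma principal_one [simp]: "principal 1 = R"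
  by (simp add: principal_def)

lemma principal_zero: "a \<in> principal 0 \<longleftrightarrow> a = 0"
  using zero_mem by (auto simp: principal_def)

lemma mem_principal_iff: "t \<noteq> 0 \<Longrightarrow> a \<in> principal t \<longleftrightarrow> a / t \<in> R"
  by (force simp: principal_def)

lemma principalI: "c \<in> R \<Longrightarrow> t * c \<in> principal t"
  unfolding principal_def by (rule imageI)

lemma principal_self: "t \<in> principal t"
  using principalI[OF one_mem] by simp

lemma zero_principal: "0 \<in> principal t"
  using principalI[OF zero_mem] by simp

lemma add_principal: "a \<in> principal t \<Longrightarrow> b \<in> principal t \<Longrightarrow> a + b \<in> principal t"
  unfolding principal_def using add_mem by (auto simp: image_iff simp flip: distrib_left)

lemma mult_principal: "a \<in> principal s \<Longrightarrow> b \<in> principal t \<Longrightarrow> a * b \<in> principal (s * t)"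
proof -
  assume "a \<in> principal s" "b \<in> principal t"
  then obtain c d where "a = s * c" "b = t * d" "c \<in> R" "d \<in> R"
    by (auto simp: principal_def)
  then have "a * b = s * t * (c * d)" "c * d \<in> R" by (simp_all add: mult_mem)
  then show ?thesis using principalI by metis
qed

lemma uminus_principal: "a \<in> principal t \<Longrightarrow> - a \<in> principal t"
  using mult_principal[of "-1" 1 a t] uminus_mem[OF one_mem] by simp

lemma diff_principal: "a \<in> principal t \<Longrightarrow> b \<in> principal t \<Longrightarrow> a - b \<in> principal t"
  using add_principal[of a t "- b"] uminus_principal by simp

lemma mult_principal_left: "c \<in> R \<Longrightarrow> a \<in> principal t \<Longrightarrow> c * a \<in> principal t"
  using mult_principal[of c 1 a t] by simp

lemma mult_principal_right: "a \<in> principal t \<Longrightarrow> c \<in> R \<Longrightarrow> a * c \<in> principal t"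
  using mult_principal[of a t c 1] by simp

lemma sum_principal: "(\<And>i. i \<in> A \<Longrightarrow> f i \<in> principal t) \<Longrightarrow> sum f A \<in> principal t"
  by (induction A rule: infinite_finite_induct) (auto simp: zero_principal add_principal)

lemma principal_subset: "s \<in> principal t \<Longrightarrow> a \<in> principal s \<Longrightarrow> a \<in> principal t"
proof -
  assume "s \<in> principal t" "a \<in> principal s"
  then obtain c d where "s = t * c" "a = s * d" "c \<in> R" "d \<in> R"
    by (auto simp: principal_def)
  then have "a = t * (c * d)" "c * d \<in> R" by (simp_all add: mult_mem mult.assoc)
  then show ?thesis using principalI by metis
qed

lemma principal_mem: "t \<in> R \<Longrightarrow> a \<in> principal t \<Longrightarrow> a \<in> R"
  by (auto simp: principal_def mult_mem)

lemma principal_total: "a \<in> principal b \<or> b \<in> principal a"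
proof (cases "a = 0 \<or> b = 0")
  case False
  then show ?thesis
    using mem_or_inverse_mem[of "a / b"] by (auto simp: mem_principal_iff)
qed (auto simp: zero_principal)

lemma principal_mult_cancel: "c \<noteq> 0 \<Longrightarrow> c * a \<in> principal (c * t) \<longleftrightarrow> a \<in> principal t"
  by (auto simp: principal_def image_iff)

lemma power_principal: "t \<in> R \<Longrightarrow> m \<le> n \<Longrightarrow> t ^ n \<in> principal (t ^ m)"
  using principalI[of "t ^ (n - m)" "t ^ m"] by (simp add: power_mem flip: power_add)

lemma maximal_ideal_mem: "a \<in> maximal_ideal \<Longrightarrow> a \<in> R"
  by (simp add: maximal_ideal_def)

lemma zero_maximal_ideal: "0 \<in> maximal_ideal"
  by (simp add: maximal_ideal_def zero_mem)

lemma one_not_maximal_ideal: "1 \<notin> maximal_ideal"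
  by (simp add: maximal_ideal_def one_mem)

lemma mult_maximal_ideal: "a \<in> R \<Longrightarrow> b \<in> maximal_ideal \<Longrightarrow> a * b \<in> maximal_ideal"
proof -
  assume a: "a \<in> R" and b: "b \<in> maximal_ideal"
  have "inverse b \<in> R" if "a \<noteq> 0" "b \<noteq> 0" "inverse (a * b) \<in> R"
  proof -
    have "inverse b = a * inverse (a * b)" using that by (simp add: field_simps)
    then show ?thesis using a that(3) mult_mem by metis
  qed
  then show ?thesis using a b by (auto simp: maximal_ideal_def mult_mem)
qed

lemma mult_maximal_ideal': "b \<in> maximal_ideal \<Longrightarrow> a \<in> R \<Longrightarrow> b * a \<in> maximal_ideal"
  using mult_maximal_ideal by (simp add: mult.commute)

lemma principal_maximal_ideal: "t \<in> maximal_ideal \<Longrightarrow> a \<in> principal t \<Longrightarrow> a \<in> maximal_ideal"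
  by (auto simp: principal_def mult_maximal_ideal')

text \<open>Of two elements one divides the other, so the sum is a multiple of one of them.\<close>

lemma add_maximal_ideal:
  "a \<in> maximal_ideal \<Longrightarrow> b \<in> maximal_ideal \<Longrightarrow> a + b \<in> maximal_ideal"
  using principal_total[of a b] principal_maximal_ideal add_principal[of a _ b] principal_self
  by blast

lemma uminus_maximal_ideal: "a \<in> maximal_ideal \<Longrightarrow> - a \<in> maximal_ideal"
  using mult_maximal_ideal[of "-1" a] uminus_mem[OF one_mem] by simp

lemma diff_maximal_ideal:
  "a \<in> maximal_ideal \<Longrightarrow> b \<in> maximal_ideal \<Longrightarrow> a - b \<in> maximal_ideal"
  using add_maximal_ideal[of a "- b"] uminus_maximal_ideal by simp

lemma sum_maximal_ideal:
  "(\<And>i. i \<in> A \<Longrightarrow> f i \<in> maximal_ideal) \<Longrightarrow> sum f A \<in> maximal_ideal"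
  by (induction A rule: infinite_finite_induct) (auto simp: zero_maximal_ideal add_maximal_ideal)

lemma prod_maximal_ideal:
  assumes "finite A" "k \<in> A" "f k \<in> maximal_ideal" "\<And>i. i \<in> A \<Longrightarrow> f i \<in> R"
  shows "prod f A \<in> maximal_ideal"
proof -
  have "prod f (A - {k}) \<in> R" using assms by (intro prod_mem) auto
  then show ?thesis
    using assms mult_maximal_ideal' by (simp add: prod.remove)
qed

lemma one_plus_mult:
  assumes "a - 1 \<in> maximal_ideal" "b - 1 \<in> maximal_ideal"
  shows "a * b - 1 \<in> maximal_ideal"
proof -
  have eq: "a * b - 1 = (a - 1) * (b - 1) + (a - 1) + (b - 1)" by (simp add: algebra_simps)
  show ?thesis
    unfolding eq using assms by (intro add_maximal_ideal mult_maximal_ideal maximal_ideal_mem)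
qed

lemma one_plus_prod:
  "(\<And>i. i \<in> A \<Longrightarrow> f i - 1 \<in> maximal_ideal) \<Longrightarrow> prod f A - 1 \<in> maximal_ideal"
  by (induction A rule: infinite_finite_induct) (auto simp: zero_maximal_ideal one_plus_mult)

lemma one_plus_unit:
  assumes "a - 1 \<in> maximal_ideal"
  shows "a \<in> R" "a \<noteq> 0" "inverse a \<in> R"
proof -
  show a: "a \<in> R"
    using add_mem[OF maximal_ideal_mem[OF assms] one_mem] by simp
  show a0: "a \<noteq> 0"
    using assms uminus_maximal_ideal[of "-1"] one_not_maximal_ideal by auto
  show "inverse a \<in> R"
  proof (rule ccontr)
    assume "inverse a \<notin> R"
    then have "a \<in> maximal_ideal" using a by (simp add: maximal_ideal_def)
    then have "a - (a - 1) \<in> maximal_ideal" using assms by (rule diff_maximal_ideal)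
    then show False using one_not_maximal_ideal by simp
  qed
qed

lemma unit_mult_principal:
  assumes "u \<noteq> 0" "inverse u \<in> R" "u * a \<in> principal t"
  shows "a \<in> principal t"
  using mult_principal_left[OF assms(2,3)] assms(1) by (simp flip: mult.assoc)

lemma not_principal_ratio:
  assumes "a \<notin> principal b"
  shows "a \<noteq> 0" "b / a \<in> maximal_ideal"
proof -
  show a: "a \<noteq> 0" using assms zero_principal by auto
  have "b \<in> principal a" using assms principal_total by auto
  then have "b / a \<in> R" using a by (simp add: mem_principal_iff)
  moreover have "inverse (b / a) \<notin> R" if "b \<noteq> 0"
    using assms mem_principal_iff[OF that] by simp
  ultimately show "b / a \<in> maximal_ideal" by (auto simp: maximal_ideal_def a)
qed

text \<open>Principal ideals form a chain. The entry found here divides all the others and serves as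
  the norm of a vector.\<close>

lemma principal_maximum:
  assumes "finite A" "A \<noteq> {}"
  shows "\<exists>k\<in>A. \<forall>i\<in>A. f i \<in> principal (f k)"
  using assms
proof (induction A rule: finite_ne_induct)
  case (singleton x)
  then show ?case by (simp add: principal_self)
next
  case (insert x F)
  then obtain k where "k \<in> F" "\<forall>i\<in>F. f i \<in> principal (f k)" by auto
  then show ?case
    using principal_total[of "f x" "f k"]
    by (auto simp: principal_self intro: principal_subset)
qed

text \<open>In the Leibniz formula the identity permutation contributes a product of factors
  congruent to 1; any other permutation picks an off-diagonal entry, which lies in the maximal
  ideal.\<close>

lemma det_one_plus:
  assumes A: "A \<in> carrier_mat N N"
    and one: "\<And>i j. i < N \<Longrightarrow> j < N \<Longrightarrow> A $$ (i, j) - (if i = j then 1 else 0) \<in> maximal_ideal"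
  shows "Determinant.det A - 1 \<in> maximal_ideal"
proof -
  let ?s = "\<lambda>p. signof p * (\<Prod>i = 0..<N. A $$ (i, p i))"
  let ?P = "{p. p permutes {0..<N}}"
  have mem: "A $$ (i, j) \<in> R" if "i < N" "j < N" for i j
    using add_mem[OF maximal_ideal_mem[OF one[OF that]], of "if i = j then 1 else 0"]
    by (auto simp: ring_mem split: if_splits)
  have id: "?s id - 1 \<in> maximal_ideal"
    using one_plus_prod[of "{0..<N}" "\<lambda>i. A $$ (i, i)"] one[of i i for i] by simp
  have "?s p \<in> maximal_ideal" if p: "p \<in> ?P - {id}" for p
  proof -
    have perm: "p permutes {0..<N}" using p by simp
    obtain i where i: "p i \<noteq> i" using p by (auto simp: fun_eq_iff)
    then have "i \<in> {0..<N}" using perm by (auto simp: permutes_def)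
    then have "i < N" by simp
    moreover have "p j < N" if "j < N" for j
      using permutes_in_image[OF perm, of j] that by simp
    moreover from calculation have "A $$ (i, p i) \<in> maximal_ideal" using one[of i "p i"] i by simp
    ultimately have "(\<Prod>i = 0..<N. A $$ (i, p i)) \<in> maximal_ideal"
      by (intro prod_maximal_ideal[of _ i]) (auto simp: mem)
    then show ?thesis by (auto simp: sign_def uminus_maximal_ideal)
  qed
  then have "sum ?s (?P - {id}) \<in> maximal_ideal" by (rule sum_maximal_ideal)
  moreover have "Determinant.det A = ?s id + sum ?s (?P - {id})"
    unfolding det_def'[OF A] by (rule sum.remove) (auto simp: finite_permutations permutes_id)
  ultimately show ?thesis
    using add_maximal_ideal[OF id] by (simp only: diff_add_eq)
qed

end

section \<open>Polynomials and linear systems over a valuation ring\<close>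

context valuation_subring
begin

definition integral_poly :: "'k poly \<Rightarrow> bool" where
  "integral_poly f \<longleftrightarrow> (\<forall>i. poly.coeff f i \<in> R)"

lemma integral_poly_0: "integral_poly 0"
  by (simp add: integral_poly_def zero_mem)

lemma integral_poly_pCons: "integral_poly (pCons a f) \<longleftrightarrow> a \<in> R \<and> integral_poly f"
  unfolding integral_poly_def coeff_pCons by (metis nat.case nat.exhaust)

lemma integral_poly_add: "integral_poly f \<Longrightarrow> integral_poly g \<Longrightarrow> integral_poly (f + g)"
  by (simp add: integral_poly_def add_mem)

lemma integral_poly_mult: "integral_poly f \<Longrightarrow> integral_poly g \<Longrightarrow> integral_poly (f * g)"
  by (simp add: integral_poly_def coeff_mult sum_mem mult_mem)

lemma integral_poly_pcompose: "integral_poly f \<Longrightarrow> integral_poly g \<Longrightarrow> integral_poly (f \<circ>\<^sub>p g)"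
  by (induction f)
    (simp_all add: pcompose_pCons integral_poly_0 integral_poly_pCons integral_poly_add
      integral_poly_mult)

lemma integral_poly_pderiv: "integral_poly f \<Longrightarrow> integral_poly (pderiv f)"
  unfolding integral_poly_def coeff_pderiv using mult_mem of_nat_mem by blast

lemma integral_poly_mem: "integral_poly f \<Longrightarrow> x \<in> R \<Longrightarrow> poly f x \<in> R"
  by (induction f) (simp_all add: integral_poly_pCons ring_mem)

text \<open>\<open>f\<close> is recentred at \<open>x\<close> and the first two coefficients are
  split off; what remains has coefficients in \<open>R\<close>, so no factorials are
  inverted.\<close>

lemma poly_taylor:
  assumes "integral_poly f" "x \<in> R"
  obtains g where "integral_poly g"
    "\<And>h. poly f (x + h) = poly f x + h * poly (pderiv f) x + h\<^sup>2 * poly g h"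
proof -
  let ?F = "f \<circ>\<^sub>p [:x, 1:]"
  obtain a F where F: "?F = pCons a F" by (cases ?F)
  obtain b g where g: "F = pCons b g" by (cases F)
  have eq: "poly f (x + h) = a + h * b + h\<^sup>2 * poly g h" for h
  proof -
    have "poly f (x + h) = poly ?F h" by (simp add: poly_pcompose)
    then show ?thesis by (simp add: F g algebra_simps power2_eq_square)
  qed
  have "pderiv ?F = pderiv f \<circ>\<^sub>p [:x, 1:]"
    by (simp add: pderiv_pcompose pderiv_pCons)
  then have "poly (pderiv ?F) 0 = poly (pderiv f) x" by (simp add: poly_pcompose)
  then have b: "b = poly (pderiv f) x" by (simp add: F g pderiv_pCons)
  have "integral_poly ?F"
    using assms by (simp add: integral_poly_pcompose integral_poly_pCons integral_poly_0 one_mem)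
  then have "integral_poly g" by (simp add: F g integral_poly_pCons)
  moreover have "a = poly f x" using eq[of 0] by simp
  ultimately show ?thesis using that eq b by simp
qed

lemma poly_congruent:
  assumes "integral_poly f" "x \<in> R" "y \<in> R" "y - x \<in> principal t"
  shows "poly f y - poly f x \<in> principal t"
proof -
  obtain g where g: "integral_poly g"
    "\<And>h. poly f (x + h) = poly f x + h * poly (pderiv f) x + h\<^sup>2 * poly g h"
    using poly_taylor[OF assms(1,2)] by blast
  have "poly f y - poly f x = (y - x) * (poly (pderiv f) x + (y - x) * poly g (y - x))"
    using g(2)[of "y - x"] by (simp add: algebra_simps power2_eq_square)
  moreover have "poly (pderiv f) x + (y - x) * poly g (y - x) \<in> R"
    using assms g(1) by (simp add: ring_mem integral_poly_mem integral_poly_pderiv)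
  ultimately show ?thesis using mult_principal_right[OF assms(4)] by simp
qed

text \<open>Cofactors are determinants over \<open>R\<close>, so the adjugate is integral even when
  the determinant is not a unit. Both products are recorded: one shapes the Jacobian matrix of the
  reduced system, the other recovers the original equations from the reduced ones.\<close>

lemma adjugate:
  fixes M :: "nat \<Rightarrow> nat \<Rightarrow> 'k"
  assumes M: "\<And>i j. i < N \<Longrightarrow> j < N \<Longrightarrow> M i j \<in> R"
    and d: "d = Determinant.det (mat N N (\<lambda>(i, j). M i j))"
  shows "\<exists>B. \<forall>i<N. \<forall>j<N. B i j \<in> R \<and>
    (\<Sum>l<N. B i l * M l j) = (if i = j then d else 0) \<and>
    (\<Sum>l<N. M i l * B l j) = (if i = j then d else 0)"
proof -
  let ?M = "mat N N (\<lambda>(i, j). M i j)"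
  have C: "?M \<in> carrier_mat N N" by simp
  note adj = adj_mat[OF C, folded d]
  have mem: "adj_mat ?M $$ (i, j) \<in> R" if "i < N" "j < N" for i j
  proof -
    have D: "mat_delete ?M j i \<in> carrier_mat (N - 1) (N - 1)"
      using C by (rule mat_delete_carrier)
    have "Determinant.det (mat_delete ?M j i) \<in> R"
      unfolding det_def'[OF D]
    proof (intro sum_mem mult_mem prod_mem)
      fix p k assume p: "p \<in> {p. p permutes {0..<N - 1}}" and k: "k \<in> {0..<N - 1}"
      then have "p k < N - 1" using permutes_in_image[of p "{0..<N - 1}" k] by simp
      then show "mat_delete ?M j i $$ (k, p k) \<in> R"
        using k M by (auto simp: mat_delete_def)
    qed (auto simp: sign_def ring_mem)
    then show ?thesis
      using that by (simp add: adj_mat_def cofactor_def ring_mem)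
  qed
  have entry: "(X * Y) $$ (i, j) = (\<Sum>l<N. X $$ (i, l) * Y $$ (l, j))"
    if "X \<in> carrier_mat N N" "Y \<in> carrier_mat N N" "i < N" "j < N" for X Y :: "'k mat" and i j
    using that by (simp add: scalar_prod_def lessThan_atLeast0)
  show ?thesis
  proof (intro exI[of _ "\<lambda>i j. adj_mat ?M $$ (i, j)"] allI impI conjI)
    fix i j assume ij: "i < N" "j < N"
    show "adj_mat ?M $$ (i, j) \<in> R" by (rule mem[OF ij])
    show "(\<Sum>l<N. adj_mat ?M $$ (i, l) * M l j) = (if i = j then d else 0)"
      using entry[OF adj(1) C ij, unfolded adj(3)] ij by (cases "i = j") simp_all
    show "(\<Sum>l<N. M i l * adj_mat ?M $$ (l, j)) = (if i = j then d else 0)"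
      using entry[OF C adj(1) ij, unfolded adj(2)] ij by (cases "i = j") simp_all
  qed
qed

text \<open>The determinant is a unit by \<open>det_one_plus\<close>, hence the inverse matrix is
  integral and the solution lies in the same ideal as the right-hand side.\<close>

lemma solve_linear:
  fixes N :: nat
  assumes A: "\<And>i j. i < N \<Longrightarrow> j < N \<Longrightarrow> A i j - (if i = j then 1 else 0) \<in> maximal_ideal"
    and w: "\<And>i. i < N \<Longrightarrow> w i \<in> principal t"
  shows "\<exists>h. \<forall>i<N. h i \<in> principal t \<and> (\<Sum>j<N. A i j * h j) = w i"
proof -
  define d where "d = Determinant.det (mat N N (\<lambda>(i, j). A i j))"
  have A_mem: "A i j \<in> R" if "i < N" "j < N" for i j
    using add_mem[OF maximal_ideal_mem[OF A[OF that]], of "if i = j then 1 else 0"]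
    by (auto simp: ring_mem split: if_splits)
  have "d - 1 \<in> maximal_ideal"
    unfolding d_def using A by (intro det_one_plus[of _ N]) simp_all
  then have d: "d \<noteq> 0" "inverse d \<in> R" using one_plus_unit by auto
  have "\<exists>B. \<forall>i<N. \<forall>j<N. B i j \<in> R \<and> (\<Sum>l<N. B i l * A l j) = (if i = j then d else 0) \<and>
      (\<Sum>l<N. A i l * B l j) = (if i = j then d else 0)"
    by (rule adjugate[OF _ d_def]) (rule A_mem)
  then obtain B where B: "\<And>i j. i < N \<Longrightarrow> j < N \<Longrightarrow> B i j \<in> R"
    "\<And>i j. i < N \<Longrightarrow> j < N \<Longrightarrow> (\<Sum>l<N. A i l * B l j) = (if i = j then d else 0)"
    by blast
  define h where "h j = inverse d * (\<Sum>k<N. B j k * w k)" for j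
  have "h i \<in> principal t" if "i < N" for i
    unfolding h_def using that B(1) w d by (intro mult_principal_left sum_principal) auto
  moreover have "(\<Sum>j<N. A i j * h j) = w i" if i: "i < N" for i
  proof -
    have "(\<Sum>j<N. A i j * h j) = inverse d * (\<Sum>k<N. (\<Sum>j<N. A i j * B j k) * w k)"
      unfolding h_def sum_distrib_left sum_distrib_right
      by (subst sum.swap) (simp add: mult_ac)
    also have "(\<Sum>k<N. (\<Sum>j<N. A i j * B j k) * w k) = (\<Sum>k<N. if k = i then d * w k else 0)"
      using B(2)[OF i] by (intro sum.cong) auto
    finally show ?thesis using i d by simp
  qed
  ultimately show ?thesis by blast
qed

end

section \<open>Newton's form of Hensel's lemma\<close>

locale henselian_subring = valuation_subring R for R :: "'k::field set" +
  assumes hensel: "integral_poly f \<Longrightarrow> a \<in> R \<Longrightarrow> poly f a \<in> maximal_ideal \<Longrightarrow>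
      poly (pderiv f) a \<notin> maximal_ideal \<Longrightarrow> \<exists>b\<in>R. poly f b = 0 \<and> b - a \<in> maximal_ideal"
begin

text \<open>Substituting \<open>b + s * c\<close> into the Taylor formula and dividing by
  \<open>s\<^sup>2\<close> gives an equation for \<open>c\<close> with constant term in the maximal
  ideal and linear coefficient 1, to which Hensel's lemma applies at 0.\<close>

lemma hensel_newton:
  assumes f: "integral_poly f" and b: "b \<in> R" and s: "s = poly (pderiv f) b" "s \<noteq> 0"
    and small: "poly f b / s\<^sup>2 \<in> maximal_ideal"
  shows "\<exists>c\<in>maximal_ideal. poly f (b + s * c) = 0"
proof -
  obtain g where g: "integral_poly g"
    "\<And>h. poly f (b + h) = poly f b + h * poly (pderiv f) b + h\<^sup>2 * poly g h"
    using poly_taylor[OF f b] by blast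
  have sR: "s \<in> R" using f b s by (simp add: integral_poly_mem integral_poly_pderiv)
  let ?q = "pCons (poly f b / s\<^sup>2) (pCons 1 (g \<circ>\<^sub>p [:0, s:]))"
  have "integral_poly ?q"
    using g(1) sR maximal_ideal_mem[OF small]
    by (simp add: integral_poly_pCons integral_poly_pcompose integral_poly_0 ring_mem)
  moreover have "poly ?q 0 \<in> maximal_ideal" using small by simp
  moreover have "poly (pderiv ?q) 0 \<notin> maximal_ideal"
    by (simp add: pderiv_pCons one_not_maximal_ideal)
  ultimately obtain c where c: "poly ?q c = 0" "c - 0 \<in> maximal_ideal"
    using hensel[of ?q 0] zero_mem by auto
  have "poly f (b + s * c) = s\<^sup>2 * poly ?q c"
    using s by (simp add: g(2) poly_pcompose algebra_simps power2_eq_square)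
  then show ?thesis using c by auto
qed

end

section \<open>Algebraic dependence by counting monomials\<close>

text \<open>Gaussian elimination: if some unknown \<open>x\<close> occurs in the equation
  \<open>b\<close>, it is eliminated from the other equations and \<open>b\<close> is
  dropped.\<close>

lemma homogeneous_solution:
  fixes M :: "'a \<Rightarrow> 'b \<Rightarrow> 'k::field"
  assumes "finite B" "finite A" "card B < card A"
  shows "\<exists>c. (\<exists>a\<in>A. c a \<noteq> 0) \<and> (\<forall>b\<in>B. (\<Sum>a\<in>A. c a * M a b) = 0)"
  using assms
proof (induction B arbitrary: A M rule: finite_induct)
  case empty
  then have "A \<noteq> {}" by auto
  then show ?case by (intro exI[of _ "\<lambda>_. 1"]) auto
next
  case (insert b B)
  show ?case
  proof (cases "\<forall>a\<in>A. M a b = 0")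
    case True
    then show ?thesis using insert.IH[of A M] insert by auto
  next
    case False
    then obtain x where x: "x \<in> A" "M x b \<noteq> 0" by auto
    let ?A = "A - {x}"
    have "card B < card ?A" using insert x by simp
    then obtain c where c: "\<exists>a\<in>?A. c a \<noteq> 0"
      "\<forall>b'\<in>B. (\<Sum>a\<in>?A. c a * (M a b' - M a b / M x b * M x b')) = 0"
      using insert.IH[of ?A "\<lambda>a b'. M a b' - M a b / M x b * M x b'"] insert.prems by auto
    \<comment> \<open>The value at \<open>x\<close> is forced by the equation
      \<open>b\<close>.\<close>
    define c' where "c' = c(x := - (\<Sum>a\<in>?A. c a * M a b) / M x b)"
    have sum: "(\<Sum>a\<in>A. c' a * M a b') = c' x * M x b' + (\<Sum>a\<in>?A. c a * M a b')" for b'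
      using insert.prems x by (auto simp: sum.remove c'_def intro!: sum.cong)
    have "(\<Sum>a\<in>A. c' a * M a b') = 0" if "b' \<in> B" for b'
    proof -
      have "0 = (\<Sum>a\<in>?A. c a * M a b') - (\<Sum>a\<in>?A. c a * (M a b / M x b * M x b'))"
        using c(2) that by (simp add: right_diff_distrib sum_subtractf mult.assoc)
      also have "(\<Sum>a\<in>?A. c a * (M a b / M x b * M x b')) = - c' x * M x b'"
        by (simp add: c'_def sum_distrib_right sum_divide_distrib mult.assoc)
      finally show ?thesis unfolding sum by (simp add: add.commute)
    qed
    moreover have "(\<Sum>a\<in>A. c' a * M a b) = 0"
      unfolding sum using x(2) by (simp add: c'_def)
    moreover have "\<exists>a\<in>A. c' a \<noteq> 0" using c(1) by (auto simp: c'_def)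
    ultimately show ?thesis by auto
  qed
qed

text \<open>The bound \<open>d\<close> applies to each variable separately, so the exponent vectors
  fill a box whose cardinality is a power; these bounds add under products. The coefficients are
  arbitrary elements of the field.\<close>

definition polynomial_map :: "nat \<Rightarrow> nat \<Rightarrow> ((nat \<Rightarrow> 'k) \<Rightarrow> 'k::field) \<Rightarrow> bool" where
  "polynomial_map N d f \<longleftrightarrow>
     (\<exists>c. \<forall>z. f z = (\<Sum>\<beta>\<in>{..<N} \<rightarrow>\<^sub>E {..d}. c \<beta> * (\<Prod>i<N. z i ^ \<beta> i)))"

lemma polynomial_map_monomial:
  assumes "\<And>i. i < N \<Longrightarrow> \<beta> i \<le> d"
  shows "polynomial_map N d (\<lambda>z. c * (\<Prod>i<N. z i ^ \<beta> i))"
proof -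
  let ?b = "restrict \<beta> {..<N}"
  have b: "?b \<in> {..<N} \<rightarrow>\<^sub>E {..d}" using assms by auto
  have "c * (\<Prod>i<N. z i ^ \<beta> i) =
      (\<Sum>\<gamma>\<in>{..<N} \<rightarrow>\<^sub>E {..d}. (if \<gamma> = ?b then c else 0) * (\<Prod>i<N. z i ^ \<gamma> i))" for z
  proof -
    have "(\<Sum>\<gamma>\<in>{..<N} \<rightarrow>\<^sub>E {..d}. (if \<gamma> = ?b then c else 0) * (\<Prod>i<N. z i ^ \<gamma> i))
        = (\<Sum>\<gamma>\<in>{..<N} \<rightarrow>\<^sub>E {..d}. if \<gamma> = ?b then c * (\<Prod>i<N. z i ^ ?b i) else 0)"
      by (intro sum.cong) auto
    also have "\<dots> = c * (\<Prod>i<N. z i ^ ?b i)"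
      using b by (subst sum.delta) (auto intro: finite_PiE)
    finally show ?thesis by simp
  qed
  then show ?thesis unfolding polynomial_map_def by (intro exI allI)
qed

lemma polynomial_map_add:
  assumes "polynomial_map N d f" "polynomial_map N d g"
  shows "polynomial_map N d (\<lambda>z. f z + g z)"
proof -
  obtain a b where "\<And>z. f z = (\<Sum>\<beta>\<in>{..<N} \<rightarrow>\<^sub>E {..d}. a \<beta> * (\<Prod>i<N. z i ^ \<beta> i))"
    "\<And>z. g z = (\<Sum>\<beta>\<in>{..<N} \<rightarrow>\<^sub>E {..d}. b \<beta> * (\<Prod>i<N. z i ^ \<beta> i))"
    using assms unfolding polynomial_map_def by auto
  then show ?thesis
    unfolding polynomial_map_def
    by (intro exI[of _ "\<lambda>\<beta>. a \<beta> + b \<beta>"]) (simp add: sum.distrib distrib_right)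
qed

lemma polynomial_map_const: "polynomial_map N d (\<lambda>_. c)"
  using polynomial_map_monomial[of N "\<lambda>_. 0" d c] by simp

lemma polynomial_map_sum:
  "(\<And>a. a \<in> A \<Longrightarrow> polynomial_map N d (f a)) \<Longrightarrow> polynomial_map N d (\<lambda>z. \<Sum>a\<in>A. f a z)"
  by (induction A rule: infinite_finite_induct)
    (auto simp: polynomial_map_const polynomial_map_add)

lemma polynomial_map_mult:
  assumes "polynomial_map N d f" "polynomial_map N d' g"
  shows "polynomial_map N (d + d') (\<lambda>z. f z * g z)"
proof -
  obtain a b where f: "\<And>z. f z = (\<Sum>\<beta>\<in>{..<N} \<rightarrow>\<^sub>E {..d}. a \<beta> * (\<Prod>i<N. z i ^ \<beta> i))"
    and g: "\<And>z. g z = (\<Sum>\<beta>\<in>{..<N} \<rightarrow>\<^sub>E {..d'}. b \<beta> * (\<Prod>i<N. z i ^ \<beta> i))"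
    using assms unfolding polynomial_map_def by auto
  have "(\<lambda>z. f z * g z) = (\<lambda>z. \<Sum>\<beta>\<in>{..<N} \<rightarrow>\<^sub>E {..d}. \<Sum>\<gamma>\<in>{..<N} \<rightarrow>\<^sub>E {..d'}.
      a \<beta> * b \<gamma> * (\<Prod>i<N. z i ^ (\<beta> i + \<gamma> i)))"
    by (simp add: f g sum_product power_add prod.distrib mult_ac)
  moreover have "polynomial_map N (d + d') \<dots>"
    by (intro polynomial_map_sum polynomial_map_monomial add_mono)
      (auto simp: PiE_iff)
  ultimately show ?thesis by simp
qed

lemma polynomial_map_mono:
  assumes "polynomial_map N d f" "d \<le> d'"
  shows "polynomial_map N d' f"
  using polynomial_map_mult[OF assms(1) polynomial_map_const[of N "d' - d" 1]] assms(2) by simp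

lemma polynomial_map_proj:
  assumes "k < N"
  shows "polynomial_map N 1 (\<lambda>z. z k)"
proof -
  have "(\<Prod>i<N. z i ^ (if i = k then 1 else 0)) = z k" for z :: "nat \<Rightarrow> 'a"
    using assms by (simp add: if_distrib[of "\<lambda>m. z _ ^ m"] prod.delta cong: if_cong)
  moreover have "polynomial_map N 1 (\<lambda>z. 1 * (\<Prod>i<N. z i ^ (if i = k then 1 else 0)) :: 'a)"
    by (rule polynomial_map_monomial) simp
  ultimately show ?thesis by simp
qed

lemma polynomial_map_power:
  "polynomial_map N d f \<Longrightarrow> polynomial_map N (m * d) (\<lambda>z. f z ^ m)"
  by (induction m) (auto simp: polynomial_map_const intro: polynomial_map_mult)

lemma polynomial_map_prod:
  "finite A \<Longrightarrow> (\<And>a. a \<in> A \<Longrightarrow> polynomial_map N d (f a)) \<Longrightarrow>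
    polynomial_map N (card A * d) (\<lambda>z. \<Prod>a\<in>A. f a z)"
  by (induction A rule: finite_induct)
    (auto simp: polynomial_map_const intro: polynomial_map_mult)

text \<open>The number of products of powers with exponents less than \<open>d\<close> grows like \<open>d ^ (N + 1)\<close>, the number
  of monomials needed to express them only like \<open>d ^ N\<close>.\<close>

lemma algebraic_relation:
  fixes Q :: "nat \<Rightarrow> (nat \<Rightarrow> 'k) \<Rightarrow> 'k::field"
  assumes Q: "\<And>i. i < N \<Longrightarrow> polynomial_map N D (Q i)" and k: "k < N"
  shows "\<exists>d F. (\<exists>\<alpha>\<in>{..<N} \<rightarrow>\<^sub>E {..<d}. \<exists>j<d. F \<alpha> j \<noteq> 0) \<and>
    (\<forall>z. (\<Sum>\<alpha>\<in>{..<N} \<rightarrow>\<^sub>E {..<d}. \<Sum>j<d. F \<alpha> j * ((\<Prod>i<N. Q i z ^ \<alpha> i) * z k ^ j)) = 0)"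
proof -
  \<comment> \<open>The number of monomials will be at most \<open>d ^ N * (N * D + 1) ^ N\<close>;
    this \<open>d\<close> makes it smaller than \<open>d ^ N * d\<close>, the number of
    products.\<close>
  define d where "d = (N * D + 1) ^ N + 1"
  \<comment> \<open>Degree bound in each variable: each of the \<open>N\<close> powers of the
    \<open>Q i\<close> contributes at most \<open>(d - 1) * D\<close>, and the power of
    \<open>z k\<close> at most \<open>d - 1\<close>.\<close>
  define L where "L = (d - 1) * (N * D + 1)"
  let ?A = "({..<N} \<rightarrow>\<^sub>E {..<d}) \<times> {..<d}"
  let ?B = "{..<N} \<rightarrow>\<^sub>E {..L}"
  have "\<exists>c. \<forall>z. (\<Prod>i<N. Q i z ^ fst a i) * z k ^ snd a
      = (\<Sum>\<beta>\<in>?B. c \<beta> * (\<Prod>i<N. z i ^ \<beta> i))" if a: "a \<in> ?A" for a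
  proof -
    have le: "fst a i \<le> d - 1" if "i < N" for i
    proof -
      have "fst a \<in> {..<N} \<rightarrow>\<^sub>E {..<d}" using a by (simp add: mem_Times_iff)
      then have "fst a i < d" using that PiE_mem by fastforce
      then show ?thesis by simp
    qed
    have "polynomial_map N ((d - 1) * D) (\<lambda>z. Q i z ^ fst a i)" if "i < N" for i
      using le[OF that] by (intro polynomial_map_mono[OF polynomial_map_power[OF Q[OF that]]]) simp
    then have "polynomial_map N (N * ((d - 1) * D)) (\<lambda>z. \<Prod>i<N. Q i z ^ fst a i)"
      using polynomial_map_prod[of "{..<N}" N "(d - 1) * D" "\<lambda>i z. Q i z ^ fst a i"] by simp
    moreover have "polynomial_map N (d - 1) (\<lambda>z. z k ^ snd a)"
      using polynomial_map_power[OF polynomial_map_proj[OF k], of "snd a"]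
      by (rule polynomial_map_mono) (use a in \<open>simp add: mem_Times_iff less_eq_Suc_le d_def\<close>)
    ultimately have "polynomial_map N (N * ((d - 1) * D) + (d - 1))
        (\<lambda>z. (\<Prod>i<N. Q i z ^ fst a i) * z k ^ snd a)"
      by (rule polynomial_map_mult)
    then have "polynomial_map N L (\<lambda>z. (\<Prod>i<N. Q i z ^ fst a i) * z k ^ snd a)"
      by (rule polynomial_map_mono) (simp add: L_def algebra_simps)
    then show ?thesis by (simp add: polynomial_map_def)
  qed
  then have "\<forall>a\<in>?A. \<exists>c. \<forall>z. (\<Prod>i<N. Q i z ^ fst a i) * z k ^ snd a
      = (\<Sum>\<beta>\<in>?B. c \<beta> * (\<Prod>i<N. z i ^ \<beta> i))" by blast
  from bchoice[OF this] obtain M where M: "\<And>a z. a \<in> ?A \<Longrightarrow>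
      (\<Prod>i<N. Q i z ^ fst a i) * z k ^ snd a = (\<Sum>\<beta>\<in>?B. M a \<beta> * (\<Prod>i<N. z i ^ \<beta> i))"
    by blast
  have "card ?B < card ?A"
  proof -
    have "L + 1 \<le> d * (N * D + 1)" by (simp add: L_def d_def)
    then have "(L + 1) ^ N \<le> (d * (N * D + 1)) ^ N" by (rule power_mono) simp
    also have "\<dots> = d ^ N * (N * D + 1) ^ N" by (rule power_mult_distrib)
    also have "\<dots> < d ^ N * d" by (simp add: d_def)
    finally show ?thesis by (simp add: card_PiE card_cartesian_product)
  qed
  \<comment> \<open>There is one equation for each monomial and one unknown for each product, so a
    nontrivial combination of the products has all its coefficients zero.\<close>
  then obtain c where c: "\<exists>a\<in>?A. c a \<noteq> 0" "\<forall>b\<in>?B. (\<Sum>a\<in>?A. c a * M a b) = 0"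
    using homogeneous_solution[of ?B ?A M] by (auto simp: finite_PiE)
  have "(\<Sum>\<alpha>\<in>{..<N} \<rightarrow>\<^sub>E {..<d}. \<Sum>j<d. c (\<alpha>, j) * ((\<Prod>i<N. Q i z ^ \<alpha> i) * z k ^ j)) = 0" for z
  proof -
    have "(\<Sum>\<alpha>\<in>{..<N} \<rightarrow>\<^sub>E {..<d}. \<Sum>j<d. c (\<alpha>, j) * ((\<Prod>i<N. Q i z ^ \<alpha> i) * z k ^ j))
        = (\<Sum>a\<in>?A. c a * ((\<Prod>i<N. Q i z ^ fst a i) * z k ^ snd a))"
      by (simp add: sum.cartesian_product case_prod_beta)
    also have "\<dots> = (\<Sum>a\<in>?A. \<Sum>\<beta>\<in>?B. c a * M a \<beta> * (\<Prod>i<N. z i ^ \<beta> i))"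
      by (intro sum.cong refl) (simp add: M sum_distrib_left mult.assoc)
    also have "\<dots> = (\<Sum>\<beta>\<in>?B. (\<Sum>a\<in>?A. c a * M a \<beta>) * (\<Prod>i<N. z i ^ \<beta> i))"
      by (subst sum.swap) (simp add: sum_distrib_right)
    also have "\<dots> = 0" using c(2) by simp
    finally show ?thesis .
  qed
  moreover have "\<exists>\<alpha>\<in>{..<N} \<rightarrow>\<^sub>E {..<d}. \<exists>j<d. c (\<alpha>, j) \<noteq> 0" using c(1) by auto
  ultimately show ?thesis by (intro exI[of _ d] exI[of _ "\<lambda>\<alpha> j. c (\<alpha>, j)"]) blast
qed

text \<open>Together with \<open>digits_bound\<close>, this lets a single integer weight separate
  exponent vectors, read as digits in base \<open>d\<close>. The induction removes the lowest digit,
  which is the residue modulo \<open>d\<close>.\<close>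

lemma digits_unique:
  fixes d :: nat
  assumes "\<And>i. i < N \<Longrightarrow> \<alpha> i < d" "\<And>i. i < N \<Longrightarrow> \<beta> i < d"
    and "(\<Sum>i<N. \<alpha> i * d ^ i) = (\<Sum>i<N. \<beta> i * d ^ i)"
  shows "\<forall>i<N. \<alpha> i = \<beta> i"
  using assms
proof (induction N arbitrary: \<alpha> \<beta>)
  case (Suc N)
  let ?s = "\<lambda>\<alpha>. \<Sum>i<N. \<alpha> (Suc i) * d ^ i"
  have split: "(\<Sum>i<Suc N. \<alpha> i * d ^ i) = \<alpha> 0 + d * ?s \<alpha>" for \<alpha>
    by (simp add: sum.lessThan_Suc_shift sum_distrib_left mult_ac del: sum.lessThan_Suc)
  have eq: "\<alpha> 0 + d * ?s \<alpha> = \<beta> 0 + d * ?s \<beta>"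
    using Suc.prems(3) unfolding split .
  have lt: "\<alpha> 0 < d" "\<beta> 0 < d" using Suc.prems(1,2) by auto
  have 0: "\<alpha> 0 = \<beta> 0"
    using arg_cong[OF eq, of "\<lambda>x. x mod d"] lt by simp
  then have "?s \<alpha> = ?s \<beta>" using eq lt by simp
  then have "\<forall>i<N. \<alpha> (Suc i) = \<beta> (Suc i)"
    using Suc.prems(1,2) by (intro Suc.IH) auto
  then show ?case using 0 by (auto simp: less_Suc_eq_0_disj)
qed simp

lemma digits_bound:
  fixes d :: nat
  assumes "\<And>i. i < N \<Longrightarrow> \<alpha> i < d"
  shows "(\<Sum>i<N. \<alpha> i * d ^ i) < d ^ N"
  using assms
proof (induction N)
  case (Suc N)
  have "(\<Sum>i<Suc N. \<alpha> i * d ^ i) < d ^ N + \<alpha> N * d ^ N"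
    using Suc by simp
  also have "\<dots> = (\<alpha> N + 1) * d ^ N" by simp
  also have "\<dots> \<le> d * d ^ N" using Suc.prems[of N] by (intro mult_right_mono) auto
  finally show ?case by simp
qed simp

section \<open>Systems with Jacobian matrix congruent to the identity\<close>

lemma (in valuation_subring) prod_one_mod:
  assumes "t \<in> R" "\<And>i. i \<in> A \<Longrightarrow> f i - 1 \<in> principal t"
  shows "(\<Prod>i\<in>A. f i ^ m i) - 1 \<in> principal t"
proof -
  have mult: "a * b - 1 \<in> principal t" if "a - 1 \<in> principal t" "b - 1 \<in> principal t" for a b
  proof -
    have eq: "a * b - 1 = a * (b - 1) + (a - 1)" by (simp add: algebra_simps)
    have "a \<in> R" using add_mem[OF principal_mem[OF assms(1) that(1)] one_mem] by simp
    then show ?thesis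
      unfolding eq using that by (intro add_principal mult_principal_left)
  qed
  have pow: "a ^ n - 1 \<in> principal t" if "a - 1 \<in> principal t" for a n
    by (induction n) (simp_all add: zero_principal mult that)
  show ?thesis
    using assms(2)
    by (induction A rule: infinite_finite_induct) (simp_all add: zero_principal mult pow)
qed

text \<open>\<open>A z\<close> takes the place of the Jacobian matrix of \<open>Q\<close> at
  \<open>z\<close>. The second-order Taylor estimate supports uniqueness and Newton steps; that
  \<open>Q\<close> is polynomial enters later, with the algebraic relations.\<close>

locale hensel_system = valuation_subring R for R :: "'k::field set" +
  fixes N :: nat and Q :: "nat \<Rightarrow> (nat \<Rightarrow> 'k) \<Rightarrow> 'k"
    and A :: "(nat \<Rightarrow> 'k) \<Rightarrow> nat \<Rightarrow> nat \<Rightarrow> 'k" and X :: "(nat \<Rightarrow> 'k) set"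
  defines "X \<equiv> {z. \<forall>i<N. z i \<in> maximal_ideal}"
  assumes near_identity: "z \<in> X \<Longrightarrow> i < N \<Longrightarrow> j < N \<Longrightarrow>
      A z i j - (if i = j then 1 else 0) \<in> maximal_ideal"
    and taylor: "z \<in> X \<Longrightarrow> h \<in> X \<Longrightarrow> t \<in> R \<Longrightarrow> (\<And>j. j < N \<Longrightarrow> h j \<in> principal t) \<Longrightarrow> i < N \<Longrightarrow>
      Q i (\<lambda>j. z j + h j) - Q i z - (\<Sum>j<N. A z i j * h j) \<in> principal (t\<^sup>2)"
    and origin_small: "i < N \<Longrightarrow> Q i (\<lambda>_. 0) \<in> maximal_ideal"
begin

lemma X_I: "(\<And>i. i < N \<Longrightarrow> z i \<in> maximal_ideal) \<Longrightarrow> z \<in> X"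
  by (simp add: X_def)

lemma X_D: "z \<in> X \<Longrightarrow> i < N \<Longrightarrow> z i \<in> maximal_ideal"
  by (simp add: X_def)

lemma zero_X: "(\<lambda>_. 0) \<in> X"
  by (simp add: X_def zero_maximal_ideal)

lemma add_X: "z \<in> X \<Longrightarrow> h \<in> X \<Longrightarrow> (\<lambda>j. z j + h j) \<in> X"
  by (simp add: X_def add_maximal_ideal)

lemma principal_X: "t \<in> maximal_ideal \<Longrightarrow> (\<And>j. j < N \<Longrightarrow> h j \<in> principal t) \<Longrightarrow> h \<in> X"
  by (rule X_I) (rule principal_maximal_ideal)

lemma A_mem:
  assumes "z \<in> X" "i < N" "j < N"
  shows "A z i j \<in> R"
  using add_mem[OF maximal_ideal_mem[OF near_identity[OF assms]], of "if i = j then 1 else 0"]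
  by (auto simp: ring_mem split: if_splits)

lemma square_principal: "t \<in> R \<Longrightarrow> a \<in> principal (t\<^sup>2) \<Longrightarrow> a \<in> principal t"
  using principal_subset[OF power_principal[of t 1 2]] by simp

lemma lipschitz:
  assumes z: "z \<in> X" and t: "t \<in> R" and h: "h \<in> X" "\<And>j. j < N \<Longrightarrow> h j \<in> principal t" and i: "i < N"
  shows "Q i (\<lambda>j. z j + h j) - Q i z \<in> principal t"
proof -
  have "Q i (\<lambda>j. z j + h j) - Q i z - (\<Sum>j<N. A z i j * h j) \<in> principal t"
    using square_principal[OF t taylor[OF z h(1) t h(2) i]] by simp
  moreover have "(\<Sum>j<N. A z i j * h j) \<in> principal t"
    using z i h(2) A_mem by (intro sum_principal mult_principal_left) auto
  ultimately have "Q i (\<lambda>j. z j + h j) - Q i z - (\<Sum>j<N. A z i j * h j)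
      + (\<Sum>j<N. A z i j * h j) \<in> principal t" by (rule add_principal)
  then show ?thesis by simp
qed

lemma dominant_coordinate:
  assumes "0 < N"
  obtains k where "k < N" "\<And>j. j < N \<Longrightarrow> h j \<in> principal (h k)"
  using principal_maximum[of "{..<N}" h] assms by auto

lemma Q_small:
  assumes z: "z \<in> X" and i: "i < N"
  shows "Q i z \<in> maximal_ideal"
proof -
  obtain k where k: "k < N" "\<And>j. j < N \<Longrightarrow> z j \<in> principal (z k)"
    using dominant_coordinate[of z] i by auto
  have "z k \<in> maximal_ideal" using X_D[OF z k(1)] .
  moreover from this have "Q i (\<lambda>j. 0 + z j) - Q i (\<lambda>_. 0) \<in> principal (z k)"
    using lipschitz[OF zero_X _ z k(2) i] maximal_ideal_mem by simp
  ultimately have "Q i z - Q i (\<lambda>_. 0) \<in> maximal_ideal"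
    using principal_maximal_ideal by simp
  then show ?thesis using add_maximal_ideal[OF _ origin_small[OF i]] by force
qed

text \<open>Let \<open>h l\<close> divide all entries of the difference \<open>h\<close>. In row
  \<open>l\<close> the off-diagonal terms and the quadratic remainder are \<open>h l\<close> times
  elements of the maximal ideal, so \<open>Q l y - Q l x\<close> is \<open>h l\<close> times a
  unit.\<close>

lemma isometry:
  assumes x: "x \<in> X" and y: "y \<in> X" and t: "\<And>i. i < N \<Longrightarrow> Q i y - Q i x \<in> principal t" and k: "k < N"
  shows "y k - x k \<in> principal t"
proof -
  define h where "h = (\<lambda>j. y j - x j)"
  have hX: "h \<in> X" using x y by (simp add: X_def h_def diff_maximal_ideal)
  obtain l where l: "l < N" "\<And>j. j < N \<Longrightarrow> h j \<in> principal (h l)"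
    using dominant_coordinate[of h] k by auto
  have s: "h l \<in> maximal_ideal" using X_D[OF hX l(1)] .
  note sR = maximal_ideal_mem[OF s]
  have "h l \<in> principal t"
  proof (cases "h l = 0")
    case True
    then show ?thesis by (simp add: zero_principal)
  next
    case False
    let ?d = "Q l y - Q l x"
    have "Q l (\<lambda>j. x j + h j) - Q l x - (\<Sum>j<N. A x l j * h j) \<in> principal ((h l)\<^sup>2)"
      using taylor[OF x hX sR l(2) l(1)] by simp
    then have "(?d - (\<Sum>j<N. A x l j * h j)) / h l \<in> principal (h l)"
      using False by (simp add: h_def mem_principal_iff power2_eq_square)
    then have 1: "(?d - (\<Sum>j<N. A x l j * h j)) / h l \<in> maximal_ideal"
      using principal_maximal_ideal[OF s] by blast
    have "(\<Sum>j<N. (A x l j - (if l = j then 1 else 0)) * (h j / h l)) \<in> maximal_ideal"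
      using near_identity[OF x l(1)] l(2) False
      by (intro sum_maximal_ideal mult_maximal_ideal') (auto simp: mem_principal_iff)
    also have "(\<Sum>j<N. (A x l j - (if l = j then 1 else 0)) * (h j / h l))
        = (\<Sum>j<N. A x l j * h j / h l) - (\<Sum>j<N. if l = j then h j / h l else 0)"
      unfolding sum_subtractf[symmetric]
      using False by (intro sum.cong) (auto simp: left_diff_distrib diff_divide_distrib)
    also have "\<dots> = (\<Sum>j<N. A x l j * h j) / h l - 1"
      unfolding sum_divide_distrib using l(1) False by simp
    finally have "(?d - (\<Sum>j<N. A x l j * h j)) / h l + ((\<Sum>j<N. A x l j * h j) / h l - 1)
        \<in> maximal_ideal"
      by (rule add_maximal_ideal[OF 1])
    moreover have "(?d - S) / h l + (S / h l - 1) = ?d / h l - 1" for S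
      by (simp add: diff_divide_distrib)
    ultimately have "?d / h l - 1 \<in> maximal_ideal" by simp
    from one_plus_unit(2,3)[OF this] have "?d / h l \<noteq> 0" "inverse (?d / h l) \<in> R" .
    moreover have "?d / h l * h l \<in> principal t" using t[OF l(1)] False by simp
    ultimately show ?thesis by (rule unit_mult_principal)
  qed
  then show ?thesis using principal_subset[OF _ l(2)[OF k]] by (simp add: h_def)
qed

text \<open>The linear part of the Taylor formula is made equal to \<open>w\<close>; only the
  quadratic remainder is left.\<close>

lemma newton:
  assumes x: "x \<in> X" and t: "t \<in> maximal_ideal" and w: "\<And>i. i < N \<Longrightarrow> w i \<in> principal t"
  shows "\<exists>y\<in>X. \<forall>i<N. Q i y - Q i x - w i \<in> principal (t\<^sup>2)"
proof -
  obtain h where h: "\<And>i. i < N \<Longrightarrow> h i \<in> principal t" "\<And>i. i < N \<Longrightarrow> (\<Sum>j<N. A x i j * h j) = w i"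
    using solve_linear[of N "A x" w t] near_identity[OF x] w by blast
  have hX: "h \<in> X" using t h(1) by (rule principal_X)
  show ?thesis
    using taylor[OF x hX maximal_ideal_mem[OF t] h(1)] h(2) add_X[OF x hX]
    by (intro bexI[of _ "\<lambda>j. x j + h j"]) auto
qed

section \<open>Approximate zeros and levels\<close>

definition good :: "'k \<Rightarrow> (nat \<Rightarrow> 'k) \<Rightarrow> bool" where
  "good t x \<longleftrightarrow> x \<in> X \<and> (\<forall>i<N. Q i x \<in> principal t)"

text \<open>0 is excluded so that levels can be cancelled; a point with \<open>good 0\<close> would
  be an exact zero of the system.\<close>

definition levels :: "'k set" where
  "levels = {t \<in> R - {0}. \<exists>x. good t x}"

lemma good_diff:
  assumes "good t x" "good t y" "k < N"
  shows "y k - x k \<in> principal t"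
  using assms by (intro isometry[of x y t]) (auto simp: good_def diff_principal)

lemma good_mono: "good s x \<Longrightarrow> s \<in> principal t \<Longrightarrow> good t x"
  by (simp add: good_def principal_subset[of s t])

lemma levels_down:
  assumes "s \<in> levels" "s \<in> principal t" "t \<in> R"
  shows "t \<in> levels"
proof -
  have "t \<noteq> 0" using assms by (auto simp: levels_def principal_zero)
  then show ?thesis using assms good_mono unfolding levels_def by blast
qed

lemma levels_D: "t \<in> levels \<Longrightarrow> t \<in> R" "t \<in> levels \<Longrightarrow> t \<noteq> 0"
  by (auto simp: levels_def)

lemma principal_unit:
  assumes "t \<in> R" "t \<notin> maximal_ideal" "a \<in> R"
  shows "a \<in> principal t"
proof -
  have t: "t \<noteq> 0" "inverse t \<in> R" using assms(1,2) by (auto simp: maximal_ideal_def)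
  then have "a * inverse t \<in> R" using assms(3) mult_mem by blast
  then show ?thesis using t by (simp add: mem_principal_iff divide_inverse)
qed

text \<open>A Newton step with \<open>w = - Q x\<close> doubles the order of vanishing. It needs
  \<open>t\<close> in the maximal ideal; for a unit \<open>t\<close>, the elements \<open>t\<close>
  and \<open>t\<^sup>2\<close> generate the same ideal.\<close>

lemma levels_square:
  assumes t: "t \<in> levels"
  shows "t\<^sup>2 \<in> levels"
proof (cases "t \<in> maximal_ideal")
  case True
  obtain x where x: "good t x" using t by (auto simp: levels_def)
  then have "\<exists>y\<in>X. \<forall>i<N. Q i y - Q i x - (- Q i x) \<in> principal (t\<^sup>2)"
    by (intro newton[OF _ True]) (auto simp: good_def uminus_principal)
  then have "\<exists>y. good (t\<^sup>2) y" by (auto simp: good_def)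
  then show ?thesis using t by (simp add: levels_def power_mem)
next
  case False
  note tR = levels_D[OF t]
  have "1 \<in> principal t" using tR(1) False one_mem by (rule principal_unit)
  then have "t \<in> principal (t\<^sup>2)" using mult_principal[OF principal_self[of t]]
    by (fastforce simp: power2_eq_square)
  then show ?thesis using levels_down[OF t] tR by (simp add: power_mem)
qed

text \<open>The product divides the square of whichever factor is divisible by the other, so closure
  under squares suffices.\<close>

lemma levels_mult:
  assumes "s \<in> levels" "t \<in> levels"
  shows "s * t \<in> levels"
proof -
  note R = levels_D(1)[OF assms(1)] levels_D(1)[OF assms(2)]
  have "s\<^sup>2 \<in> principal (s * t) \<or> t\<^sup>2 \<in> principal (s * t)"
    using principal_total[of s t] mult_principal[OF principal_self[of s]]
      mult_principal[OF _ principal_self[of t], of t s] by (auto simp: power2_eq_square)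
  then show ?thesis
    using levels_down[OF levels_square[OF assms(1)]] levels_down[OF levels_square[OF assms(2)]] R
    by (auto simp: mult_mem)
qed

lemma tiny_principal:
  assumes "a \<in> R" "a \<notin> levels" "t \<in> levels"
  shows "a \<in> principal t"
  using principal_total[of a t] levels_down[OF assms(3), of a] assms(1,2) by auto

end

section \<open>Zeros of such systems\<close>

text \<open>Collects the assumptions of the indirect argument; \<open>contradiction\<close> refutes
  them.\<close>

locale hensel_system_without_zero = hensel_system R N Q A X + henselian_subring R
  for R :: "'k::field set" and N Q A X +
  fixes D :: nat
  assumes of_nat_unit: "0 < m \<Longrightarrow> of_nat m \<notin> maximal_ideal"
    and polynomial: "i < N \<Longrightarrow> polynomial_map N D (Q i)"
    and no_zero: "z \<in> X \<Longrightarrow> \<exists>i<N. Q i z \<noteq> 0"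
begin

text \<open>Take for \<open>t\<close> the entry of \<open>Q z\<close> that divides all the others.
  It is nonzero and no unit, hence not divisible by its square; therefore no single point is good at
  every level.\<close>

lemma not_all_good:
  assumes "z \<in> X"
  obtains t where "t \<in> levels" "t \<in> maximal_ideal" "good t z" "\<not> good (t\<^sup>2) z"
proof -
  obtain i where i: "i < N" "Q i z \<noteq> 0" using no_zero[OF assms] by blast
  then obtain k where k: "k < N" "\<And>j. j < N \<Longrightarrow> Q j z \<in> principal (Q k z)"
    using dominant_coordinate[of "\<lambda>j. Q j z"] by auto
  let ?t = "Q k z"
  have m: "?t \<in> maximal_ideal" using Q_small[OF assms k(1)] .
  have 0: "?t \<noteq> 0" using k(2)[OF i(1)] i(2) by (auto simp: principal_zero)
  have good: "good ?t z" using k(2) assms by (simp add: good_def)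
  have "?t \<notin> principal (?t\<^sup>2)"
    using m 0 by (simp add: mem_principal_iff maximal_ideal_def power2_eq_square inverse_eq_divide)
  then have "\<not> good (?t\<^sup>2) z" using k(1) by (auto simp: good_def)
  moreover have "?t \<in> levels" using good 0 maximal_ideal_mem[OF m] by (auto simp: levels_def)
  ultimately show ?thesis using that m good by blast
qed

lemma small_level: obtains t where "t \<in> levels" "t \<in> maximal_ideal"
  using not_all_good[OF zero_X] by blast

lemma one_level: "1 \<in> levels"
proof -
  obtain t where "t \<in> levels" "t \<in> maximal_ideal" by (rule small_level)
  then show ?thesis using levels_down[of t 1] by (simp add: one_mem levels_D)
qed

lemma levels_power: "t \<in> levels \<Longrightarrow> t ^ n \<in> levels"
  by (induction n) (simp_all add: one_level levels_mult)

text \<open>If \<open>a\<close> were a level, so would be \<open>a * t\<close> for a level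
  \<open>t\<close> in the maximal ideal; divisibility of \<open>a\<close> by \<open>a * t\<close>
  would make \<open>t\<close> a unit.\<close>

lemma not_level:
  assumes "\<And>t. t \<in> levels \<Longrightarrow> a \<in> principal t"
  shows "a \<notin> levels"
proof
  assume a: "a \<in> levels"
  obtain t where t: "t \<in> levels" "t \<in> maximal_ideal" by (rule small_level)
  have "a * 1 \<in> principal (a * t)" using assms[OF levels_mult[OF a t(1)]] by simp
  then have "1 \<in> principal t" using principal_mult_cancel[of a 1 t] levels_D(2)[OF a] by blast
  then show False using principal_maximal_ideal[OF t(2)] one_not_maximal_ideal by blast
qed

text \<open>Start from a point where \<open>Q\<close> is divisible by \<open>t ^ (2 * W)\<close>.
  Since \<open>W \<le> w i\<close>, a Newton step with right-hand side \<open>t ^ w i\<close> and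
  modulus \<open>t ^ W\<close> leaves an error divisible by \<open>t ^ (2 * W)\<close>, hence by
  \<open>t ^ (w i + 1)\<close> as \<open>w i < 2 * W\<close>.\<close>

lemma prescribed_values:
  assumes t: "t \<in> levels" "t \<in> maximal_ideal"
    and w: "\<And>i. i < N \<Longrightarrow> W \<le> w i" "\<And>i. i < N \<Longrightarrow> w i < 2 * W" and W: "0 < W"
  obtains x where "good t x" "\<And>i. i < N \<Longrightarrow> Q i x / t ^ w i - 1 \<in> principal t"
proof -
  note tR = levels_D[OF t(1)]
  obtain x0 where x0: "good (t ^ (2 * W)) x0"
    using levels_power[OF t(1), of "2 * W"] by (auto simp: levels_def)
  have tW: "t ^ W \<in> maximal_ideal"
    using W t(2) power_mem[OF tR(1), of "W - 1"] mult_maximal_ideal'[OF t(2)]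
    by (cases W) auto
  have "\<exists>y\<in>X. \<forall>i<N. Q i y - Q i x0 - t ^ w i \<in> principal ((t ^ W)\<^sup>2)"
    using x0 w(1) tR(1) by (intro newton[OF _ tW]) (auto simp: good_def power_principal)
  then obtain y where y: "y \<in> X" "\<And>i. i < N \<Longrightarrow> Q i y - Q i x0 - t ^ w i \<in> principal (t ^ (2 * W))"
    by (auto simp: power_mult mult.commute simp flip: power_mult)
  have e: "Q i y - t ^ w i \<in> principal (t ^ (w i + 1))" if i: "i < N" for i
  proof -
    have "Q i x0 \<in> principal (t ^ (2 * W))" using x0 i by (simp add: good_def)
    from add_principal[OF y(2)[OF i] this] have "Q i y - t ^ w i \<in> principal (t ^ (2 * W))" by simp
    moreover have "t ^ (2 * W) \<in> principal (t ^ (w i + 1))"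
      using w(2)[OF i] tR(1) by (intro power_principal) auto
    ultimately show ?thesis using principal_subset by blast
  qed
  have q: "Q i y / t ^ w i - 1 \<in> principal t" if i: "i < N" for i
  proof -
    have "t ^ w i * (Q i y / t ^ w i - 1) = Q i y - t ^ w i"
      using tR by (simp add: right_diff_distrib)
    then have "t ^ w i * (Q i y / t ^ w i - 1) \<in> principal (t ^ w i * t)"
      using e[OF i] by (simp add: mult.commute)
    then show ?thesis using principal_mult_cancel tR(2) by simp
  qed
  have "Q i y \<in> principal t" if i: "i < N" for i
  proof -
    have "t ^ (w i + 1) \<in> principal t" "t ^ w i \<in> principal t"
      using power_principal[OF tR(1), of 1 "w i + 1"] power_principal[OF tR(1), of 1 "w i"]
        w(1)[OF i] W by auto
    then have "(Q i y - t ^ w i) + t ^ w i \<in> principal t"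
      using e[OF i] principal_subset add_principal by blast
    then show ?thesis by simp
  qed
  then have "good t y" using y(1) by (simp add: good_def)
  then show ?thesis using that q by blast
qed

text \<open>The coefficients of an algebraic relation between the \<open>Q i\<close> and a coordinate \<open>z k\<close> are
  separated by evaluating it where \<open>Q i\<close> is \<open>t ^ w i\<close> up to a factor congruent to 1 modulo \<open>t\<close>,
  for weights \<open>w\<close> that give the occurring monomials in the \<open>Q i\<close> distinct weighted degrees.\<close>

lemma coordinate_polynomial:
  assumes k: "k < N"
  obtains f where "integral_poly f" "\<exists>j. poly.coeff f j \<in> levels"
    "\<And>t x. t \<in> levels \<Longrightarrow> good t x \<Longrightarrow> poly f (x k) \<in> principal t"
proof -
  have "\<exists>d F. (\<exists>\<alpha>\<in>{..<N} \<rightarrow>\<^sub>E {..<d}. \<exists>j<d. F \<alpha> j \<noteq> 0) \<and>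
      (\<forall>z. (\<Sum>\<alpha>\<in>{..<N} \<rightarrow>\<^sub>E {..<d}. \<Sum>j<d. F \<alpha> j * ((\<Prod>i<N. Q i z ^ \<alpha> i) * z k ^ j)) = 0)"
    by (rule algebraic_relation[OF _ k]) (rule polynomial)
  then obtain d F0 where nz: "\<exists>\<alpha>\<in>{..<N} \<rightarrow>\<^sub>E {..<d}. \<exists>j<d. F0 \<alpha> j \<noteq> 0"
    and rel0: "\<And>z. (\<Sum>\<alpha>\<in>{..<N} \<rightarrow>\<^sub>E {..<d}. \<Sum>j<d. F0 \<alpha> j * ((\<Prod>i<N. Q i z ^ \<alpha> i) * z k ^ j)) = 0"
    by (elim exE conjE) blast
  define E where "E = {..<N} \<rightarrow>\<^sub>E {..<d}"
  have finE: "finite E" by (simp add: E_def finite_PiE)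
  obtain \<alpha>1 j1 where 1: "\<alpha>1 \<in> E" "j1 < d" "F0 \<alpha>1 j1 \<noteq> 0" using nz by (auto simp: E_def)
  then have ne: "E \<times> {..<d} \<noteq> {}" by auto
  have "finite (E \<times> {..<d})" using finE by simp
  \<comment> \<open>Dividing the relation by a coefficient that divides all the others makes it
    integral with one coefficient equal to 1, which is a level.\<close>
  from principal_maximum[OF this ne, of "\<lambda>b. F0 (fst b) (snd b)"]
  obtain a where a: "a \<in> E \<times> {..<d}"
    "\<forall>b\<in>E \<times> {..<d}. F0 (fst b) (snd b) \<in> principal (F0 (fst a) (snd a))"
    by blast
  let ?c = "F0 (fst a) (snd a)"
  have max: "F0 \<alpha> j \<in> principal ?c" if "\<alpha> \<in> E" "j < d" for \<alpha> j
    using a(2) that by force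
  have c: "?c \<noteq> 0" using max[OF 1(1,2)] 1(3) by (auto simp: principal_zero)
  define F where "F \<alpha> j = F0 \<alpha> j / ?c" for \<alpha> j
  have F_mem: "F \<alpha> j \<in> R" if "\<alpha> \<in> E" "j < d" for \<alpha> j
    using max[OF that] c by (simp add: F_def mem_principal_iff)
  have rel: "(\<Sum>\<alpha>\<in>E. \<Sum>j<d. F \<alpha> j * ((\<Prod>i<N. Q i z ^ \<alpha> i) * z k ^ j)) = 0" for z
    using arg_cong[OF rel0[of z], of "\<lambda>s. s / ?c"] by (simp add: F_def E_def sum_divide_distrib)
  have d: "0 < d" using 1(2) by simp
  \<comment> \<open>\<open>W\<close> is a multiple of \<open>d ^ N\<close>, so modulo
    \<open>d ^ N\<close> the weighted degree \<open>\<omega> \<alpha>\<close> has the entries of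
    \<open>\<alpha>\<close> as digits in base \<open>d\<close>. The factor 2 makes
    \<open>d ^ i < W\<close> strict, also for \<open>d = 1\<close>.\<close>
  define W where "W = 2 * d ^ N"
  define w where "w i = W + d ^ i" for i
  define \<omega> where "\<omega> \<alpha> = (\<Sum>i<N. w i * \<alpha> i)" for \<alpha>
  have w: "0 < W" "\<And>i. i < N \<Longrightarrow> W \<le> w i" "\<And>i. i < N \<Longrightarrow> w i < 2 * W"
  proof -
    fix i assume "i < N"
    then have "d ^ i \<le> d ^ N" using d by (intro power_increasing) auto
    also have "\<dots> < W" using d by (simp add: W_def)
    finally show "w i < 2 * W" by (simp add: w_def)
  qed (simp_all add: W_def w_def d)
  have inj: "\<alpha> = \<beta>" if "\<alpha> \<in> E" "\<beta> \<in> E" "\<omega> \<alpha> = \<omega> \<beta>" for \<alpha> \<beta>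
  proof -
    let ?s = "\<lambda>\<alpha>. \<Sum>i<N. \<alpha> i * d ^ i"
    have \<omega>: "\<omega> \<alpha> = ?s \<alpha> + d ^ N * (2 * (\<Sum>i<N. \<alpha> i))" for \<alpha>
      by (simp add: \<omega>_def w_def W_def distrib_left sum.distrib sum_distrib_left mult_ac)
    have lt: "\<And>i. i < N \<Longrightarrow> \<alpha> i < d" "\<And>i. i < N \<Longrightarrow> \<beta> i < d"
      using that(1,2) by (auto simp: E_def PiE_iff)
    have "?s \<alpha> < d ^ N" "?s \<beta> < d ^ N" using lt by (auto intro: digits_bound)
    moreover have "\<omega> \<alpha> mod d ^ N = \<omega> \<beta> mod d ^ N" using that(3) by simp
    ultimately have "?s \<alpha> = ?s \<beta>" unfolding \<omega> by simp
    then have "\<forall>i<N. \<alpha> i = \<beta> i" using lt by (intro digits_unique) auto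
    then show ?thesis using that(1,2) unfolding E_def by (intro PiE_ext) auto
  qed
  define B where "B = {\<alpha> \<in> E. \<exists>j<d. F \<alpha> j \<in> levels}"
  have "fst a \<in> B" using a(1) c one_level by (auto simp: B_def F_def)
  moreover have "finite B" using finE by (simp add: B_def)
  \<comment> \<open>Only exponent vectors with a level among their coefficients count; the one of
    least weight will dominate.\<close>
  ultimately obtain \<alpha> where \<alpha>: "\<alpha> \<in> B" "\<And>\<beta>. \<beta> \<in> B \<Longrightarrow> \<omega> \<alpha> \<le> \<omega> \<beta>"
    using arg_min_if_finite[of B \<omega>] by (metis empty_iff not_less)
  have \<alpha>E: "\<alpha> \<in> E" using \<alpha>(1) by (simp add: B_def)
  define f where "f = (\<Sum>j<d. Polynomial.monom (F \<alpha> j) j)"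
  have coeff: "poly.coeff f j = (if j < d then F \<alpha> j else 0)" for j
    by (simp add: f_def coeff_sum)
  have poly: "poly f y = (\<Sum>j<d. F \<alpha> j * y ^ j)" for y
    by (simp add: f_def poly_sum poly_monom)
  have int: "integral_poly f" using F_mem[OF \<alpha>E] by (simp add: integral_poly_def coeff zero_mem)
  have small: "poly f (y k) \<in> principal t" if t: "t \<in> levels" "t \<in> maximal_ideal" and y: "good t y" for t y
  proof -
    note tR = levels_D[OF t(1)]
    obtain x where x: "good t x" "\<And>i. i < N \<Longrightarrow> Q i x / t ^ w i - 1 \<in> principal t"
      using prescribed_values[OF t, of W w] w by blast
    define u where "u \<beta> = (\<Prod>i<N. (Q i x / t ^ w i) ^ \<beta> i)" for \<beta>
    have u: "u \<beta> - 1 \<in> principal t" for \<beta>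
      unfolding u_def using tR(1) x(2) by (intro prod_one_mod) auto
    have u_mem: "u \<beta> \<in> R" for \<beta>
      using add_mem[OF principal_mem[OF tR(1) u[of \<beta>]] one_mem] by simp
    have prod: "(\<Prod>i<N. Q i x ^ \<beta> i) = t ^ \<omega> \<beta> * u \<beta>" for \<beta>
      using tR(2) by (simp add: \<omega>_def u_def power_sum power_mult power_divide prod_dividef)
    have xk: "x k \<in> R" using x(1) k maximal_ideal_mem[OF X_D] by (simp add: good_def)
    have yk: "y k \<in> R" using y k maximal_ideal_mem[OF X_D] by (simp add: good_def)
    define T where "T \<beta> = (\<Sum>j<d. F \<beta> j * ((\<Prod>i<N. Q i x ^ \<beta> i) * x k ^ j))" for \<beta>
    \<comment> \<open>Terms of larger weight carry an extra factor \<open>t\<close>. Terms of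
      smaller weight lie outside \<open>B\<close>, so their coefficients are no levels and are
      divisible by every power of \<open>t\<close>.\<close>
    have other: "T \<beta> \<in> principal (t ^ (\<omega> \<alpha> + 1))" if \<beta>: "\<beta> \<in> E - {\<alpha>}" for \<beta>
    proof (cases "\<omega> \<alpha> < \<omega> \<beta>")
      case True
      then have "t ^ \<omega> \<beta> \<in> principal (t ^ (\<omega> \<alpha> + 1))" using tR(1) by (intro power_principal) auto
      then have "(\<Prod>i<N. Q i x ^ \<beta> i) \<in> principal (t ^ (\<omega> \<alpha> + 1))"
        unfolding prod using u_mem by (rule mult_principal_right)
      then show ?thesis
        unfolding T_def using \<beta> F_mem xk
        by (intro sum_principal mult_principal_left[of "F _ _"] mult_principal_right power_mem) auto
    next
      case False
      moreover have "\<omega> \<beta> \<noteq> \<omega> \<alpha>" using inj[of \<beta> \<alpha>] \<beta> \<alpha>E by auto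
      ultimately have "\<omega> \<beta> < \<omega> \<alpha>" by simp
      then have "\<beta> \<notin> B" using \<alpha>(2) by force
      then have "F \<beta> j \<in> principal (t ^ (\<omega> \<alpha> + 1))" if "j < d" for j
        using that \<beta> by (intro tiny_principal levels_power t F_mem) (auto simp: B_def)
      then show ?thesis
        unfolding T_def prod using xk u_mem tR(1)
        by (intro sum_principal mult_principal_right mult_mem power_mem) auto
    qed
    have "T \<alpha> = - sum T (E - {\<alpha>})"
      using rel[of x] finE \<alpha>E by (simp add: T_def sum.remove add_eq_0_iff2)
    moreover have "- sum T (E - {\<alpha>}) \<in> principal (t ^ (\<omega> \<alpha> + 1))"
      using other by (intro uminus_principal sum_principal)
    ultimately have "T \<alpha> \<in> principal (t ^ (\<omega> \<alpha> + 1))" by simp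
    moreover have "T \<alpha> = t ^ \<omega> \<alpha> * (u \<alpha> * poly f (x k))"
      unfolding T_def prod poly by (simp add: sum_distrib_left mult_ac)
    ultimately have "t ^ \<omega> \<alpha> * (u \<alpha> * poly f (x k)) \<in> principal (t ^ \<omega> \<alpha> * t)"
      by (simp add: mult.commute)
    then have "u \<alpha> * poly f (x k) \<in> principal t"
      using principal_mult_cancel tR(2) by simp
    \<comment> \<open>\<open>u \<alpha>\<close> is congruent to 1 modulo \<open>t\<close>, so it can
      be replaced by 1.\<close>
    moreover have "(u \<alpha> - 1) * poly f (x k) \<in> principal t"
      using u integral_poly_mem[OF int xk] by (rule mult_principal_right)
    ultimately have "u \<alpha> * poly f (x k) - (u \<alpha> - 1) * poly f (x k) \<in> principal t"
      by (rule diff_principal)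
    then have fx: "poly f (x k) \<in> principal t" by (simp add: algebra_simps)
    \<comment> \<open>So far the estimate concerns the auxiliary point \<open>x\<close>; two points
      good at \<open>t\<close> have coordinates congruent modulo \<open>t\<close>, so it carries
      over to \<open>y\<close>.\<close>
    have "poly f (y k) - poly f (x k) \<in> principal t"
      using poly_congruent[OF int xk yk good_diff[OF x(1) y k]] .
    from add_principal[OF this fx] show ?thesis by simp
  qed
  have "poly f (x k) \<in> principal t" if t: "t \<in> levels" and x: "good t x" for t x
  proof (cases "t \<in> maximal_ideal")
    case True
    then show ?thesis using small t x by blast
  next
    case False
    have "x k \<in> R" using x k maximal_ideal_mem[OF X_D] by (simp add: good_def)
    then show ?thesis using principal_unit[OF levels_D(1)[OF t] False] integral_poly_mem[OF int] by blast
  qed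
  moreover have "\<exists>j. poly.coeff f j \<in> levels" using \<alpha>(1) by (auto simp: B_def coeff)
  ultimately show ?thesis using that int by blast
qed

lemma good_coordinate:
  assumes "good t x" "k < N"
  shows "x k \<in> R"
  using assms maximal_ideal_mem[OF X_D] by (simp add: good_def)

text \<open>The limit is a root \<open>a\<close> of a polynomial \<open>f\<close> of minimal degree.
  Near the approximate coordinates the derivative of \<open>f\<close> equals a fixed
  \<open>s\<close> times a unit, so small values of \<open>f\<close> force closeness to
  \<open>a\<close>.\<close>

lemma coordinate_limit:
  assumes k: "k < N"
  shows "\<exists>a. \<forall>t\<in>levels. \<forall>x. good t x \<longrightarrow> a - x k \<in> principal t"
proof -
  define P where "P f \<longleftrightarrow> integral_poly f \<and> (\<exists>j. poly.coeff f j \<in> levels) \<and>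
    (\<forall>t x. t \<in> levels \<longrightarrow> good t x \<longrightarrow> poly f (x k) \<in> principal t)" for f
  obtain f0 where "P f0" by (rule coordinate_polynomial[OF k]) (auto simp: P_def)
  from ex_has_least_nat[of P, OF this, of degree]
  obtain f where f: "P f" and least: "\<And>g. P g \<Longrightarrow> degree f \<le> degree g" by blast
  have int: "integral_poly f" and small: "\<And>t x. t \<in> levels \<Longrightarrow> good t x \<Longrightarrow> poly f (x k) \<in> principal t"
    using f by (auto simp: P_def)
  let ?d = "degree f"
  have coeff_R: "poly.coeff f j \<in> R" for j using int by (simp add: integral_poly_def)
  \<comment> \<open>A leading coefficient that is no level is divisible by every level; dropping its
    term would keep all properties and lower the degree.\<close>
  have lead: "poly.coeff f ?d \<in> levels"
  proof (rule ccontr)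
    assume nl: "poly.coeff f ?d \<notin> levels"
    let ?g = "f - Polynomial.monom (poly.coeff f ?d) ?d"
    obtain j where j: "poly.coeff f j \<in> levels" using f by (auto simp: P_def)
    then have "j \<noteq> ?d" "poly.coeff f j \<noteq> 0" using nl levels_D by auto
    then have jd: "j < ?d" using le_degree[of f j] by simp
    have "integral_poly ?g"
      using int coeff_R by (simp add: integral_poly_def zero_mem)
    moreover have "poly.coeff ?g j \<in> levels" using j jd by simp
    moreover have "poly ?g (x k) \<in> principal t" if t: "t \<in> levels" and x: "good t x" for t x
    proof -
      have "poly.coeff f ?d \<in> principal t" using tiny_principal[OF coeff_R nl t] .
      then have "poly.coeff f ?d * x k ^ ?d \<in> principal t"
        using good_coordinate[OF x k] by (intro mult_principal_right power_mem)
      with small[OF t x] have "poly f (x k) - poly.coeff f ?d * x k ^ ?d \<in> principal t"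
        by (rule diff_principal)
      then show ?thesis by (simp add: poly_monom)
    qed
    ultimately have "?d \<le> degree ?g" using least unfolding P_def by blast
    moreover have "degree ?g < ?d"
    proof (rule degree_lessI)
      show "?g \<noteq> 0 \<or> 0 < ?d" using jd by simp
      show "\<forall>i\<ge>?d. poly.coeff ?g i = 0" by (auto simp: coeff_eq_0)
    qed
    ultimately show False by simp
  qed
  \<comment> \<open>A constant polynomial would give a level divisible by every level.\<close>
  have deg: "0 < ?d"
  proof (rule ccontr)
    assume "\<not> 0 < ?d"
    then obtain c where c: "f = [:c:]" by (auto elim: degree_eq_zeroE)
    have "c \<in> principal t" if "t \<in> levels" for t
      using that small unfolding c by (auto simp: levels_def)
    then show False using not_level lead by (simp add: c)
  qed
  have "degree (pderiv f) \<le> ?d - 1"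
    by (rule degree_le) (auto simp: coeff_pderiv coeff_eq_0 simp del: of_nat_Suc)
  then have "\<not> P (pderiv f)" using least[of "pderiv f"] deg by auto
  \<comment> \<open>The degree is a unit of \<open>R\<close>, because the residue field has
    characteristic zero.\<close>
  moreover have "poly.coeff (pderiv f) (?d - 1) \<in> levels"
  proof -
    have unit: "(of_nat ?d :: 'k) \<noteq> 0" "inverse (of_nat ?d :: 'k) \<in> R"
      using of_nat_unit[OF deg] zero_maximal_ideal of_nat_mem by (auto simp: maximal_ideal_def)
    have "poly.coeff f ?d \<in> principal (of_nat ?d * poly.coeff f ?d)"
      using unit levels_D[OF lead] by (simp add: mem_principal_iff inverse_eq_divide)
    then show ?thesis
      using levels_down[OF lead] deg coeff_R by (simp add: coeff_pderiv mult_mem of_nat_mem del: of_nat_Suc)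
  qed
  \<comment> \<open>The derivative is integral and has a level among its coefficients, so by
    minimality it must violate smallness at some good point.\<close>
  ultimately obtain t0 x0 where 0: "t0 \<in> levels" "good t0 x0" "poly (pderiv f) (x0 k) \<notin> principal t0"
    using integral_poly_pderiv[OF int] unfolding P_def by blast
  define s where "s = poly (pderiv f) (x0 k)"
  have s: "s \<noteq> 0" "t0 / s \<in> maximal_ideal"
    using not_principal_ratio[OF 0(3)] by (auto simp: s_def)
  have sR: "s \<in> R"
    unfolding s_def using integral_poly_mem integral_poly_pderiv int good_coordinate[OF 0(2) k] by blast
  note t0R = levels_D[OF 0(1)]
  have s_level: "s \<in> levels"
    using levels_down[OF 0(1) _ sR] maximal_ideal_mem[OF s(2)] s(1) by (simp add: mem_principal_iff)
  \<comment> \<open>Two forms of closeness are needed: \<open>x1 k\<close> is within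
    \<open>t0\<close> of \<open>x0 k\<close>, while for the root \<open>a\<close> only a distance in
    \<open>s\<close> times the maximal ideal is known.\<close>
  have deriv: "poly (pderiv f) y / s - 1 \<in> maximal_ideal"
    if "y \<in> R" "y - x0 k \<in> principal t0 \<or> (y - x0 k) / s \<in> maximal_ideal" for y
  proof -
    have R0: "x0 k \<in> R" using good_coordinate[OF 0(2) k] .
    have "t0 * ((y - x0 k) / t0) / s \<in> maximal_ideal" if "y - x0 k \<in> principal t0"
      using that t0R mult_maximal_ideal'[OF s(2), of "(y - x0 k) / t0"] by (simp add: mem_principal_iff)
    then have m: "(y - x0 k) / s \<in> maximal_ideal" using that(2) t0R(2) by auto
    have "poly (pderiv f) y - s \<in> principal (y - x0 k)"
      unfolding s_def using int that(1) R0 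
      by (intro poly_congruent integral_poly_pderiv principal_self)
    then obtain c where "c \<in> R" "poly (pderiv f) y - s = (y - x0 k) * c" by (auto simp: principal_def)
    then have "poly (pderiv f) y / s - 1 = (y - x0 k) / s * c" using s(1) by (simp add: field_simps)
    then show ?thesis using mult_maximal_ideal'[OF m \<open>c \<in> R\<close>] by simp
  qed
  \<comment> \<open>At level \<open>t0\<^sup>2\<close> the value of \<open>f\<close> at
    \<open>x1 k\<close> is small compared with the square of the derivative, as
    \<open>hensel_newton\<close> requires.\<close>
  obtain x1 where x1: "good (t0\<^sup>2) x1" using levels_square[OF 0(1)] by (auto simp: levels_def)
  note x1R = good_coordinate[OF x1 k]
  have "good t0 x1" using good_mono[OF x1] square_principal[OF t0R(1) principal_self] .
  then have x10: "x1 k - x0 k \<in> principal t0" using good_diff[OF 0(2) _ k] by blast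
  define s1 where "s1 = poly (pderiv f) (x1 k)"
  have u1: "s1 / s - 1 \<in> maximal_ideal" unfolding s1_def using deriv[OF x1R] x10 by blast
  have u1': "s1 / s \<noteq> 0" "s1 / s \<in> R" "inverse (s1 / s) \<in> R" using one_plus_unit[OF u1] by auto
  have "poly f (x1 k) / s1\<^sup>2 \<in> maximal_ideal"
  proof -
    have "poly f (x1 k) / t0\<^sup>2 \<in> R"
      using small[OF levels_square[OF 0(1)] x1] t0R by (simp add: mem_principal_iff)
    moreover have "(inverse (s1 / s))\<^sup>2 * ((t0 / s) * (t0 / s)) \<in> maximal_ideal"
      using u1'(3) s(2) by (intro mult_maximal_ideal power_mem) (auto simp: maximal_ideal_mem)
    ultimately have "(inverse (s1 / s))\<^sup>2 * ((t0 / s) * (t0 / s)) * (poly f (x1 k) / t0\<^sup>2) \<in> maximal_ideal"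
      by (rule mult_maximal_ideal'[rotated])
    also have "(inverse (s1 / s))\<^sup>2 * ((t0 / s) * (t0 / s)) * (poly f (x1 k) / t0\<^sup>2)
        = poly f (x1 k) / s1\<^sup>2"
      using t0R(2) s(1) u1'(1) by (simp add: field_simps power2_eq_square)
    finally show ?thesis .
  qed
  then obtain c where c: "c \<in> maximal_ideal" "poly f (x1 k + s1 * c) = 0"
    using hensel_newton[OF int x1R s1_def] u1'(1) by auto
  define a where "a = x1 k + s1 * c"
  have s1R: "s1 \<in> R" unfolding s1_def using integral_poly_mem integral_poly_pderiv int x1R by blast
  have aR: "a \<in> R" using x1R s1R maximal_ideal_mem[OF c(1)] by (simp add: a_def ring_mem)
  have near: "(y - a) / s \<in> maximal_ideal" if "y - x1 k \<in> principal t0" for y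
  proof -
    have "(y - x1 k) / t0 \<in> R" using that t0R by (simp add: mem_principal_iff)
    then have "(t0 / s) * ((y - x1 k) / t0) - (s1 / s) * c \<in> maximal_ideal"
      using s(2) u1'(2) c(1) by (intro diff_maximal_ideal mult_maximal_ideal' mult_maximal_ideal)
    moreover have "(t0 / s) * ((y - x1 k) / t0) - (s1 / s) * c = (y - a) / s"
      using t0R(2) s(1) by (simp add: a_def field_simps)
    ultimately show ?thesis by simp
  qed
  have a_deriv: "poly (pderiv f) a / s - 1 \<in> maximal_ideal"
  proof (rule deriv[OF aR])
    have "x0 k - x1 k \<in> principal t0" using uminus_principal[OF x10] by simp
    from uminus_maximal_ideal[OF near[OF this]] 
    show "a - x0 k \<in> principal t0 \<or> (a - x0 k) / s \<in> maximal_ideal" by (simp add: minus_divide_left)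
  qed
  have "a - x k \<in> principal t" if t: "t \<in> levels" and x: "good t x" for t x
  proof -
    \<comment> \<open>The factor \<open>s\<close> will be lost when the derivative is cancelled, and
      \<open>t0\<^sup>2\<close> keeps \<open>y\<close> close to \<open>x1\<close>.\<close>
    let ?t = "t * s * t0\<^sup>2"
    have tl: "?t \<in> levels" by (intro levels_mult levels_square t s_level 0)
    then obtain y where y: "good ?t y" by (auto simp: levels_def)
    note R = levels_D(1)[OF t] t0R(1) sR
    have "good t y" using good_mono[OF y] principalI[of "s * t0\<^sup>2" t] R by (simp add: ring_mem mult.assoc)
    then have yx: "y k - x k \<in> principal t" using good_diff[OF x _ k] by blast
    have "good (t0\<^sup>2) y"
      using good_mono[OF y] principalI[of "t * s" "t0\<^sup>2"] R by (simp add: ring_mem mult_ac)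
    then have "y k - x1 k \<in> principal t0"
      using square_principal[OF t0R(1) good_diff[OF x1 _ k]] by blast
    from near[OF this] have m: "(y k - a) / s \<in> maximal_ideal" .
    define h where "h = y k - a"
    obtain g where g: "integral_poly g"
      "\<And>h. poly f (a + h) = poly f a + h * poly (pderiv f) a + h\<^sup>2 * poly g h"
      using poly_taylor[OF int aR] by blast
    have hR: "h \<in> R" using good_coordinate[OF y k] aR by (simp add: h_def diff_mem)
    \<comment> \<open>Taylor's formula at the root \<open>a\<close> reads
      \<open>poly f (a + h) = s * (?u * h)\<close>; since \<open>h / s\<close> lies in the maximal
      ideal, \<open>?u\<close> is a unit.\<close>
    let ?u = "poly (pderiv f) a / s + h / s * poly g h"
    have "(poly (pderiv f) a / s - 1) + h / s * poly g h \<in> maximal_ideal"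
      using m integral_poly_mem[OF g(1) hR]
      by (intro add_maximal_ideal a_deriv mult_maximal_ideal') (simp_all add: h_def)
    then have "?u - 1 \<in> maximal_ideal" by (simp add: algebra_simps)
    from one_plus_unit(2,3)[OF this] have u: "?u \<noteq> 0" "inverse ?u \<in> R" .
    have "poly f a = 0" using c(2) by (simp add: a_def)
    then have "poly f (a + h) = s * (?u * h)"
      using s(1) by (simp add: g(2) field_simps power2_eq_square)
    then have "poly f (y k) = s * (?u * h)" by (simp add: h_def)
    then have "s * (?u * h) \<in> principal ?t" using small[OF tl y] by simp
    moreover have "?t \<in> principal (s * t)"
      using principalI[of "t0\<^sup>2" "s * t"] R by (simp add: ring_mem mult_ac)
    ultimately have "s * (?u * h) \<in> principal (s * t)" using principal_subset by blast
    then have "?u * h \<in> principal t" using principal_mult_cancel s(1) by simp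
    with u have "h \<in> principal t" by (rule unit_mult_principal)
    from diff_principal[OF yx this] show ?thesis by (simp add: h_def)
  qed
  then show ?thesis by blast
qed

text \<open>The vector of the limits is close to a good point of every level, hence good at every
  level itself by \<open>lipschitz\<close>; \<open>not_all_good\<close> excludes this.\<close>

lemma contradiction: False
proof -
  have "\<exists>a. \<forall>k<N. \<forall>t\<in>levels. \<forall>x. good t x \<longrightarrow> a k - x k \<in> principal t"
    using coordinate_limit by metis
  then obtain a where a: "\<And>k t x. k < N \<Longrightarrow> t \<in> levels \<Longrightarrow> good t x \<Longrightarrow> a k - x k \<in> principal t"
    by blast
  have aX: "a \<in> X"
  proof (rule X_I)
    fix k assume k: "k < N"
    obtain t where t: "t \<in> levels" "t \<in> maximal_ideal" by (rule small_level)
    then obtain x where x: "good t x" by (auto simp: levels_def)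
    have "(a k - x k) + x k \<in> maximal_ideal"
      using principal_maximal_ideal[OF t(2) a[OF k t(1) x]] X_D[OF _ k] x
      by (intro add_maximal_ideal) (auto simp: good_def)
    then show "a k \<in> maximal_ideal" by simp
  qed
  have "good t a" if t: "t \<in> levels" for t
  proof -
    obtain x where x: "good t x" using t by (auto simp: levels_def)
    then have xX: "x \<in> X" by (simp add: good_def)
    define h where "h = (\<lambda>j. a j - x j)"
    have hX: "h \<in> X" using aX xX by (simp add: h_def X_def diff_maximal_ideal)
    have "Q i a - Q i x \<in> principal t" if "i < N" for i
      using lipschitz[OF xX levels_D(1)[OF t] hX _ that] a[OF _ t x] by (simp add: h_def)
    moreover have "Q i x \<in> principal t" if "i < N" for i using x that by (simp add: good_def)
    ultimately have "(Q i a - Q i x) + Q i x \<in> principal t" if "i < N" for i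
      using that by (intro add_principal)
    then show ?thesis using aX by (simp add: good_def)
  qed
  moreover obtain t where "t \<in> levels" "\<not> good (t\<^sup>2) a" using not_all_good[OF aX] by blast
  ultimately show False using levels_square by blast
qed

end

theorem (in henselian_subring) hensel_system_zero:
  assumes "hensel_system R N Q A" and "\<And>m::nat. 0 < m \<Longrightarrow> of_nat m \<notin> maximal_ideal"
    and "\<And>i. i < N \<Longrightarrow> polynomial_map N D (Q i)"
  shows "\<exists>z. (\<forall>i<N. z i \<in> maximal_ideal) \<and> (\<forall>i<N. Q i z = 0)"
proof (rule ccontr)
  assume no: "\<not> ?thesis"
  interpret hensel_system R N Q A "{z. \<forall>i<N. z i \<in> maximal_ideal}" by (rule assms(1))
  interpret hensel_system_without_zero R N Q A "{z. \<forall>i<N. z i \<in> maximal_ideal}" D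
    by unfold_locales (use assms no in auto)
  show False by (rule contradiction)
qed

section \<open>Evaluation and Taylor expansion of polynomials in several variables\<close>

definition monomial_eval :: "(nat \<Rightarrow>\<^sub>0 nat) \<Rightarrow> (nat \<Rightarrow> 'a::comm_ring_1) \<Rightarrow> 'a" where
  "monomial_eval m x = (\<Prod>i\<in>Poly_Mapping.keys m. x i ^ Poly_Mapping.lookup m i)"

lemma monomial_eval_superset:
  assumes "finite S" "Poly_Mapping.keys m \<subseteq> S"
  shows "monomial_eval m x = (\<Prod>i\<in>S. x i ^ Poly_Mapping.lookup m i)"
  unfolding monomial_eval_def using assms by (intro prod.mono_neutral_left) (auto simp: in_keys_iff)

lemma monomial_eval_add: "monomial_eval (m + m') x = monomial_eval m x * monomial_eval m' x"
proof -
  let ?S = "Poly_Mapping.keys m \<union> Poly_Mapping.keys m'"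
  have "Poly_Mapping.keys (m + m') \<subseteq> ?S" by (rule Poly_Mapping.keys_add)
  then show ?thesis
    by (simp add: monomial_eval_superset[of ?S] lookup_add power_add prod.distrib)
qed

lemma mpoly_eval_superset:
  assumes "finite S" "Poly_Mapping.keys f \<subseteq> S"
  shows "mpoly_eval f x = (\<Sum>m\<in>S. Poly_Mapping.lookup f m * monomial_eval m x)"
  unfolding mpoly_eval_def monomial_eval_def[symmetric]
  using assms by (intro sum.mono_neutral_left) (auto simp: in_keys_iff)

lemma mpoly_eval_zero [simp]: "mpoly_eval 0 x = 0"
  by (simp add: mpoly_eval_def)

lemma mpoly_eval_add: "mpoly_eval (f + g) x = mpoly_eval f x + mpoly_eval g x"
proof -
  let ?S = "Poly_Mapping.keys f \<union> Poly_Mapping.keys g"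
  have "Poly_Mapping.keys (f + g) \<subseteq> ?S" by (rule Poly_Mapping.keys_add)
  then show ?thesis
    by (simp add: mpoly_eval_superset[of ?S] lookup_add distrib_right sum.distrib)
qed

lemma mpoly_eval_sum: "mpoly_eval (sum f A) x = (\<Sum>a\<in>A. mpoly_eval (f a) x)"
  by (induction A rule: infinite_finite_induct) (simp_all add: mpoly_eval_add)

lemma mpoly_eval_single: "mpoly_eval (Poly_Mapping.single m c) x = c * monomial_eval m x"
  using mpoly_eval_superset[of "{m}" "Poly_Mapping.single m c" x] by simp

lemma mpoly_monomial_sum:
  fixes f :: "'a::comm_ring_1 mpolynomial"
  shows "f = (\<Sum>m\<in>Poly_Mapping.keys f. Poly_Mapping.single m (Poly_Mapping.lookup f m))"
  by (rule poly_mapping_eqI) (simp add: lookup_sum lookup_single when_def in_keys_iff)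

lemma mpoly_eval_mult: "mpoly_eval (f * g) x = mpoly_eval f x * mpoly_eval g x"
proof -
  let ?s = "\<lambda>f m. Poly_Mapping.single m (Poly_Mapping.lookup f m)"
  have "f * g = (\<Sum>m\<in>Poly_Mapping.keys f. \<Sum>m'\<in>Poly_Mapping.keys g. ?s f m * ?s g m')"
    by (subst mpoly_monomial_sum[of f], subst mpoly_monomial_sum[of g], rule sum_product)
  then show ?thesis
    by (simp add: mpoly_eval_sum mult_single mpoly_eval_single monomial_eval_add sum_product mult_ac
        mpoly_eval_superset[of "Poly_Mapping.keys f" f] mpoly_eval_superset[of "Poly_Mapping.keys g" g])
qed

text \<open>Packaged as a homomorphism so that evaluation can be moved inside the Jacobian
  determinant.\<close>

lemma mpoly_eval_hom: "comm_ring_hom (\<lambda>f. mpoly_eval f x)"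
proof
  show "mpoly_eval 1 x = 1"
    using mpoly_eval_single[of 0 1 x] by (simp add: monomial_eval_def)
qed (simp_all add: mpoly_eval_add mpoly_eval_mult)

lemma mpoly_eval_cong:
  assumes "f \<in> mpolys_over S I" "\<And>i. i \<in> I \<Longrightarrow> x i = y i"
  shows "mpoly_eval f x = mpoly_eval f y"
  unfolding mpoly_eval_def using assms
  by (intro sum.cong arg_cong2[of _ _ _ _ "(*)"] prod.cong) (auto simp: mpolys_over_def subset_iff)

lemma mpoly_eval_pderiv:
  "mpoly_eval (mpoly_pderiv i f) x = (\<Sum>m\<in>Poly_Mapping.keys f.
     of_nat (Poly_Mapping.lookup m i) * Poly_Mapping.lookup f m * monomial_eval (m - Poly_Mapping.single i 1) x)"
  by (simp add: mpoly_pderiv_def mpoly_eval_sum mpoly_eval_single)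

text \<open>The truncated exponent is harmless because of the factor in front. The right-hand side
  has the form that the product rule \<open>first_order_prod\<close> produces.\<close>

lemma monomial_eval_pderiv:
  assumes "finite I" "Poly_Mapping.keys m \<subseteq> I" "i \<in> I"
  shows "of_nat (Poly_Mapping.lookup m i) * monomial_eval (m - Poly_Mapping.single i 1) x =
    of_nat (Poly_Mapping.lookup m i) * x i ^ (Poly_Mapping.lookup m i - 1) *
      (\<Prod>j\<in>I - {i}. x j ^ Poly_Mapping.lookup m j)"
proof (cases "Poly_Mapping.lookup m i = 0")
  case False
  have "Poly_Mapping.keys (m - Poly_Mapping.single i 1) \<subseteq> I"
    using assms(2) by (auto simp: in_keys_iff lookup_minus)
  then have "monomial_eval (m - Poly_Mapping.single i 1) x =
      (\<Prod>j\<in>I. x j ^ Poly_Mapping.lookup (m - Poly_Mapping.single i 1) j)"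
    using assms(1) by (intro monomial_eval_superset)
  also have "\<dots> = x i ^ (Poly_Mapping.lookup m i - 1) *
      (\<Prod>j\<in>I - {i}. x j ^ Poly_Mapping.lookup (m - Poly_Mapping.single i 1) j)"
    using assms(1,3) by (simp add: prod.remove lookup_minus)
  also have "(\<Prod>j\<in>I - {i}. x j ^ Poly_Mapping.lookup (m - Poly_Mapping.single i 1) j)
      = (\<Prod>j\<in>I - {i}. x j ^ Poly_Mapping.lookup m j)"
    by (intro prod.cong) (auto simp: lookup_minus lookup_single when_def)
  finally show ?thesis by (simp add: mult.assoc)
qed simp

lemma polynomial_map_sum_ex:
  assumes "finite A" "\<And>a. a \<in> A \<Longrightarrow> \<exists>d. polynomial_map N d (f a)"
  shows "\<exists>d. polynomial_map N d (\<lambda>z. \<Sum>a\<in>A. f a z)"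
  using assms
proof (induction A rule: finite_induct)
  case empty
  then show ?case using polynomial_map_const[of N 0 0] by auto
next
  case (insert a A)
  obtain d where "polynomial_map N d (f a)" using insert.prems by auto
  moreover obtain d' where "polynomial_map N d' (\<lambda>z. \<Sum>a\<in>A. f a z)"
    using insert by auto
  ultimately have "polynomial_map N (max d d') (\<lambda>z. f a z + (\<Sum>a\<in>A. f a z))"
    by (intro polynomial_map_add) (auto elim: polynomial_map_mono)
  then show ?case using insert.hyps by auto
qed

lemma polynomial_map_scale: "\<exists>d. polynomial_map N d f \<Longrightarrow> \<exists>d. polynomial_map N d (\<lambda>z. c * f z)"
  using polynomial_map_mult[OF polynomial_map_const] by blast

lemma polynomial_map_prod_ex:
  assumes "finite A" "\<And>a. a \<in> A \<Longrightarrow> \<exists>d. polynomial_map N d (f a)"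
  shows "\<exists>d. polynomial_map N d (\<lambda>z. \<Prod>a\<in>A. f a z)"
  using assms
proof (induction A rule: finite_induct)
  case empty
  then show ?case using polynomial_map_const[of N 0 1] by auto
next
  case (insert a A)
  obtain d where "polynomial_map N d (f a)" using insert.prems by auto
  moreover obtain d' where "polynomial_map N d' (\<lambda>z. \<Prod>a\<in>A. f a z)"
    using insert by auto
  ultimately have "polynomial_map N (d + d') (\<lambda>z. f a z * (\<Prod>a\<in>A. f a z))"
    by (rule polynomial_map_mult)
  then show ?case using insert.hyps by auto
qed

lemma polynomial_map_mpoly_eval:
  assumes "f \<in> mpolys_over S I" "\<And>k. k \<in> I \<Longrightarrow> polynomial_map N 1 (\<lambda>z. g z k)"
  shows "\<exists>d. polynomial_map N d (\<lambda>z. mpoly_eval f (g z))"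
  unfolding mpoly_eval_def
proof (intro polynomial_map_sum_ex polynomial_map_scale polynomial_map_prod_ex)
  fix m i assume "m \<in> Poly_Mapping.keys f" "i \<in> Poly_Mapping.keys m"
  then have "i \<in> I" using assms(1) by (auto simp: mpolys_over_def)
  then show "\<exists>d. polynomial_map N d (\<lambda>z. g z i ^ Poly_Mapping.lookup m i)"
    using polynomial_map_power[OF assms(2)] by blast
qed simp_all

section \<open>Taylor expansion to first order\<close>

context valuation_subring
begin

text \<open>\<open>L\<close> is the differential of an expansion; the rules below are the sum,
  product and power rules, with errors tracked as ideals instead of limits.\<close>

definition first_order :: "'k \<Rightarrow> 'k \<Rightarrow> 'k \<Rightarrow> 'k \<Rightarrow> bool" where
  "first_order t a b L \<longleftrightarrow> a \<in> R \<and> L \<in> principal t \<and> b - a - L \<in> principal (t\<^sup>2)"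

lemma first_order_const: "a \<in> R \<Longrightarrow> first_order t a a 0"
  by (simp add: first_order_def zero_principal)

lemma first_order_add:
  assumes "first_order t a b L" "first_order t a' b' L'"
  shows "first_order t (a + a') (b + b') (L + L')"
proof -
  have "(b + b') - (a + a') - (L + L') = (b - a - L) + (b' - a' - L')" by simp
  then show ?thesis
    using assms add_principal[of "b - a - L" "t\<^sup>2" "b' - a' - L'"]
    by (simp only: first_order_def) (simp add: add_mem add_principal)
qed

lemma first_order_mult:
  assumes t: "t \<in> R" and a: "first_order t a b L" and a': "first_order t a' b' L'"
  shows "first_order t (a * a') (b * b') (a * L' + L * a')"
proof -
  define s s' where "s = b - a - L" and "s' = b' - a' - L'"
  have s: "s \<in> principal (t\<^sup>2)" "s' \<in> principal (t\<^sup>2)" using a a' by (auto simp: first_order_def s_def s'_def)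
  have L: "L \<in> principal t" "L' \<in> principal t" using a a' by (auto simp: first_order_def)
  have R: "a \<in> R" "a' \<in> R" using a a' by (auto simp: first_order_def)
  have LR: "L \<in> R" "L' \<in> R" "s \<in> R" using L s t by (auto intro: principal_mem power_mem)
  have "b * b' - a * a' - (a * L' + L * a') = a * s' + L * L' + L * s' + s * (a' + L' + s')"
    unfolding s_def s'_def by (simp add: algebra_simps)
  also have "\<dots> \<in> principal (t\<^sup>2)"
  proof (intro add_principal)
    show "L * L' \<in> principal (t\<^sup>2)" using mult_principal[OF L] by (simp add: power2_eq_square)
    have "s' \<in> R" using s t by (auto intro: principal_mem power_mem)
    then show "s * (a' + L' + s') \<in> principal (t\<^sup>2)"
      using s R LR by (intro mult_principal_right add_mem)
  qed (use s R LR in \<open>auto intro: mult_principal_left\<close>)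
  finally show ?thesis
    using R L by (simp add: first_order_def mult_mem add_principal mult_principal_left mult_principal_right)
qed

lemma first_order_power:
  assumes t: "t \<in> R" and a: "first_order t a b L"
  shows "first_order t (a ^ n) (b ^ n) (of_nat n * a ^ (n - 1) * L)"
proof (induction n)
  case 0
  then show ?case using first_order_const[OF one_mem] by simp
next
  case (Suc n)
  have "a * (of_nat n * a ^ (n - 1) * L) + L * a ^ n = of_nat (Suc n) * a ^ (Suc n - 1) * L"
    by (cases n) (simp_all add: algebra_simps)
  then show ?case using first_order_mult[OF t a Suc] by simp
qed

lemma first_order_prod:
  assumes t: "t \<in> R" and "finite A" "\<And>i. i \<in> A \<Longrightarrow> first_order t (a i) (b i) (L i)"
  shows "first_order t (prod a A) (prod b A) (\<Sum>i\<in>A. L i * prod a (A - {i}))"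
  using assms(2,3)
proof (induction A rule: finite_induct)
  case empty
  then show ?case using first_order_const[OF one_mem] by simp
next
  case (insert k A)
  have "(\<Sum>i\<in>A. L i * prod a (insert k A - {i})) = (\<Sum>i\<in>A. a k * (L i * prod a (A - {i})))"
  proof (rule sum.cong[OF refl])
    fix i assume "i \<in> A"
    then have "insert k A - {i} = insert k (A - {i})" using insert.hyps by auto
    then show "L i * prod a (insert k A - {i}) = a k * (L i * prod a (A - {i}))"
      using insert.hyps by (simp add: mult_ac)
  qed
  then have "(\<Sum>i\<in>insert k A. L i * prod a (insert k A - {i}))
      = a k * (\<Sum>i\<in>A. L i * prod a (A - {i})) + L k * prod a A"
    using insert.hyps by (simp add: sum_distrib_left add.commute)
  moreover have fo: "first_order t (a k) (b k) (L k)"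
    "first_order t (prod a A) (prod b A) (\<Sum>i\<in>A. L i * prod a (A - {i}))"
    using insert by auto
  ultimately show ?case
    using first_order_mult[OF t fo] insert.hyps by (simp add: add.commute)
qed

lemma first_order_sum:
  assumes "\<And>i. i \<in> A \<Longrightarrow> first_order t (a i) (b i) (L i)"
  shows "first_order t (sum a A) (sum b A) (sum L A)"
  using assms
  by (induction A rule: infinite_finite_induct) (auto simp: first_order_const zero_mem first_order_add)

lemma mpoly_taylor:
  assumes f: "f \<in> mpolys_over R I" and I: "finite I" and t: "t \<in> R"
    and x: "\<And>i. i \<in> I \<Longrightarrow> x i \<in> R" and h: "\<And>i. i \<in> I \<Longrightarrow> h i \<in> principal t"
  shows "first_order t (mpoly_eval f x) (mpoly_eval f (\<lambda>i. x i + h i))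
    (\<Sum>i\<in>I. mpoly_eval (mpoly_pderiv i f) x * h i)"
proof -
  have keys: "Poly_Mapping.keys m \<subseteq> I" if "m \<in> Poly_Mapping.keys f" for m
    using f that by (auto simp: mpolys_over_def)
  have coeff: "Poly_Mapping.lookup f m \<in> R" for m using f by (simp add: mpolys_over_def)
  let ?L = "\<lambda>m. \<Sum>i\<in>I. of_nat (Poly_Mapping.lookup m i) * monomial_eval (m - Poly_Mapping.single i 1) x * h i"
  have mono: "first_order t (monomial_eval m x) (monomial_eval m (\<lambda>i. x i + h i)) (?L m)"
    if m: "m \<in> Poly_Mapping.keys f" for m
  proof -
    have pw: "first_order t (x i ^ Poly_Mapping.lookup m i) ((x i + h i) ^ Poly_Mapping.lookup m i)
        (of_nat (Poly_Mapping.lookup m i) * x i ^ (Poly_Mapping.lookup m i - 1) * h i)"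
      if "i \<in> I" for i
      using that x h t by (intro first_order_power) (auto simp: first_order_def zero_principal)
    have "first_order t (\<Prod>i\<in>I. x i ^ Poly_Mapping.lookup m i) (\<Prod>i\<in>I. (x i + h i) ^ Poly_Mapping.lookup m i)
        (\<Sum>i\<in>I. of_nat (Poly_Mapping.lookup m i) * x i ^ (Poly_Mapping.lookup m i - 1) * h i *
          (\<Prod>j\<in>I - {i}. x j ^ Poly_Mapping.lookup m j))"
      by (rule first_order_prod[OF t I]) (rule pw)
    moreover have "?L m = (\<Sum>i\<in>I. of_nat (Poly_Mapping.lookup m i) * x i ^ (Poly_Mapping.lookup m i - 1) * h i *
          (\<Prod>j\<in>I - {i}. x j ^ Poly_Mapping.lookup m j))"
      by (intro sum.cong refl, subst monomial_eval_pderiv[OF I keys[OF m]]) (simp_all add: mult_ac)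
    ultimately show ?thesis by (simp only: monomial_eval_superset[OF I keys[OF m]])
  qed
  \<comment> \<open>The term with factor 0 comes from the product rule: the coefficient of the
    monomial is a constant with differential 0.\<close>
  have "first_order t (\<Sum>m\<in>Poly_Mapping.keys f. Poly_Mapping.lookup f m * monomial_eval m x)
      (\<Sum>m\<in>Poly_Mapping.keys f. Poly_Mapping.lookup f m * monomial_eval m (\<lambda>i. x i + h i))
      (\<Sum>m\<in>Poly_Mapping.keys f. Poly_Mapping.lookup f m * ?L m + 0 * monomial_eval m x)"
    using coeff mono t by (intro first_order_sum first_order_mult first_order_const)
  moreover have "(\<Sum>m\<in>Poly_Mapping.keys f. Poly_Mapping.lookup f m * ?L m + 0 * monomial_eval m x)
      = (\<Sum>i\<in>I. mpoly_eval (mpoly_pderiv i f) x * h i)"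
    unfolding mpoly_eval_pderiv sum_distrib_left sum_distrib_right
    by (simp add: sum_distrib_left, subst sum.swap) (simp add: mult_ac)
  ultimately show ?thesis
    by (simp add: mpoly_eval_superset[of "Poly_Mapping.keys f" f])
qed

lemma mpoly_eval_congruent:
  assumes f: "f \<in> mpolys_over R I" and I: "finite I" and t: "t \<in> R"
    and x: "\<And>i. i \<in> I \<Longrightarrow> x i \<in> R" and y: "\<And>i. i \<in> I \<Longrightarrow> y i - x i \<in> principal t"
  shows "mpoly_eval f y - mpoly_eval f x \<in> principal t"
proof -
  have fo: "first_order t (mpoly_eval f x) (mpoly_eval f (\<lambda>i. x i + (y i - x i)))
      (\<Sum>i\<in>I. mpoly_eval (mpoly_pderiv i f) x * (y i - x i))"
    using assms by (intro mpoly_taylor)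
  have "t\<^sup>2 \<in> principal t" using power_principal[OF t, of 1 2] by simp
  then have "mpoly_eval f y - mpoly_eval f x - (\<Sum>i\<in>I. mpoly_eval (mpoly_pderiv i f) x * (y i - x i))
      + (\<Sum>i\<in>I. mpoly_eval (mpoly_pderiv i f) x * (y i - x i)) \<in> principal t"
    using fo principal_subset by (intro add_principal) (auto simp: first_order_def)
  then show ?thesis by simp
qed

lemma mpoly_eval_mem:
  assumes f: "f \<in> mpolys_over R I" and x: "\<And>i. i \<in> I \<Longrightarrow> x i \<in> R"
  shows "mpoly_eval f x \<in> R"
  unfolding mpoly_eval_def using f x
  by (intro sum_mem mult_mem prod_mem power_mem) (auto simp: mpolys_over_def)

text \<open>The maximal ideal need not be principal, so \<open>mpoly_eval_congruent\<close> is
  applied with the largest of the differences as modulus.\<close>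

lemma mpoly_eval_congruent_scaled:
  assumes f: "f \<in> mpolys_over R I" and I: "finite I" and c: "c \<in> R" "c \<noteq> 0"
    and x: "\<And>i. i \<in> I \<Longrightarrow> x i \<in> R" and y: "\<And>i. i \<in> I \<Longrightarrow> (y i - x i) / c \<in> maximal_ideal"
  shows "(mpoly_eval f y - mpoly_eval f x) / c \<in> maximal_ideal"
proof (cases "I = {}")
  case True
  then have "mpoly_eval f y = mpoly_eval f x" using f by (intro mpoly_eval_cong) auto
  then show ?thesis by (simp add: zero_maximal_ideal)
next
  case False
  let ?d = "\<lambda>i. y i - x i"
  obtain k where k: "k \<in> I" "\<And>i. i \<in> I \<Longrightarrow> ?d i \<in> principal (?d k)"
    using principal_maximum[OF I False, of ?d] by auto
  have "?d k = c * (?d k / c)" using c by simp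
  then have "?d k \<in> R" using mult_mem[OF c(1) maximal_ideal_mem[OF y[OF k(1)]]] by simp
  then have "mpoly_eval f y - mpoly_eval f x \<in> principal (?d k)"
    using f I x k(2) by (intro mpoly_eval_congruent)
  then obtain b where "b \<in> R" "mpoly_eval f y - mpoly_eval f x = ?d k * b"
    by (auto simp: principal_def)
  then show ?thesis using mult_maximal_ideal'[OF y[OF k(1)], of b] by simp
qed

lemma mpolys_over_sum:
  assumes "\<And>a. a \<in> A \<Longrightarrow> f a \<in> mpolys_over R I"
  shows "sum f A \<in> mpolys_over R I"
  using assms
proof (induction A rule: infinite_finite_induct)
  case (insert a A)
  then have "f a \<in> mpolys_over R I" "sum f A \<in> mpolys_over R I" by auto
  then have "f a + sum f A \<in> mpolys_over R I"
    using Poly_Mapping.keys_add[of "f a" "sum f A"]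
    unfolding mpolys_over_def by (simp add: lookup_add add_mem) blast
  then show ?case using insert.hyps by simp
qed (auto simp: mpolys_over_def zero_mem)

lemma mpoly_pderiv_over:
  assumes "f \<in> mpolys_over R I"
  shows "mpoly_pderiv i f \<in> mpolys_over R I"
  unfolding mpoly_pderiv_def
proof (rule mpolys_over_sum)
  fix m assume "m \<in> Poly_Mapping.keys f"
  then have "Poly_Mapping.keys m \<subseteq> I" using assms by (simp add: mpolys_over_def)
  moreover have "Poly_Mapping.keys (m - Poly_Mapping.single i 1) \<subseteq> Poly_Mapping.keys m"
    by (auto simp: in_keys_iff lookup_minus)
  ultimately have "Poly_Mapping.keys (m - Poly_Mapping.single i 1) \<subseteq> I" by blast
  moreover have "of_nat (Poly_Mapping.lookup m i) * Poly_Mapping.lookup f m \<in> R"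
    using assms by (simp add: mpolys_over_def mult_mem of_nat_mem)
  ultimately show "Poly_Mapping.single (m - Poly_Mapping.single i 1)
      (of_nat (Poly_Mapping.lookup m i) * Poly_Mapping.lookup f m) \<in> mpolys_over R I"
    by (auto simp: mpolys_over_def lookup_single when_def zero_mem)
qed

end

section \<open>Reduction of the implicit function problem\<close>

locale implicit_system = henselian_subring R for R :: "'k::field set" +
  fixes r n :: nat and p :: "nat \<Rightarrow> 'k mpolynomial" and e :: 'k
  assumes of_nat_unit: "0 < m \<Longrightarrow> of_nat m \<notin> maximal_ideal"
    and rn: "r < n"
    and p_over: "i \<in> {r + 1..n} \<Longrightarrow> p i \<in> mpolys_over R {1..n}"
    and e_eq: "e = mpoly_eval (jacobian_det r n p) (origin {1..n})"
    and e_nonzero: "e \<noteq> 0"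
    and p_origin: "i \<in> {r + 1..n} \<Longrightarrow> mpoly_eval (p i) (origin {1..n}) = 0"
begin

abbreviation codim :: nat where
  "codim \<equiv> n - r"

definition jac :: "(nat \<Rightarrow> 'k) \<Rightarrow> nat \<Rightarrow> nat \<Rightarrow> 'k" where
  "jac x i j = mpoly_eval (mpoly_pderiv (r + 1 + j) (p (r + 1 + i))) x"

lemma e_det: "e = Determinant.det (mat codim codim (\<lambda>(i, j). jac (origin {1..n}) i j))"
proof -
  interpret comm_ring_hom "\<lambda>f. mpoly_eval f (origin {1..n} :: nat \<Rightarrow> 'k)" by (rule mpoly_eval_hom)
  have "map_mat (\<lambda>f. mpoly_eval f (origin {1..n}))
      (mat codim codim (\<lambda>(i, j). mpoly_pderiv (r + 1 + j) (p (r + 1 + i))))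
      = mat codim codim (\<lambda>(i, j). jac (origin {1..n}) i j)"
    by (rule eq_matI) (auto simp: jac_def)
  then show ?thesis
    unfolding e_eq jacobian_det_def by (metis hom_det)
qed

lemma p_index: "i < codim \<Longrightarrow> r + 1 + i \<in> {r + 1..n}"
  by auto

lemma jac_mem:
  assumes "i < codim" "\<And>k. k \<in> {1..n} \<Longrightarrow> x k \<in> R"
  shows "jac x i j \<in> R"
  unfolding jac_def using assms p_over[OF p_index] by (intro mpoly_eval_mem mpoly_pderiv_over)

lemma origin_mem: "k \<in> {1..n} \<Longrightarrow> origin {1..n} k \<in> R"
  by (simp add: origin_def zero_mem)

text \<open>A fixed choice of an integral adjugate of the Jacobian matrix at the origin, so that the
  reduced system can refer to it.\<close>

definition cofactors :: "nat \<Rightarrow> nat \<Rightarrow> 'k" where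
  "cofactors = (SOME B. \<forall>i<codim. \<forall>j<codim. B i j \<in> R \<and>
    (\<Sum>l<codim. B i l * jac (origin {1..n}) l j) = (if i = j then e else 0) \<and>
    (\<Sum>l<codim. jac (origin {1..n}) i l * B l j) = (if i = j then e else 0))"

lemma cofactors:
  assumes "i < codim" "j < codim"
  shows "cofactors i j \<in> R"
    "(\<Sum>l<codim. cofactors i l * jac (origin {1..n}) l j) = (if i = j then e else 0)"
    "(\<Sum>l<codim. jac (origin {1..n}) i l * cofactors l j) = (if i = j then e else 0)"
proof -
  have "\<exists>B. \<forall>i<codim. \<forall>j<codim. B i j \<in> R \<and>
    (\<Sum>l<codim. B i l * jac (origin {1..n}) l j) = (if i = j then e else 0) \<and>
    (\<Sum>l<codim. jac (origin {1..n}) i l * B l j) = (if i = j then e else 0)"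
    by (rule adjugate[OF _ e_det]) (rule jac_mem[OF _ origin_mem])
  from someI_ex[OF this, folded cofactors_def] assms
  show "cofactors i j \<in> R"
    "(\<Sum>l<codim. cofactors i l * jac (origin {1..n}) l j) = (if i = j then e else 0)"
    "(\<Sum>l<codim. jac (origin {1..n}) i l * cofactors l j) = (if i = j then e else 0)"
    by blast+
qed

text \<open>\<open>e\<close> is a diagonal entry of the product of two integral matrices.\<close>

lemma e_mem: "e \<in> R"
proof -
  have "(\<Sum>l<codim. cofactors 0 l * jac (origin {1..n}) l 0) \<in> R"
    using rn by (intro sum_mem mult_mem cofactors jac_mem origin_mem) auto
  then show ?thesis using cofactors(2)[of 0 0] rn by simp
qed

text \<open>The vector \<open>z\<close> is indexed from 0 and the coordinates of the point from 1,
  hence the shift by \<open>Suc r\<close>.\<close>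

definition point :: "(nat \<Rightarrow> 'k) \<Rightarrow> (nat \<Rightarrow> 'k) \<Rightarrow> nat \<Rightarrow> 'k" where
  "point u z k = (if k \<le> r then u k else e * z (k - Suc r))"

definition admissible :: "(nat \<Rightarrow> 'k) \<Rightarrow> bool" where
  "admissible u \<longleftrightarrow> (\<forall>k\<in>{1..r}. u k / e\<^sup>2 \<in> maximal_ideal)"

definition small_vectors :: "(nat \<Rightarrow> 'k) set" where
  "small_vectors = {z. \<forall>i<codim. z i \<in> maximal_ideal}"

lemma point_small:
  assumes "admissible u" "z \<in> small_vectors" "k \<in> {1..n}"
  shows "(point u z k - origin {1..n} k) / e \<in> maximal_ideal"
proof (cases "k \<le> r")
  case True
  then have "u k / e\<^sup>2 \<in> maximal_ideal" using assms by (simp add: admissible_def)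
  from mult_maximal_ideal[OF e_mem this] show ?thesis
    using True assms(3) e_nonzero by (simp add: point_def origin_def power2_eq_square)
next
  case False
  then have "k - Suc r < codim" using assms(3) by auto
  then show ?thesis
    using False assms e_nonzero by (simp add: point_def origin_def small_vectors_def)
qed

lemma point_mem:
  assumes "admissible u" "z \<in> small_vectors" "k \<in> {1..n}"
  shows "point u z k \<in> R"
  using mult_mem[OF e_mem maximal_ideal_mem[OF point_small[OF assms]]] assms(3) e_nonzero
  by (simp add: origin_def)

text \<open>At \<open>point u z\<close> the system \<open>p\<close> is its value at
  \<open>z = 0\<close>, plus \<open>e\<close> times the Jacobian matrix applied to \<open>z\<close>,
  plus terms with a factor \<open>e\<^sup>2\<close>. The cofactors turn the linear part at the
  origin into \<open>e\<^sup>2 * z\<close>, so division by \<open>e\<^sup>2\<close> makes it the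
  identity.\<close>

definition reduced :: "(nat \<Rightarrow> 'k) \<Rightarrow> nat \<Rightarrow> (nat \<Rightarrow> 'k) \<Rightarrow> 'k" where
  "reduced u i z = (\<Sum>l<codim. cofactors i l / e\<^sup>2 * mpoly_eval (p (r + 1 + l)) (point u z))"

definition reduced_jac :: "(nat \<Rightarrow> 'k) \<Rightarrow> (nat \<Rightarrow> 'k) \<Rightarrow> nat \<Rightarrow> nat \<Rightarrow> 'k" where
  "reduced_jac u z i j = (\<Sum>l<codim. cofactors i l * jac (point u z) l j) / e"

lemma divide_principal: "c \<noteq> 0 \<Longrightarrow> a \<in> principal (c * t) \<Longrightarrow> a / c \<in> principal t"
  using principal_mult_cancel[of c "a / c" t] by simp

text \<open>The point lies within \<open>e\<close> times the maximal ideal of the origin, so the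
  entries of the Jacobian matrix change by as little, and the change stays in the maximal ideal
  after division by \<open>e\<close>.\<close>

lemma reduced_jac_near_identity:
  assumes u: "admissible u" and z: "z \<in> small_vectors" and ij: "i < codim" "j < codim"
  shows "reduced_jac u z i j - (if i = j then 1 else 0) \<in> maximal_ideal"
proof -
  have "(jac (point u z) l j - jac (origin {1..n}) l j) / e \<in> maximal_ideal" if "l < codim" for l
    unfolding jac_def using point_small[OF u z] origin_mem e_mem e_nonzero
    by (intro mpoly_eval_congruent_scaled[of _ "{1..n}"] mpoly_pderiv_over p_over[OF p_index[OF that]]) auto
  then have "(\<Sum>l<codim. cofactors i l * ((jac (point u z) l j - jac (origin {1..n}) l j) / e)) \<in> maximal_ideal"
    using cofactors(1)[OF ij(1)] by (intro sum_maximal_ideal mult_maximal_ideal) auto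
  also have "(\<Sum>l<codim. cofactors i l * ((jac (point u z) l j - jac (origin {1..n}) l j) / e))
      = reduced_jac u z i j - (\<Sum>l<codim. cofactors i l * jac (origin {1..n}) l j) / e"
    by (simp add: reduced_jac_def sum_divide_distrib diff_divide_distrib right_diff_distrib sum_subtractf)
  also have "(\<Sum>l<codim. cofactors i l * jac (origin {1..n}) l j) / e = (if i = j then 1 else 0)"
    using cofactors(2)[OF ij] e_nonzero by simp
  finally show ?thesis .
qed

text \<open>A change of \<open>z\<close> in the ideal of \<open>t\<close> moves the point by
  multiples of \<open>e * t\<close>; the remainder in the ideal of
  \<open>e\<^sup>2 * t\<^sup>2\<close> becomes one in that of \<open>t\<^sup>2\<close> on dividing
  by \<open>e\<^sup>2\<close>.\<close>

lemma reduced_taylor: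
  assumes u: "admissible u" and z: "z \<in> small_vectors" and t: "t \<in> R"
    and h: "\<And>j. j < codim \<Longrightarrow> h j \<in> principal t" and i: "i < codim"
  shows "reduced u i (\<lambda>j. z j + h j) - reduced u i z - (\<Sum>j<codim. reduced_jac u z i j * h j)
    \<in> principal (t\<^sup>2)"
proof -
  define H where "H k = (if k \<le> r then 0 else e * h (k - Suc r))" for k
  let ?P = "\<lambda>l x. mpoly_eval (p (r + 1 + l)) x"
  let ?S = "\<lambda>l. \<Sum>j<codim. jac (point u z) l j * (e * h j)"
  have shift: "point u (\<lambda>j. z j + h j) = (\<lambda>k. point u z k + H k)"
    by (auto simp: point_def H_def algebra_simps)
  have summand: "(?P l (point u (\<lambda>j. z j + h j)) - ?P l (point u z) - ?S l) / e\<^sup>2 \<in> principal (t\<^sup>2)"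
    if l: "l < codim" for l
  proof -
    have H: "H k \<in> principal (e * t)" if "k \<in> {1..n}" for k
    proof (cases "k \<le> r")
      case False
      then have "k - Suc r < codim" using that by auto
      then show ?thesis using False h e_nonzero by (simp add: H_def principal_mult_cancel)
    qed (simp add: H_def zero_principal)
    have "first_order (e * t) (?P l (point u z)) (?P l (\<lambda>k. point u z k + H k))
        (\<Sum>k\<in>{1..n}. mpoly_eval (mpoly_pderiv k (p (r + 1 + l))) (point u z) * H k)"
      using H point_mem[OF u z] e_mem t
      by (intro mpoly_taylor p_over[OF p_index[OF l]]) (auto intro: mult_mem)
    moreover have "(\<Sum>k\<in>{1..n}. mpoly_eval (mpoly_pderiv k (p (r + 1 + l))) (point u z) * H k) = ?S l"
    proof -
      have "(\<Sum>k\<in>{1..n}. mpoly_eval (mpoly_pderiv k (p (r + 1 + l))) (point u z) * H k)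
          = (\<Sum>k\<in>{r + 1..n}. mpoly_eval (mpoly_pderiv k (p (r + 1 + l))) (point u z) * H k)"
        by (intro sum.mono_neutral_right) (auto simp: H_def)
      also have "\<dots> = ?S l"
        by (rule sum.reindex_bij_witness[of _ "\<lambda>j. r + 1 + j" "\<lambda>k. k - Suc r"])
          (auto simp: jac_def H_def)
      finally show ?thesis .
    qed
    ultimately have "?P l (point u (\<lambda>j. z j + h j)) - ?P l (point u z) - ?S l \<in> principal (e\<^sup>2 * t\<^sup>2)"
      by (simp add: first_order_def shift power_mult_distrib)
    then show ?thesis using e_nonzero by (intro divide_principal) auto
  qed
  have "(\<Sum>j<codim. reduced_jac u z i j * h j) = (\<Sum>l<codim. cofactors i l * (?S l / e\<^sup>2))"
  proof -
    have "(\<Sum>j<codim. reduced_jac u z i j * h j)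
        = (\<Sum>j<codim. \<Sum>l<codim. cofactors i l * jac (point u z) l j * h j / e)"
      by (simp add: reduced_jac_def sum_divide_distrib sum_distrib_right)
    also have "\<dots> = (\<Sum>l<codim. \<Sum>j<codim. cofactors i l * jac (point u z) l j * h j / e)"
      by (rule sum.swap)
    also have "\<dots> = (\<Sum>l<codim. cofactors i l * (?S l / e\<^sup>2))"
      using e_nonzero
      by (simp add: sum_distrib_left sum_divide_distrib power2_eq_square mult_ac)
    finally show ?thesis .
  qed
  then have "reduced u i (\<lambda>j. z j + h j) - reduced u i z - (\<Sum>j<codim. reduced_jac u z i j * h j)
      = (\<Sum>l<codim. cofactors i l *
          ((?P l (point u (\<lambda>j. z j + h j)) - ?P l (point u z) - ?S l) / e\<^sup>2))"
    by (simp add: reduced_def sum_subtractf diff_divide_distrib right_diff_distrib)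
  also have "\<dots> \<in> principal (t\<^sup>2)"
    using summand cofactors(1)[OF i] by (intro sum_principal mult_principal_left) auto
  finally show ?thesis .
qed

text \<open>This is where the radius of the domain enters: \<open>u\<close> lies in
  \<open>e\<^sup>2\<close> times the maximal ideal and \<open>p\<close> vanishes at the origin, so
  the values at \<open>z = 0\<close> are small even after division by
  \<open>e\<^sup>2\<close>.\<close>

lemma reduced_origin:
  assumes u: "admissible u" and i: "i < codim"
  shows "reduced u i (\<lambda>_. 0) \<in> maximal_ideal"
proof -
  have close: "(mpoly_eval (p (r + 1 + l)) (point u (\<lambda>_. 0)) - mpoly_eval (p (r + 1 + l)) (origin {1..n})) / e\<^sup>2
      \<in> maximal_ideal" if l: "l < codim" for l
    using u origin_mem e_mem e_nonzero
    by (intro mpoly_eval_congruent_scaled[of _ "{1..n}"] p_over[OF p_index[OF l]])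
      (auto simp: point_def origin_def admissible_def zero_maximal_ideal intro: power_mem)
  then have "mpoly_eval (p (r + 1 + l)) (point u (\<lambda>_. 0)) / e\<^sup>2 \<in> maximal_ideal" if "l < codim" for l
    using close[OF that] p_origin[OF p_index[OF that]] by simp
  then have "(\<Sum>l<codim. cofactors i l * (mpoly_eval (p (r + 1 + l)) (point u (\<lambda>_. 0)) / e\<^sup>2)) \<in> maximal_ideal"
    using cofactors(1)[OF i] by (intro sum_maximal_ideal mult_maximal_ideal) auto
  then show ?thesis by (simp add: reduced_def)
qed

lemma reduced_hensel_system:
  assumes "admissible u"
  shows "hensel_system R codim (reduced u) (reduced_jac u)"
  using reduced_jac_near_identity[OF assms] reduced_taylor[OF assms] reduced_origin[OF assms]
  by unfold_locales (auto simp: small_vectors_def)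

lemma reduced_polynomial: "\<exists>d. \<forall>i<codim. polynomial_map codim d (reduced u i)"
proof -
  have coord: "polynomial_map codim 1 (\<lambda>z. point u z k)" if "k \<in> {1..n}" for k
  proof (cases "k \<le> r")
    case True
    then show ?thesis by (simp add: point_def polynomial_map_const)
  next
    case False
    then have "k - Suc r < codim" using that by auto
    from polynomial_map_mult[OF polynomial_map_const[of codim 0 e] polynomial_map_proj[OF this]] False
    show ?thesis by (simp add: point_def)
  qed
  have "\<exists>d. polynomial_map codim d (reduced u i)" for i
    unfolding reduced_def
    by (intro polynomial_map_sum_ex polynomial_map_scale)
      (auto intro!: polynomial_map_mpoly_eval[OF p_over coord])
  then obtain d where d: "\<And>i. polynomial_map codim (d i) (reduced u i)" by metis
  \<comment> \<open>The sum of the individual degree bounds is a common one.\<close>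
  have "polynomial_map codim (\<Sum>i<codim. d i) (reduced u i)" if "i < codim" for i
    using that by (intro polynomial_map_mono[OF d] member_le_sum) auto
  then show ?thesis by blast
qed

text \<open>A zero of the reduced system is multiplied by the Jacobian matrix at the origin, whose
  product with the cofactors is \<open>e\<close> times the identity; as \<open>e\<close> is nonzero,
  the original equations follow.\<close>

lemma solution_exists:
  assumes "admissible u"
  shows "\<exists>z\<in>small_vectors. \<forall>i\<in>{r + 1..n}. mpoly_eval (p i) (point u z) = 0"
proof -
  obtain d where "\<And>i. i < codim \<Longrightarrow> polynomial_map codim d (reduced u i)"
    using reduced_polynomial by blast
  then have "\<exists>z. (\<forall>i<codim. z i \<in> maximal_ideal) \<and> (\<forall>i<codim. reduced u i z = 0)"
    by (intro hensel_system_zero[OF reduced_hensel_system[OF assms] of_nat_unit])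
  then obtain z where z: "z \<in> small_vectors" "\<And>i. i < codim \<Longrightarrow> reduced u i z = 0"
    by (auto simp: small_vectors_def)
  have "mpoly_eval (p (r + 1 + m)) (point u z) = 0" if m: "m < codim" for m
  proof -
    let ?P = "\<lambda>l. mpoly_eval (p (r + 1 + l)) (point u z)"
    have "0 = (\<Sum>i<codim. jac (origin {1..n}) m i * reduced u i z)" using z(2) by simp
    also have "\<dots> = (\<Sum>i<codim. \<Sum>l<codim. jac (origin {1..n}) m i * cofactors i l * (?P l / e\<^sup>2))"
      by (simp add: reduced_def sum_distrib_left mult.assoc)
    also have "\<dots> = (\<Sum>l<codim. (\<Sum>i<codim. jac (origin {1..n}) m i * cofactors i l) * (?P l / e\<^sup>2))"
      by (subst sum.swap) (simp only: sum_distrib_right)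
    also have "\<dots> = (\<Sum>l<codim. if l = m then e * (?P l / e\<^sup>2) else 0)"
      using cofactors(3)[OF m] by (intro sum.cong) auto
    also have "\<dots> = e * (?P m / e\<^sup>2)" using m by simp
    finally show ?thesis using e_nonzero by simp
  qed
  moreover have "i - (r + 1) < codim" "r + 1 + (i - (r + 1)) = i" if "i \<in> {r + 1..n}" for i
    using that by auto
  ultimately have "mpoly_eval (p i) (point u z) = 0" if "i \<in> {r + 1..n}" for i
    using that by metis
  then show ?thesis using z(1) by blast
qed

text \<open>Both vectors are fed into the system of \<open>u\<close>: \<open>z\<close> is an exact
  zero of it, and \<open>z'\<close> an approximate one because \<open>p\<close> changes by a
  multiple of \<open>s\<close> when \<open>u'\<close> is replaced by \<open>u\<close>. Then
  \<open>isometry\<close> compares them.\<close>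

lemma solution_lipschitz:
  assumes u: "admissible u" "admissible u'" and z: "z \<in> small_vectors" "z' \<in> small_vectors"
    and zero: "\<And>i. i \<in> {r + 1..n} \<Longrightarrow> mpoly_eval (p i) (point u z) = 0"
      "\<And>i. i \<in> {r + 1..n} \<Longrightarrow> mpoly_eval (p i) (point u' z') = 0"
    and s: "s \<in> R" "\<And>k. k \<in> {1..r} \<Longrightarrow> u' k - u k \<in> principal s" and j: "j < codim"
  shows "z' j - z j \<in> principal (s / e\<^sup>2)"
proof -
  interpret hensel_system R codim "reduced u" "reduced_jac u" "{z. \<forall>i<codim. z i \<in> maximal_ideal}"
    by (rule reduced_hensel_system[OF u(1)])
  show ?thesis
  proof (rule isometry[OF _ _ _ j])
    fix i assume i: "i < codim"
    have diff: "mpoly_eval (p (r + 1 + l)) (point u z') - mpoly_eval (p (r + 1 + l)) (point u' z') \<in> principal s"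
      if l: "l < codim" for l
    proof (rule mpoly_eval_congruent[OF p_over[OF p_index[OF l]] _ s(1) point_mem[OF u(2) z(2)]])
      fix k assume k: "k \<in> {1..n}"
      then show "point u z' k - point u' z' k \<in> principal s"
        using uminus_principal[OF s(2)[of k]] by (auto simp: point_def zero_principal)
    qed simp_all
    then have "mpoly_eval (p (r + 1 + l)) (point u z') / e\<^sup>2 \<in> principal (s / e\<^sup>2)" if l: "l < codim" for l
      using diff[OF l] zero(2)[OF p_index[OF l]] e_nonzero by (intro divide_principal) simp_all
    then have "(\<Sum>l<codim. cofactors i l * (mpoly_eval (p (r + 1 + l)) (point u z') / e\<^sup>2)) \<in> principal (s / e\<^sup>2)"
      using cofactors(1)[OF i] by (intro sum_principal mult_principal_left) auto
    moreover have "reduced u i z = 0" using zero(1) p_index by (simp add: reduced_def)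
    ultimately show "reduced u i z' - reduced u i z \<in> principal (s / e\<^sup>2)"
      by (simp add: reduced_def)
  qed (use z in \<open>auto simp: small_vectors_def\<close>)
qed

end

section \<open>Valuation topology and definability\<close>

locale valued_field =
  fixes v :: "'k::field \<Rightarrow> 'g::linordered_ab_group_add"
  assumes valuation: "valuation v"
begin

lemma v_mult: "x \<noteq> 0 \<Longrightarrow> y \<noteq> 0 \<Longrightarrow> v (x * y) = v x + v y"
  using valuation by (simp add: valuation_def)

lemma v_add: "x \<noteq> 0 \<Longrightarrow> y \<noteq> 0 \<Longrightarrow> x + y \<noteq> 0 \<Longrightarrow> min (v x) (v y) \<le> v (x + y)"
  using valuation by (simp add: valuation_def)

lemma v_one: "v 1 = 0"
  using v_mult[of 1 1] by simp

lemma v_minus: "v (- x) = v x"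
proof (cases "x = 0")
  case False
  have "v (- 1) + v (- 1) = 0" using v_mult[of "-1" "-1"] by (simp add: v_one)
  then have "v (- 1) = 0" by (simp only: double_zero)
  then show ?thesis using v_mult[of "-1" x] False by simp
qed simp

lemma v_inverse: "x \<noteq> 0 \<Longrightarrow> v (inverse x) = - v x"
  using v_mult[of x "inverse x"] by (simp add: v_one add_eq_0_iff)

sublocale valuation_subring "valuation_ring v"
proof
  show "1 \<in> valuation_ring v" by (simp add: valuation_ring_def v_one)
next
  fix a b assume ab: "a \<in> valuation_ring v" "b \<in> valuation_ring v"
  show "a - b \<in> valuation_ring v"
  proof (cases "a = 0 \<or> b = 0 \<or> a - b = 0")
    case True
    then show ?thesis using ab by (auto simp: valuation_ring_def v_minus)
  next
    case False
    then have "min (v a) (v b) \<le> v (a - b)" using v_add[of a "- b"] by (simp add: v_minus)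
    moreover have "0 \<le> min (v a) (v b)" using False ab by (simp add: valuation_ring_def)
    ultimately have "0 \<le> v (a - b)" by (rule order_trans[rotated])
    then show ?thesis by (simp add: valuation_ring_def)
  qed
  show "a * b \<in> valuation_ring v"
    using ab v_mult[of a b] by (cases "a = 0 \<or> b = 0") (auto simp: valuation_ring_def)
next
  fix a
  show "a \<in> valuation_ring v \<or> inverse a \<in> valuation_ring v"
    by (cases "a = 0") (auto simp: valuation_ring_def v_inverse)
qed

lemma maximal_ideal_eq: "maximal_ideal = valuation_ideal v"
  unfolding maximal_ideal_def by (auto simp: valuation_ideal_def valuation_ring_def v_inverse)

text \<open>The strict inequality in the balls makes them translates of multiples of the maximal
  ideal, so the topology can be handled through divisibility as well.\<close>

lemma valuation_ball_eq:
  assumes "c \<noteq> 0"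
  shows "valuation_ball v a (v c) = {x. (x - a) / c \<in> maximal_ideal}"
proof -
  have "y = 0 \<or> v c < v y \<longleftrightarrow> y / c = 0 \<or> 0 < v (y / c)" for y
  proof (cases "y = 0")
    case False
    then have "v (y / c) = v y - v c"
      using assms v_mult[of y "inverse c"] by (simp add: v_inverse divide_inverse)
    then show ?thesis using False assms by simp
  qed simp
  from this[of "x - a" for x] show ?thesis
    unfolding maximal_ideal_eq by (simp add: valuation_ball_def valuation_ideal_def)
qed

lemma openin_valuation_iff:
  "openin (valuation_topology v) U \<longleftrightarrow>
    (\<forall>a\<in>U. \<exists>c. c \<noteq> 0 \<and> {x. (x - a) / c \<in> maximal_ideal} \<subseteq> U)"
  unfolding openin_valuation_topology by (auto simp: valuation_ball_eq)

text \<open>By the ultrametric inequality every point of the ball is a centre of it.\<close>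

lemma openin_ball:
  assumes "c \<noteq> 0"
  shows "openin (valuation_topology v) {x. (x - a) / c \<in> maximal_ideal}"
  unfolding openin_valuation_iff
proof
  fix b assume b: "b \<in> {x. (x - a) / c \<in> maximal_ideal}"
  have "(x - a) / c \<in> maximal_ideal" if "(x - b) / c \<in> maximal_ideal" for x
    using add_maximal_ideal[OF that, of "(b - a) / c"] b by (simp flip: add_divide_distrib)
  then show "\<exists>d. d \<noteq> 0 \<and> {x. (x - b) / d \<in> maximal_ideal} \<subseteq> {x. (x - a) / c \<in> maximal_ideal}"
    using assms by auto
qed

text \<open>Since \<open>I\<close> is finite, a product of balls is open in the product topology;
  one radius \<open>d\<close> serves all coordinates.\<close>

lemma continuous_map_affine:
  assumes I: "finite I" and D: "D \<subseteq> extensional I" and f: "f ` D \<subseteq> extensional J"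
    and close: "\<And>u c. u \<in> D \<Longrightarrow> c \<noteq> 0 \<Longrightarrow> \<exists>d. d \<noteq> 0 \<and> (\<forall>u'\<in>D.
      (\<forall>i\<in>I. (u' i - u i) / d \<in> maximal_ideal) \<longrightarrow> (\<forall>j\<in>J. (f u' j - f u j) / c \<in> maximal_ideal))"
  shows "continuous_map (subtopology (affine_topology v I) D) (affine_topology v J) f"
proof -
  let ?T = "subtopology (affine_topology v I) D"
  have top: "topspace ?T = D" using D by (auto simp: PiE_def)
  have "continuous_map ?T (valuation_topology v) (\<lambda>u. f u j)" if j: "j \<in> J" for j
    unfolding continuous_map
  proof (intro conjI allI impI)
    fix U assume U: "openin (valuation_topology v) U"
    show "openin ?T {u \<in> topspace ?T. f u j \<in> U}"
    proof (subst openin_subopen, intro ballI)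
      fix u assume u: "u \<in> {u \<in> topspace ?T. f u j \<in> U}"
      then have uD: "u \<in> D" using top by blast
      obtain c where c: "c \<noteq> 0" "{x. (x - f u j) / c \<in> maximal_ideal} \<subseteq> U"
        using U u unfolding openin_valuation_iff by blast
      obtain d where d: "d \<noteq> 0" "\<And>u'. u' \<in> D \<Longrightarrow> \<forall>i\<in>I. (u' i - u i) / d \<in> maximal_ideal \<Longrightarrow>
          \<forall>j\<in>J. (f u' j - f u j) / c \<in> maximal_ideal"
        using close[OF uD c(1)] by blast
      let ?B = "\<Pi>\<^sub>E i\<in>I. {x. (x - u i) / d \<in> maximal_ideal}"
      have "openin (affine_topology v I) ?B"
        using I openin_ball[OF d(1)] by (simp add: openin_PiE)
      then have "openin ?T (?B \<inter> D)" by (rule openin_subtopology_Int)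
      moreover have "u \<in> ?B \<inter> D"
        using uD D by (auto simp: PiE_iff zero_maximal_ideal)
      moreover have "?B \<inter> D \<subseteq> {u \<in> topspace ?T. f u j \<in> U}"
      proof
        fix u' assume u': "u' \<in> ?B \<inter> D"
        then have "\<forall>i\<in>I. (u' i - u i) / d \<in> maximal_ideal" by (auto simp: PiE_iff)
        then have "(f u' j - f u j) / c \<in> maximal_ideal" using d(2) u' j by blast
        then show "u' \<in> {u \<in> topspace ?T. f u j \<in> U}" using c(2) u' top by blast
      qed
      ultimately show "\<exists>T. openin ?T T \<and> u \<in> T \<and> T \<subseteq> {u \<in> topspace ?T. f u j \<in> U}" by blast
    qed
  qed simp
  then show ?thesis
    using f top by (auto simp: continuous_map_componentwise)
qed

section \<open>Definable terms and predicates\<close>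

definition definable_predicate :: "nat set \<Rightarrow> ((nat \<Rightarrow> 'k) \<Rightarrow> bool) \<Rightarrow> bool" where
  "definable_predicate I P \<longleftrightarrow> (\<exists>F. vf_free_vars F \<subseteq> I \<and> (\<forall>x. vf_sat v F x \<longleftrightarrow> P x))"

text \<open>As for predicates, definability is a property of functions of assignments, so that
  closure rules build the defining formula implicitly.\<close>

definition definable_term :: "nat set \<Rightarrow> ((nat \<Rightarrow> 'k) \<Rightarrow> 'k) \<Rightarrow> bool" where
  "definable_term I f \<longleftrightarrow> (\<exists>t. vf_term_vars t \<subseteq> I \<and> (\<forall>x. vf_term_val t x = f x))"

lemma definable_term_var: "i \<in> I \<Longrightarrow> definable_term I (\<lambda>x. x i)"
  unfolding definable_term_def by (rule exI[of _ "Var i"]) simp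

lemma definable_term_const: "definable_term I (\<lambda>_. c)"
  unfolding definable_term_def by (rule exI[of _ "Const c"]) simp

lemma definable_term_add:
  assumes "definable_term I f" "definable_term I g"
  shows "definable_term I (\<lambda>x. f x + g x)"
proof -
  obtain s t where "vf_term_vars s \<subseteq> I" "\<forall>x. vf_term_val s x = f x"
    "vf_term_vars t \<subseteq> I" "\<forall>x. vf_term_val t x = g x"
    using assms unfolding definable_term_def by blast
  then show ?thesis unfolding definable_term_def by (intro exI[of _ "Plus s t"]) simp
qed

lemma definable_term_mult:
  assumes "definable_term I f" "definable_term I g"
  shows "definable_term I (\<lambda>x. f x * g x)"
proof -
  obtain s t where "vf_term_vars s \<subseteq> I" "\<forall>x. vf_term_val s x = f x"
    "vf_term_vars t \<subseteq> I" "\<forall>x. vf_term_val t x = g x"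
    using assms unfolding definable_term_def by blast
  then show ?thesis unfolding definable_term_def by (intro exI[of _ "Times s t"]) simp
qed

lemma definable_term_power: "definable_term I f \<Longrightarrow> definable_term I (\<lambda>x. f x ^ m)"
  by (induction m) (simp_all add: definable_term_const definable_term_mult)

lemma definable_term_sum:
  "(\<And>a. a \<in> A \<Longrightarrow> definable_term I (f a)) \<Longrightarrow> definable_term I (\<lambda>x. \<Sum>a\<in>A. f a x)"
  by (induction A rule: infinite_finite_induct) (simp_all add: definable_term_const definable_term_add)

lemma definable_term_prod:
  "(\<And>a. a \<in> A \<Longrightarrow> definable_term I (f a)) \<Longrightarrow> definable_term I (\<lambda>x. \<Prod>a\<in>A. f a x)"
  by (induction A rule: infinite_finite_induct) (simp_all add: definable_term_const definable_term_mult)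

lemma definable_term_mpoly_eval:
  assumes "f \<in> mpolys_over S I"
  shows "definable_term I (mpoly_eval f)"
  unfolding mpoly_eval_def[abs_def] using assms
  by (intro definable_term_sum definable_term_mult definable_term_const definable_term_prod
      definable_term_power definable_term_var) (auto simp: mpolys_over_def)

lemma definable_conj:
  assumes "definable_predicate I P" "definable_predicate I Q"
  shows "definable_predicate I (\<lambda>x. P x \<and> Q x)"
proof -
  obtain F G where "vf_free_vars F \<subseteq> I" "\<forall>x. vf_sat v F x \<longleftrightarrow> P x"
    "vf_free_vars G \<subseteq> I" "\<forall>x. vf_sat v G x \<longleftrightarrow> Q x"
    using assms unfolding definable_predicate_def by blast
  then show ?thesis unfolding definable_predicate_def by (intro exI[of _ "Conj F G"]) simp
qed

lemma definable_ball:
  assumes "finite A" "\<And>a. a \<in> A \<Longrightarrow> definable_predicate I (P a)"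
  shows "definable_predicate I (\<lambda>x. \<forall>a\<in>A. P a x)"
  using assms
proof (induction A rule: finite_induct)
  case empty
  show ?case
    unfolding definable_predicate_def by (rule exI[of _ "Equal (Const 0) (Const 0)"]) simp
next
  case (insert a A)
  then have "definable_predicate I (\<lambda>x. P a x \<and> (\<forall>a\<in>A. P a x))"
    by (intro definable_conj) auto
  then show ?case by simp
qed

lemma definable_zero:
  assumes "definable_term I f"
  shows "definable_predicate I (\<lambda>x. f x = 0)"
proof -
  obtain t where "vf_term_vars t \<subseteq> I" "\<forall>x. vf_term_val t x = f x"
    using assms unfolding definable_term_def by blast
  then show ?thesis
    unfolding definable_predicate_def by (intro exI[of _ "Equal t (Const 0)"]) simp
qed

text \<open>An element of the valuation ring lies in the maximal ideal unless it has an inverse in the ring;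
  the bound variable that stands for this inverse only has to differ from \<open>i\<close>.\<close>

lemma definable_maximal_ideal:
  assumes "i \<in> I"
  shows "definable_predicate I (\<lambda>x. x i / c \<in> maximal_ideal)"
proof -
  let ?t = "Times (Var i) (Const (inverse c))"
  let ?F = "Conj (InRing ?t) (Neg (Exists (Suc i)
    (Conj (InRing (Var (Suc i))) (Equal (Times (Var (Suc i)) ?t) (Const 1)))))"
  have "vf_sat v ?F x \<longleftrightarrow> x i / c \<in> maximal_ideal" for x
  proof -
    have inv: "(\<exists>w. w \<in> valuation_ring v \<and> w * a = 1) \<longleftrightarrow> a \<noteq> 0 \<and> inverse a \<in> valuation_ring v" for a
      using inverse_unique[of a] by (force simp: mult.commute)
    show ?thesis
      using inv[of "x i * inverse c"] by (auto simp: maximal_ideal_def divide_inverse)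
  qed
  moreover have "vf_free_vars ?F \<subseteq> I" using assms by auto
  ultimately show ?thesis unfolding definable_predicate_def by blast
qed

end

section \<open>The implicit function on the valued field\<close>

locale valued_implicit_system = valued_field v + implicit_system "valuation_ring v" r n p e
  for v :: "'k::field \<Rightarrow> 'g::linordered_ab_group_add" and r n p e

context valued_implicit_system
begin

context
  notes One_nat_def [simp del]
begin

definition zeros :: "(nat \<Rightarrow> 'k) set" where
  "zeros = {x \<in> {1..n} \<rightarrow>\<^sub>E valuation_ring v. \<forall>i\<in>{r + 1..n}. mpoly_eval (p i) x = 0}"

definition domain :: "(nat \<Rightarrow> 'k) set" where
  "domain = {1..r} \<rightarrow>\<^sub>E (\<lambda>a. e\<^sup>2 * a) ` valuation_ideal v"

definition target :: "(nat \<Rightarrow> 'k) set" where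
  "target = {r + 1..n} \<rightarrow>\<^sub>E (\<lambda>a. e * a) ` valuation_ideal v"

lemma scaled_ideal: "c \<noteq> 0 \<Longrightarrow> (\<lambda>a. c * a) ` valuation_ideal v = {x. x / c \<in> maximal_ideal}"
  unfolding maximal_ideal_eq[symmetric] by force

lemma domain_iff: "u \<in> domain \<longleftrightarrow> u \<in> extensional {1..r} \<and> admissible u"
  using e_nonzero by (auto simp: domain_def scaled_ideal PiE_iff admissible_def)

lemma target_iff: "y \<in> target \<longleftrightarrow> y \<in> extensional {r + 1..n} \<and> (\<forall>j\<in>{r + 1..n}. y j / e \<in> maximal_ideal)"
  using e_nonzero by (auto simp: target_def scaled_ideal PiE_iff)

text \<open>Inverts the substitution made by \<open>point\<close>, so that estimates about solutions
  \<open>z\<close> apply to any zero in the box.\<close>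

definition tail :: "(nat \<Rightarrow> 'k) \<Rightarrow> nat \<Rightarrow> 'k" where
  "tail x j = x (Suc r + j) / e"

lemma point_tail: "point x (tail x) = x"
  using e_nonzero by (auto simp: point_def tail_def)

definition in_box :: "(nat \<Rightarrow> 'k) \<Rightarrow> bool" where
  "in_box x \<longleftrightarrow> admissible x \<and> (\<forall>j\<in>{r + 1..n}. x j / e \<in> maximal_ideal)"

lemma tail_small: "in_box x \<Longrightarrow> tail x \<in> small_vectors"
  by (auto simp: in_box_def tail_def small_vectors_def)

text \<open>Undoing the substitution multiplies the bound \<open>s / e\<^sup>2\<close> of
  \<open>solution_lipschitz\<close> by \<open>e\<close>.\<close>

lemma zeros_lipschitz:
  assumes x: "in_box x" "in_box x'"
    and zero: "\<And>i. i \<in> {r + 1..n} \<Longrightarrow> mpoly_eval (p i) x = 0"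
      "\<And>i. i \<in> {r + 1..n} \<Longrightarrow> mpoly_eval (p i) x' = 0"
    and s: "s \<in> valuation_ring v" "\<And>k. k \<in> {1..r} \<Longrightarrow> x' k - x k \<in> principal s" and j: "j \<in> {r + 1..n}"
  shows "x' j - x j \<in> principal (s / e)"
proof -
  have "tail x' (j - Suc r) - tail x (j - Suc r) \<in> principal (s / e\<^sup>2)"
    using x zero s j tail_small
    by (intro solution_lipschitz[of x x']) (auto simp: point_tail in_box_def)
  then have "e * (tail x' (j - Suc r) - tail x (j - Suc r)) \<in> principal (e * (s / e\<^sup>2))"
    using principal_mult_cancel[OF e_nonzero] by blast
  then show ?thesis
    using j e_nonzero by (simp add: tail_def right_diff_distrib power2_eq_square)
qed

text \<open>The Lipschitz estimate with \<open>s = 0\<close>.\<close>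

lemma zeros_unique:
  assumes "in_box x" "in_box x'"
    "\<And>i. i \<in> {r + 1..n} \<Longrightarrow> mpoly_eval (p i) x = 0" "\<And>i. i \<in> {r + 1..n} \<Longrightarrow> mpoly_eval (p i) x' = 0"
    "\<And>k. k \<in> {1..r} \<Longrightarrow> x' k = x k" "j \<in> {r + 1..n}"
  shows "x' j = x j"
  using zeros_lipschitz[OF assms(1-4) zero_mem _ assms(6)] assms(5)
  by (simp add: principal_zero zero_principal)

definition join :: "(nat \<Rightarrow> 'k) \<Rightarrow> (nat \<Rightarrow> 'k) \<Rightarrow> nat \<Rightarrow> 'k" where
  "join u y = merge {1..r} {r + 1..n} (u, y)"

lemma join_left: "i \<in> {1..r} \<Longrightarrow> join u y i = u i"
  by (simp add: join_def merge_def)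

lemma join_right: "i \<in> {r + 1..n} \<Longrightarrow> join u y i = y i"
  by (auto simp: join_def merge_def)

lemma index_union: "{1..r} \<union> {r + 1..n} = {1..n}"
  using rn by auto

lemma join_extensional: "join u y \<in> extensional {1..n}"
  using index_union by (auto simp: join_def merge_def extensional_def)

lemma join_in_box: "u \<in> domain \<Longrightarrow> y \<in> target \<Longrightarrow> in_box (join u y)"
  by (simp add: in_box_def admissible_def domain_iff target_iff join_left join_right)

lemma in_box_mem: "in_box x \<Longrightarrow> k \<in> {1..n} \<Longrightarrow> x k \<in> valuation_ring v"
  using point_mem[of x "tail x" k] tail_small[of x] by (simp add: in_box_def point_tail)

text \<open>Points of the box have all their coordinates in the valuation ring, so only the
  equations remain.\<close>

lemma join_in_zeros:
  assumes "u \<in> domain" "y \<in> target"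
  shows "join u y \<in> zeros \<longleftrightarrow> (\<forall>i\<in>{r + 1..n}. mpoly_eval (p i) (join u y) = 0)"
  using in_box_mem[OF join_in_box[OF assms]] join_extensional by (simp add: zeros_def PiE_iff)

lemma join_unique:
  assumes "u \<in> domain" "y \<in> target" "y' \<in> target" "join u y \<in> zeros" "join u y' \<in> zeros"
  shows "y' = y"
proof (rule extensionalityI[of _ "{r + 1..n}"])
  fix j assume j: "j \<in> {r + 1..n}"
  have "join u y' j = join u y j"
  proof (rule zeros_unique[OF join_in_box[OF assms(1,2)] join_in_box[OF assms(1,3)] _ _ _ j])
    show "mpoly_eval (p i) (join u y) = 0" "mpoly_eval (p i) (join u y') = 0" if "i \<in> {r + 1..n}" for i
      using assms(4,5) that by (auto simp: zeros_def)
  qed (simp add: join_left)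
  then show "y' j = y j" using join_right[OF j] by simp
qed (use assms in \<open>auto simp: target_iff\<close>)

lemma join_exists:
  assumes u: "u \<in> domain"
  shows "\<exists>y\<in>target. join u y \<in> zeros"
proof -
  have "admissible u" using u by (simp add: domain_iff)
  then obtain z where z: "z \<in> small_vectors" "\<And>i. i \<in> {r + 1..n} \<Longrightarrow> mpoly_eval (p i) (point u z) = 0"
    using solution_exists by blast
  define y where "y = restrict (point u z) {r + 1..n}"
  have y: "y \<in> target"
    using z(1) e_nonzero by (auto simp: target_iff y_def point_def small_vectors_def)
  have eq: "join u y k = point u z k" if "k \<in> {1..n}" for k
  proof (cases "k \<le> r")
    case True
    then show ?thesis using that by (simp add: join_left point_def)
  next
    case False
    then show ?thesis using that by (simp add: join_right y_def)
  qed
  have "mpoly_eval (p i) (join u y) = 0" if "i \<in> {r + 1..n}" for i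
    using mpoly_eval_cong[OF p_over[OF that] eq] z(2)[OF that] by simp
  then show ?thesis using join_in_zeros[OF u y] y by blast
qed

text \<open>Restricted to \<open>domain\<close>, since uniqueness is claimed among extensional
  functions. By \<open>join_unique\<close> there is only one value to choose.\<close>

definition implicit_map :: "(nat \<Rightarrow> 'k) \<Rightarrow> nat \<Rightarrow> 'k" where
  "implicit_map = (\<lambda>u\<in>domain. SOME y. y \<in> target \<and> join u y \<in> zeros)"

lemma implicit_map:
  assumes "u \<in> domain"
  shows "implicit_map u \<in> target" "join u (implicit_map u) \<in> zeros"
proof -
  have "\<exists>y. y \<in> target \<and> join u y \<in> zeros" using join_exists[OF assms] by blast
  from someI_ex[OF this] show "implicit_map u \<in> target" "join u (implicit_map u) \<in> zeros"
    using assms by (simp_all add: implicit_map_def)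
qed

definition graph :: "(nat \<Rightarrow> 'k) \<Rightarrow> nat \<Rightarrow> 'k" where
  "graph u = join u (implicit_map u)"

lemma graph_eq_graph_map: "graph = graph_map {1..r} {r + 1..n} implicit_map"
  by (simp add: fun_eq_iff graph_def graph_map_def join_def)

lemma graph_in_box: "u \<in> domain \<Longrightarrow> in_box (graph u)"
  by (simp add: graph_def join_in_box implicit_map)

lemma graph_in_zeros: "u \<in> domain \<Longrightarrow> graph u \<in> zeros"
  by (simp add: graph_def implicit_map)

lemma domain_mem:
  assumes "u \<in> domain" "k \<in> {1..r}"
  shows "u k \<in> valuation_ring v"
  using in_box_mem[OF graph_in_box[OF assms(1)], of k] assms(2) rn by (simp add: graph_def join_left)

text \<open>Passing to the implicit coordinates costs a factor \<open>e\<close>, so the arguments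
  have to be close relative to \<open>c * e\<close>.\<close>

lemma graph_close:
  assumes u: "u \<in> domain" "u' \<in> domain" and c: "c \<noteq> 0"
    and close: "\<And>i. i \<in> {1..r} \<Longrightarrow> (u' i - u i) / (c * e) \<in> maximal_ideal" and j: "j \<in> {1..n}"
  shows "(graph u' j - graph u j) / c \<in> maximal_ideal"
proof -
  \<comment> \<open>\<open>s\<close> is the largest difference of the first coordinates; for
    \<open>r = 0\<close> there is none and \<open>s = 0\<close>.\<close>
  obtain s where s: "s \<in> valuation_ring v" "\<And>k. k \<in> {1..r} \<Longrightarrow> u' k - u k \<in> principal s"
    "s / (c * e) \<in> maximal_ideal"
  proof (cases "{1..r} = {}")
    case True
    then show ?thesis using that[of 0] by (simp add: zero_mem zero_maximal_ideal)
  next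
    case False
    then obtain k where "k \<in> {1..r}" "\<And>i. i \<in> {1..r} \<Longrightarrow> u' i - u i \<in> principal (u' k - u k)"
      using principal_maximum[of "{1..r}" "\<lambda>i. u' i - u i"] by blast
    then show ?thesis using that[of "u' k - u k"] close domain_mem u by (simp add: diff_mem)
  qed
  show ?thesis
  proof (cases "j \<le> r")
    case True
    then have "j \<in> {1..r}" using j by simp
    from mult_maximal_ideal[OF e_mem close[OF this]] show ?thesis
      using \<open>j \<in> {1..r}\<close> e_nonzero by (simp add: graph_def join_left)
  next
    case False
    then have j': "j \<in> {r + 1..n}" using j by simp
    have "graph u' j - graph u j \<in> principal (s / e)"
    proof (rule zeros_lipschitz[OF graph_in_box[OF u(1)] graph_in_box[OF u(2)] _ _ s(1) _ j'])
      show "mpoly_eval (p i) (graph u) = 0" "mpoly_eval (p i) (graph u') = 0" if "i \<in> {r + 1..n}" for i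
        using graph_in_zeros u that by (auto simp: zeros_def)
      show "graph u' k - graph u k \<in> principal s" if "k \<in> {1..r}" for k
        using s(2)[OF that] that by (simp add: graph_def join_left)
    qed
    then obtain b where b: "b \<in> valuation_ring v" "graph u' j - graph u j = s / e * b"
      by (auto simp: principal_def)
    have "s / (c * e) * b \<in> maximal_ideal" using s(3) b(1) by (rule mult_maximal_ideal')
    also have "s / (c * e) * b = (graph u' j - graph u j) / c" by (simp add: b(2) mult_ac)
    finally show ?thesis .
  qed
qed

section \<open>Continuity, openness and definability\<close>

abbreviation domain_topology :: "(nat \<Rightarrow> 'k) topology" where
  "domain_topology \<equiv> subtopology (affine_topology v {1..r}) domain"

abbreviation zeros_topology :: "(nat \<Rightarrow> 'k) topology" where
  "zeros_topology \<equiv> subtopology (affine_topology v {1..n}) zeros"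

lemma topspace_domain: "topspace domain_topology = domain"
  by (auto simp: domain_iff PiE_def)

lemma implicit_map_continuous:
  "continuous_map domain_topology (subtopology (affine_topology v {r + 1..n}) target) implicit_map"
proof (rule continuous_map_into_subtopology)
  show "continuous_map domain_topology (affine_topology v {r + 1..n}) implicit_map"
  proof (rule continuous_map_affine)
    fix u c assume uc: "u \<in> domain" "c \<noteq> (0 :: 'k)"
    have "\<forall>u'\<in>domain. (\<forall>i\<in>{1..r}. (u' i - u i) / (c * e) \<in> maximal_ideal) \<longrightarrow>
        (\<forall>j\<in>{r + 1..n}. (implicit_map u' j - implicit_map u j) / c \<in> maximal_ideal)"
    proof (intro ballI impI)
      fix u' j assume *: "u' \<in> domain" "\<forall>i\<in>{1..r}. (u' i - u i) / (c * e) \<in> maximal_ideal"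
        "j \<in> {r + 1..n}"
      then have "(graph u' j - graph u j) / c \<in> maximal_ideal"
        using uc by (intro graph_close) auto
      then show "(implicit_map u' j - implicit_map u j) / c \<in> maximal_ideal"
        using *(3) by (simp add: graph_def join_right)
    qed
    then show "\<exists>d. d \<noteq> 0 \<and> (\<forall>u'\<in>domain. (\<forall>i\<in>{1..r}. (u' i - u i) / d \<in> maximal_ideal) \<longrightarrow>
        (\<forall>j\<in>{r + 1..n}. (implicit_map u' j - implicit_map u j) / c \<in> maximal_ideal))"
      using uc(2) e_nonzero by (intro exI[of _ "c * e"]) simp
  qed (use implicit_map(1) in \<open>auto simp: domain_iff target_iff\<close>)
  show "implicit_map \<in> topspace domain_topology \<rightarrow> target"
    using implicit_map(1) topspace_domain by auto
qed

lemma graph_continuous: "continuous_map domain_topology zeros_topology graph"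
proof (rule continuous_map_into_subtopology)
  show "continuous_map domain_topology (affine_topology v {1..n}) graph"
  proof (rule continuous_map_affine)
    fix u c assume uc: "u \<in> domain" "c \<noteq> (0 :: 'k)"
    then show "\<exists>d. d \<noteq> 0 \<and> (\<forall>u'\<in>domain. (\<forall>i\<in>{1..r}. (u' i - u i) / d \<in> maximal_ideal) \<longrightarrow>
        (\<forall>j\<in>{1..n}. (graph u' j - graph u j) / c \<in> maximal_ideal))"
      using graph_close[of u] e_nonzero by (intro exI[of _ "c * e"]) simp
  qed (use join_extensional in \<open>auto simp: domain_iff graph_def\<close>)
  show "graph \<in> topspace domain_topology \<rightarrow> zeros"
    unfolding topspace_domain using implicit_map(2) by (auto simp: graph_def)
qed

lemma restrict_continuous:
  assumes "I \<subseteq> {1..n}"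
  shows "continuous_map (affine_topology v {1..n}) (affine_topology v I) (\<lambda>x. restrict x I)"
  using assms by (auto simp: continuous_map_componentwise intro!: continuous_map_product_projection)

lemma openin_scaled: "c \<noteq> 0 \<Longrightarrow> openin (valuation_topology v) ((\<lambda>a. c * a) ` valuation_ideal v)"
  using openin_ball[of c 0] by (simp add: scaled_ideal)

lemma domain_open: "openin (affine_topology v {1..r}) domain"
  unfolding domain_def using openin_scaled e_nonzero by (simp add: openin_PiE)

lemma target_open: "openin (affine_topology v {r + 1..n}) target"
  unfolding target_def using openin_scaled e_nonzero by (simp add: openin_PiE)

lemma restrict_join:
  assumes "u \<in> domain" "y \<in> target"
  shows "restrict (join u y) {1..r} = u" "restrict (join u y) {r + 1..n} = y"
proof -
  show "restrict (join u y) {1..r} = u"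
    using assms by (intro extensionalityI[of _ "{1..r}"]) (auto simp: domain_iff join_left)
  show "restrict (join u y) {r + 1..n} = y"
    using assms by (intro extensionalityI[of _ "{r + 1..n}"]) (auto simp: target_iff join_right)
qed

lemma join_restrict:
  assumes "x \<in> extensional {1..n}"
  shows "join (restrict x {1..r}) (restrict x {r + 1..n}) = x"
proof (rule extensionalityI[of _ "{1..n}"])
  fix i assume "i \<in> {1..n}"
  then show "join (restrict x {1..r}) (restrict x {r + 1..n}) i = x i"
    unfolding index_union[symmetric] by (auto simp: join_left join_right)
qed (use assms join_extensional in auto)

text \<open>By uniqueness a zero in the box is the graph point above its first coordinates. Images
  under the graph map are thus described by coordinate restrictions alone.\<close>

lemma graph_image:
  assumes "U \<subseteq> domain"
  shows "graph ` U = zeros \<inter> {x. restrict x {1..r} \<in> U \<and> restrict x {r + 1..n} \<in> target}"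
proof (intro equalityI subsetI)
  fix x assume "x \<in> graph ` U"
  then obtain u where u: "u \<in> U" "x = graph u" by blast
  then show "x \<in> zeros \<inter> {x. restrict x {1..r} \<in> U \<and> restrict x {r + 1..n} \<in> target}"
    using assms implicit_map[of u] by (auto simp: graph_def restrict_join)
next
  fix x assume x: "x \<in> zeros \<inter> {x. restrict x {1..r} \<in> U \<and> restrict x {r + 1..n} \<in> target}"
  let ?u = "restrict x {1..r}" and ?y = "restrict x {r + 1..n}"
  have eq: "join ?u ?y = x" using x by (intro join_restrict) (auto simp: zeros_def PiE_def)
  have u: "?u \<in> domain" using x assms by blast
  have "?y = implicit_map ?u"
    using x u eq by (intro join_unique[of ?u] implicit_map) auto
  then have "graph ?u = x" using eq by (simp add: graph_def)
  then show "x \<in> graph ` U" using x by (metis (no_types, lifting) IntE imageI mem_Collect_eq)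
qed

text \<open>By \<open>graph_image\<close> the image of an open set is cut out of the zero locus by
  preimages of open sets under the continuous restriction maps; \<open>U\<close> is open in the
  whole space because \<open>domain\<close> is.\<close>

lemma graph_open: "open_map domain_topology zeros_topology graph"
  unfolding open_map_def
proof (intro allI impI)
  fix U assume U: "openin domain_topology U"
  then have UD: "U \<subseteq> domain" using openin_subset topspace_domain by blast
  have "openin (affine_topology v {1..r}) U"
    using U domain_open by (rule openin_trans_full)
  from openin_continuous_map_preimage[OF restrict_continuous this]
  have 1: "openin (affine_topology v {1..n})
      {x \<in> topspace (affine_topology v {1..n}). restrict x {1..r} \<in> U}" using rn by auto
  from openin_continuous_map_preimage[OF restrict_continuous target_open]
  have 2: "openin (affine_topology v {1..n})
      {x \<in> topspace (affine_topology v {1..n}). restrict x {r + 1..n} \<in> target}" by auto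
  from openin_subtopology_Int[OF openin_Int[OF 1 2], of zeros]
  have "openin zeros_topology
      ({x \<in> topspace (affine_topology v {1..n}). restrict x {1..r} \<in> U} \<inter>
       {x \<in> topspace (affine_topology v {1..n}). restrict x {r + 1..n} \<in> target} \<inter> zeros)" .
  also have "\<dots> = graph ` U"
    unfolding graph_image[OF UD] by (auto simp: zeros_def PiE_def)
  finally show "openin zeros_topology (graph ` U)" .
qed

lemma graph_embedding: "embedding_map domain_topology zeros_topology graph"
proof (rule injective_open_imp_embedding_map[OF graph_continuous graph_open])
  show "inj_on graph (topspace domain_topology)"
    unfolding topspace_domain
  proof (rule inj_onI)
    fix u u' assume "u \<in> domain" "u' \<in> domain" "graph u = graph u'"
    then show "u = u'" using restrict_join(1) implicit_map(1) by (metis graph_def)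
  qed
qed

lemma graph_onto: "graph ` domain = zeros \<inter> merge {1..r} {r + 1..n} ` (domain \<times> target)"
proof (intro equalityI subsetI)
  fix x assume "x \<in> graph ` domain"
  then obtain u where "u \<in> domain" "x = graph u" by blast
  then show "x \<in> zeros \<inter> merge {1..r} {r + 1..n} ` (domain \<times> target)"
    using implicit_map[of u] by (auto simp: graph_def join_def)
next
  fix x assume "x \<in> zeros \<inter> merge {1..r} {r + 1..n} ` (domain \<times> target)"
  then obtain u y where "u \<in> domain" "y \<in> target" "x = join u y" "x \<in> zeros"
    by (auto simp: join_def)
  then show "x \<in> graph ` domain"
    unfolding graph_image[OF subset_refl] by (auto simp: restrict_join)
qed

text \<open>The graph is the part of the zero locus in the box, hence given by finitely many
  equations and conditions on scaled coordinates; the box conditions imply membership in the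
  valuation ring.\<close>

lemma implicit_map_definable: "vf_definable_map v {1..r} {r + 1..n} domain implicit_map"
proof -
  let ?P = "\<lambda>x. (\<forall>i\<in>{r + 1..n}. mpoly_eval (p i) x = 0) \<and>
    (\<forall>i\<in>{1..r}. x i / e\<^sup>2 \<in> maximal_ideal) \<and> (\<forall>i\<in>{r + 1..n}. x i / e \<in> maximal_ideal)"
  have "definable_predicate {1..n} ?P"
    using rn by (intro definable_conj definable_ball definable_zero
        definable_term_mpoly_eval[OF p_over] definable_maximal_ideal) auto
  moreover have "graph ` domain = {x \<in> {1..n} \<rightarrow>\<^sub>E UNIV. ?P x}"
  proof (intro equalityI subsetI)
    fix x assume "x \<in> graph ` domain"
    then obtain u where u: "u \<in> domain" "x = graph u" by blast
    then have "in_box x" "x \<in> zeros" using graph_in_box graph_in_zeros by auto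
    then show "x \<in> {x \<in> {1..n} \<rightarrow>\<^sub>E UNIV. ?P x}"
      by (auto simp: in_box_def zeros_def admissible_def PiE_def)
  next
    fix x assume x: "x \<in> {x \<in> {1..n} \<rightarrow>\<^sub>E UNIV. ?P x}"
    then have "in_box x" by (simp add: in_box_def admissible_def)
    then have "x \<in> zeros" using x in_box_mem by (auto simp: zeros_def PiE_def)
    moreover have "restrict x {1..r} \<in> domain" "restrict x {r + 1..n} \<in> target"
      using x by (auto simp: domain_iff target_iff admissible_def)
    ultimately show "x \<in> graph ` domain" unfolding graph_image[OF subset_refl] by blast
  qed
  ultimately show ?thesis
    unfolding vf_definable_map_def vf_definable_def definable_predicate_def index_union
      graph_eq_graph_map[symmetric] by auto
qed

text \<open>The origin lies in the zero locus and in the box, so uniqueness identifies the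
  value.\<close>

lemma implicit_map_origin: "implicit_map (origin {1..r}) = origin {r + 1..n}"
proof -
  have u: "origin {1..r} \<in> domain" and y: "origin {r + 1..n} \<in> target"
    by (auto simp: domain_iff target_iff admissible_def origin_def zero_maximal_ideal)
  have "mpoly_eval (p i) (join (origin {1..r}) (origin {r + 1..n})) = 0" if i: "i \<in> {r + 1..n}" for i
  proof -
    have "join (origin {1..r}) (origin {r + 1..n}) k = origin {1..n} k" if "k \<in> {1..n}" for k
      using that by (auto simp: join_def merge_def origin_def)
    from mpoly_eval_cong[OF p_over[OF i] this] show ?thesis using p_origin[OF i] by simp
  qed
  then have "join (origin {1..r}) (origin {r + 1..n}) \<in> zeros" using join_in_zeros[OF u y] by blast
  then show ?thesis using join_unique[OF u y implicit_map(1)[OF u]] implicit_map(2)[OF u] by blast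
qed

lemma implicit_map_unique:
  assumes f: "f \<in> domain \<rightarrow>\<^sub>E target" and g: "graph_map {1..r} {r + 1..n} f ` domain \<subseteq> zeros"
  shows "f = implicit_map"
proof (rule extensionalityI[of _ domain])
  fix u assume u: "u \<in> domain"
  then have "f u \<in> target" "join u (f u) \<in> zeros"
    using f g by (auto simp: graph_map_def join_def)
  then show "f u = implicit_map u" using u by (intro join_unique[of u] implicit_map)
qed (use f in \<open>auto simp: implicit_map_def PiE_def\<close>)

end

end

theorem proposition2p5:
  fixes v :: "'k::field \<Rightarrow> 'g::linordered_ab_group_add"
    and r n :: nat
    and p :: "nat \<Rightarrow> 'k mpolynomial"
    and R \<mm> :: "'k set"
    and J :: "'k mpolynomial"
    and e :: 'k
    and V D E :: "(nat \<Rightarrow> 'k) set"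
  assumes "valuation v" and "henselian v" and "equichar_zero v"
    and "R = valuation_ring v" and "\<mm> = valuation_ideal v"
    and "r < n"
    and "\<forall>i\<in>{r+1..n}. p i \<in> mpolys_over R {1..n}"
    and "J = jacobian_det r n p"
    and "e = mpoly_eval J (origin {1..n})"
    and "V = {x \<in> {1..n} \<rightarrow>\<^sub>E R. \<forall>i\<in>{r+1..n}. mpoly_eval (p i) x = 0}"
    and "origin {1..n} \<in> V"
    and "e \<noteq> 0"
    and "D = ({1..r} \<rightarrow>\<^sub>E (\<lambda>a. e\<^sup>2 * a) ` \<mm>)"
    and "E = ({r+1..n} \<rightarrow>\<^sub>E (\<lambda>a. e * a) ` \<mm>)"
  shows "\<exists>!\<phi>. \<phi> \<in> D \<rightarrow>\<^sub>E E \<and>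
           continuous_map (subtopology (affine_topology v {1..r}) D)
             (subtopology (affine_topology v {r+1..n}) E) \<phi> \<and>
           vf_definable_map v {1..r} {r+1..n} D \<phi> \<and>
           \<phi> (origin {1..r}) = origin {r+1..n} \<and>
           embedding_map (subtopology (affine_topology v {1..r}) D)
             (subtopology (affine_topology v {1..n}) V) (graph_map {1..r} {r+1..n} \<phi>) \<and>
           open_map (subtopology (affine_topology v {1..r}) D)
             (subtopology (affine_topology v {1..n}) V) (graph_map {1..r} {r+1..n} \<phi>) \<and>
           graph_map {1..r} {r+1..n} \<phi> ` D = V \<inter> merge {1..r} {r+1..n} ` (D \<times> E)"
proof -
  interpret valued_field v by unfold_locales (rule assms(1))
  have "valued_implicit_system v r n p e"
  proof unfold_locales
    fix f a
    assume "integral_poly f" "a \<in> valuation_ring v" "poly f a \<in> maximal_ideal"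
      "poly (pderiv f) a \<notin> maximal_ideal"
    then show "\<exists>b\<in>valuation_ring v. poly f b = 0 \<and> b - a \<in> maximal_ideal"
      using assms(2) unfolding henselian_def integral_poly_def maximal_ideal_eq by blast
  next
    fix m :: nat assume "0 < m"
    then show "of_nat m \<notin> maximal_ideal"
      using assms(3) by (simp add: equichar_zero_def maximal_ideal_eq)
  qed (use assms in auto)
  then interpret valued_implicit_system v r n p e .
  have sets: "V = zeros" "D = domain" "E = target"
    using assms(4,5,10,13,14) by (simp_all add: zeros_def domain_def target_def)
  show ?thesis
    unfolding sets
  proof (rule ex1I[of _ implicit_map])
    show "implicit_map \<in> domain \<rightarrow>\<^sub>E target \<and>
        continuous_map domain_topology (subtopology (affine_topology v {r+1..n}) target) implicit_map \<and>
        vf_definable_map v {1..r} {r+1..n} domain implicit_map \<and>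
        implicit_map (origin {1..r}) = origin {r+1..n} \<and>
        embedding_map domain_topology zeros_topology (graph_map {1..r} {r+1..n} implicit_map) \<and>
        open_map domain_topology zeros_topology (graph_map {1..r} {r+1..n} implicit_map) \<and>
        graph_map {1..r} {r+1..n} implicit_map ` domain = zeros \<inter> merge {1..r} {r+1..n} ` (domain \<times> target)"
      unfolding graph_eq_graph_map[symmetric]
    proof (intro conjI implicit_map_continuous implicit_map_definable implicit_map_origin
        graph_embedding graph_open graph_onto)
      show "implicit_map \<in> domain \<rightarrow>\<^sub>E target"
        using implicit_map(1) by (auto simp: implicit_map_def)
    qed
  next
    fix \<psi>
    assume \<psi>: "\<psi> \<in> domain \<rightarrow>\<^sub>E target \<and>
        continuous_map domain_topology (subtopology (affine_topology v {r+1..n}) target) \<psi> \<and>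
        vf_definable_map v {1..r} {r+1..n} domain \<psi> \<and>
        \<psi> (origin {1..r}) = origin {r+1..n} \<and>
        embedding_map domain_topology zeros_topology (graph_map {1..r} {r+1..n} \<psi>) \<and>
        open_map domain_topology zeros_topology (graph_map {1..r} {r+1..n} \<psi>) \<and>
        graph_map {1..r} {r+1..n} \<psi> ` domain = zeros \<inter> merge {1..r} {r+1..n} ` (domain \<times> target)"
    \<comment> \<open>The condition on the image puts the graph of \<open>\<psi>\<close> into the
      zero locus, which determines it pointwise.\<close>
    show "\<psi> = implicit_map"
      using \<psi> by (intro implicit_map_unique) auto
  qed
qed

end
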